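(* Let $N\ge2$, $R>0$, and let $f:[0,\infty)\to[0,\infty)$ satisfy $(f_1)$, $(f_2)$, $(f_3)$ (listed in the context). Suppose $f$ is super-exponential. Fix $\kappa\ge0$ such that $F(t):=f(t)+\kappa t^{N-1}$ is strictly increasing on $[0,\infty)$. Assume that there is $c>0$ such that $$(f(t))^\lambda\le c\,f(\lambda t)\qquad\text{for all }\lambda>1,\ t\ge0.$$ Then any unbounded solution $u$ of $(P_R^* )$ satisfies: (a) For every $\epsilon>0$ there exists $R_\epsilon\in(0,R)$ such that $u(x)\le F^{-1}(\epsilon|x|^{-N})$ for all $x\in B_{R_\epsilon}\setminus\{0\}$. (b) For every $\epsilon>0$, $$\limsup_{x\to0}\frac{u(x)}{F^{-1}(\epsilon|x|^{-N})}=1.$$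
   Context: $B_R\subset\mathbb R^N$ is the open ball of radius $R$ centred at $0$; $\Delta_N u=\operatorname{div}(|\nabla u|^{N-2}\nabla u)$. $L^\infty_{\rm loc}(\overline B_R\setminus\{0\})$ denotes functions essentially bounded on compact subsets of $\overline B_R\setminus\{0\}$. Standing assumptions on $f$: $(f_1)$ $f$ is locally Hölder continuous on $[0,\infty)$ with some exponent $\theta\in(0,1)$; $(f_2)$ $\liminf_{t\to\infty}f(t)t^{1-N}>0$; $(f_3)$ there is $\kappa>0$ such that $t\mapsto f(t)+\kappa t^{N-1}$ is non-decreasing on $[0,\infty)$. (By $(f_3)$ a $\kappa$ making $F$ strictly increasing exists.) $f$ is sub-exponential if there is $\beta>0$ with $\sup_{t\ge0}f(t)e^{-\beta t}<\infty$; it is super-exponential if it is not sub-exponential. A solution of $(P_R^* )$ is a radial function $u\ge0$ on $B_R\setminus\{0\}$, $u\in L^\infty_{\rm loc}(\overline B_R\setminus\{0\})$, weakly differentiable with $|\nabla u|\in L^{N-1}_{\rm loc}(B_R\setminus\{0\})$, with $-\Delta_N u=f(u)$ in $\mathcal D'(B_R\setminus\{0\})$, i.e. $\int|\nabla u|^{N-2}\nabla u\cdot\nabla\phi\,dx=\int f(u)\phi\,dx$ for all $\phi\in C_0^\infty(B_R\setminus\{0\})$; $u$ is identified with its continuous representative. $F^{-1}$ denotes the inverse function of $F$, defined on $[F(0),\infty)$, so the expressions above make sense for $|x|$ small. (It is known, by Brezis–Lions for $N=2$ and Véron for $N>2$, that every solution $u$ of $(P^*_R)$ lies in $W^{1,p}(B_R)$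 for all $1\le p<N$, has $f(u)\in L^1(B_R)$, and satisfies $-\Delta_Nu=f(u)+\alpha\delta_0$ in $\mathcal D'(B_R)$ for some $\alpha\ge0$.) *)

theory Defs
  imports "HOL-Analysis.Analysis"
begin

definition grad :: "('a::euclidean_space \<Rightarrow> real) \<Rightarrow> 'a \<Rightarrow> 'a" where
  "grad \<phi> x = (\<Sum>b\<in>Basis. frechet_derivative \<phi> (at x) b *\<^sub>R b)"

lemma grad_GDERIV:
  assumes "\<phi> differentiable (at x)"
  shows "GDERIV \<phi> x :> grad \<phi> x"
proof -
  have D: "(\<phi> has_derivative frechet_derivative \<phi> (at x)) (at x)"
    using assms frechet_derivative_works by blast
  then interpret linear "frechet_derivative \<phi> (at x)"
    by (rule has_derivative_linear)
  have "frechet_derivative \<phi> (at x) h = inner h (grad \<phi> x)" for h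
  proof -
    have "frechet_derivative \<phi> (at x) h
        = frechet_derivative \<phi> (at x) (\<Sum>b\<in>Basis. inner h b *\<^sub>R b)"
      by (simp add: euclidean_representation)
    also have "\<dots> = inner h (grad \<phi> x)"
      by (simp add: sum scale grad_def inner_sum_right mult.commute)
    finally show ?thesis .
  qed
  then show ?thesis
    using D by (metis (no_types, lifting) ext gderiv_def)
qed

primrec Ck :: "nat \<Rightarrow> ('a::euclidean_space \<Rightarrow> real) \<Rightarrow> bool" where
  "Ck 0 \<phi> \<longleftrightarrow> continuous_on UNIV \<phi>"
| "Ck (Suc k) \<phi> \<longleftrightarrow> \<phi> differentiable_on UNIV \<and>
     (\<forall>b\<in>Basis. Ck k (\<lambda>x. frechet_derivative \<phi> (at x) b))"

text \<open>The space of smooth functions with compact support in an open set; the functions are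
  taken to be extended by zero to the whole space.\<close>

definition test_function :: "'a::euclidean_space set \<Rightarrow> ('a \<Rightarrow> real) \<Rightarrow> bool" where
  "test_function \<Omega> \<phi> \<longleftrightarrow> (\<forall>k. Ck k \<phi>) \<and>
     compact (closure {x. \<phi> x \<noteq> 0}) \<and> closure {x. \<phi> x \<noteq> 0} \<subseteq> \<Omega>"

definition locally_integrable_on ::
  "('a::euclidean_space \<Rightarrow> 'b::euclidean_space) \<Rightarrow> 'a set \<Rightarrow> bool" where
  "locally_integrable_on g \<Omega> \<longleftrightarrow> (\<forall>K. compact K \<and> K \<subseteq> \<Omega> \<longrightarrow> g absolutely_integrable_on K)"

definition weak_gradient_on ::
  "'a::euclidean_space set \<Rightarrow> ('a \<Rightarrow> real) \<Rightarrow> ('a \<Rightarrow> 'a) \<Rightarrow> bool" where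
  "weak_gradient_on \<Omega> u G \<longleftrightarrow>
     locally_integrable_on u \<Omega> \<and> locally_integrable_on G \<Omega> \<and>
     (\<forall>\<phi>. test_function \<Omega> \<phi> \<longrightarrow> (\<forall>b\<in>Basis.
        (LINT x:\<Omega>|lebesgue. u x * inner (grad \<phi> x) b)
        = - (LINT x:\<Omega>|lebesgue. inner (G x) b * \<phi> x)))"

text \<open>The dimension \<open>N\<close> is \<open>DIM('a)\<close>. For \<open>N = 2\<close> the factor \<open>norm (G x) ^ (N - 2)\<close> is
  identically 1. Only the values of \<open>u\<close> on the punctured ball are used.\<close>

definition solution_PR ::
  "(real \<Rightarrow> real) \<Rightarrow> real \<Rightarrow> ('a::euclidean_space \<Rightarrow> real) \<Rightarrow> bool" where
  "solution_PR f R u \<longleftrightarrow>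
     (\<forall>x\<in>ball 0 R - {0}. \<forall>y\<in>ball 0 R - {0}. norm x = norm y \<longrightarrow> u x = u y) \<and>
     (\<forall>x\<in>ball 0 R - {0}. 0 \<le> u x) \<and>
     (\<forall>K. compact K \<and> K \<subseteq> cball 0 R - {0} \<longrightarrow>
        (\<exists>C. AE x in lebesgue. x \<in> K \<inter> ball 0 R \<longrightarrow> \<bar>u x\<bar> \<le> C)) \<and>
     (\<exists>G. weak_gradient_on (ball 0 R - {0}) u G \<and>
        locally_integrable_on (\<lambda>x. norm (G x) ^ (DIM('a) - 1)) (ball 0 R - {0}) \<and>
        (\<forall>\<phi>. test_function (ball 0 R - {0}) \<phi> \<longrightarrow>
           (LINT x:(ball 0 R - {0})|lebesgue.
              norm (G x) ^ (DIM('a) - 2) * inner (G x) (grad \<phi> x))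
           = (LINT x:(ball 0 R - {0})|lebesgue. f (u x) * \<phi> x)))"

text \<open>In the following, a function on \<open>[0,\<infinity>)\<close> is a total function of which only the
  values on \<open>{0..}\<close> are used.\<close>

definition locally_Hoelder :: "(real \<Rightarrow> real) \<Rightarrow> bool" where
  "locally_Hoelder f \<longleftrightarrow> (\<exists>\<theta>. 0 < \<theta> \<and> \<theta> < 1 \<and>
     (\<forall>K. compact K \<and> K \<subseteq> {0..} \<longrightarrow>
       (\<exists>C. \<forall>s\<in>K. \<forall>t\<in>K. \<bar>f s - f t\<bar> \<le> C * \<bar>s - t\<bar> powr \<theta>)))"

definition sub_exponential :: "(real \<Rightarrow> real) \<Rightarrow> bool" where
  "sub_exponential f \<longleftrightarrow> (\<exists>\<beta>>0. bdd_above ((\<lambda>t. f t * exp (- \<beta> * t)) ` {0..}))"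

abbreviation super_exponential :: "(real \<Rightarrow> real) \<Rightarrow> bool" where
  "super_exponential f \<equiv> \<not> sub_exponential f"

end

theory Submission
  imports Defs
begin

text \<open>Write \<open>u x = v (norm x)\<close>. Testing the weak gradient with radial vector fields shows that \<open>v\<close> is
  absolutely continuous, and testing it with arbitrary functions then identifies the weak gradient
  with \<open>v'(norm x) x / norm x\<close>; inserting radial test functions into the equation gives
  \<open>w' = r^(N-1) f(v)\<close> for the flux \<open>w = - r^(N-1) \<bar>v'\<bar>^(N-2) v'\<close>. If \<open>w\<close> were negative somewhere, \<open>v\<close>
  would be bounded near \<open>0\<close>, so \<open>w\<close> is nonnegative and \<open>v\<close> is decreasing.

  (a) Since \<open>F(v)\<close> is decreasing in \<open>r\<close> and is dominated by \<open>f(v)\<close> for large \<open>v\<close>, integration of \<open>w'\<close>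
  gives \<open>r^N F(v(r)) \<le> C (w(r) - w(0+))\<close>, which tends to \<open>0\<close>.

  (b) If \<open>w(0+) > 0\<close>, then \<open>v\<close> grows at least like a multiple of \<open>ln (1/r)\<close>, and (a) makes \<open>f\<close>
  sub-exponential. So \<open>w(0+) = 0\<close>. If the upper limit were below \<open>\<mu> < 1\<close>, the scaling hypothesis with
  \<open>\<lambda> = 1/\<mu>\<close> would give \<open>f(v) = O(r^(-N \<mu>))\<close>, hence \<open>w = O(r^\<delta>)\<close> and \<open>v' = O(r^(\<gamma> - 1))\<close> with
  \<open>\<delta>, \<gamma> > 0\<close>, and \<open>v\<close> would be bounded.\<close>

section \<open>Smooth functions\<close>

text \<open>Neither the solution nor its gradient is controlled at the origin, so all testing is
  done on annuli a < |x| < b with a > 0, and the behaviour at 0 enters only through the monotonicity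
  of the flux. The weak gradient is not assumed to be radial; that it has no tangential part must be
  proved. This needs only the image of Lebesgue measure under \<open>norm\<close>, which follows
  from the volume of balls.

  The scaling hypothesis matters because it lowers an exponent. Part (a) only says that f(v) is at
  most of order r^(-N), for which w' = r^(N-1) f(v) sits at the borderline 1/r. A gap \<mu> < 1 in
  the upper limit turns r^(-N) into r^(-N \<mu>), and w' becomes integrable at 0 with a power to
  spare. There w(0+) = 0 is essential, since a positive limit makes v' of order 1/r;
  super-exponential growth serves to exclude this. The value of \<epsilon> affects constants only,
  which is why the upper limit is the same for every \<epsilon>.\<close>

text \<open>With \<open>Ck_SucE\<close> this replaces \<open>frechet_derivative\<close> in
  \<open>Ck\<close> by any derivative map, so that inductions on the order can work with explicit
  formulas.\<close>

lemma Ck_SucI: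
  assumes "\<And>x. (\<phi> has_derivative D x) (at x)" and "\<And>b. b \<in> Basis \<Longrightarrow> Ck k (\<lambda>x. D x b)"
  shows "Ck (Suc k) \<phi>"
proof -
  have "frechet_derivative \<phi> (at x) = D x" for x
    using frechet_derivative_at[OF assms(1)] by simp
  then show ?thesis
    using assms by (auto simp: differentiable_on_def differentiable_def intro: has_derivative_at_withinI)
qed

lemma Ck_SucE:
  assumes "Ck (Suc k) \<phi>"
  obtains D where "\<And>x. (\<phi> has_derivative D x) (at x)" and "\<And>b. b \<in> Basis \<Longrightarrow> Ck k (\<lambda>x. D x b)"
proof
  show "(\<phi> has_derivative frechet_derivative \<phi> (at x)) (at x)" for x
    using assms by (simp add: differentiable_on_def frechet_derivative_works)
qed (use assms in auto)

lemma Ck_pred: "Ck (Suc k) \<phi> \<Longrightarrow> Ck k \<phi>"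
  by (induction k arbitrary: \<phi>) (auto intro: differentiable_imp_continuous_on)

lemma Ck_continuous: "Ck k \<phi> \<Longrightarrow> continuous_on UNIV \<phi>"
  by (cases k) (auto intro: differentiable_imp_continuous_on)

lemma Ck_const: "Ck k (\<lambda>_. c)"
proof (induction k arbitrary: c)
  case (Suc k)
  show ?case
    by (rule Ck_SucI[where D = "\<lambda>_ _. 0"]) (auto intro: Suc)
qed simp

lemma Ck_inner: "Ck k (\<lambda>x. inner x b)"
proof (cases k)
  case (Suc k)
  show ?thesis unfolding Suc
    by (rule Ck_SucI[where D = "\<lambda>_ h. inner h b"]) (auto intro: Ck_const intro!: derivative_eq_intros)
qed (auto intro: continuous_intros)

lemma Ck_add: "Ck k \<phi> \<Longrightarrow> Ck k \<eta> \<Longrightarrow> Ck k (\<lambda>x. \<phi> x + \<eta> x)"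
proof (induction k arbitrary: \<phi> \<eta>)
  case (Suc k)
  from Suc.prems obtain D D' where "\<And>x. (\<phi> has_derivative D x) (at x)" "\<And>b. b \<in> Basis \<Longrightarrow> Ck k (\<lambda>x. D x b)"
    "\<And>x. (\<eta> has_derivative D' x) (at x)" "\<And>b. b \<in> Basis \<Longrightarrow> Ck k (\<lambda>x. D' x b)"
    by (metis Ck_SucE)
  then show ?case
    by (intro Ck_SucI[where D = "\<lambda>x h. D x h + D' x h"]) (auto intro: Suc.IH has_derivative_add)
qed (auto intro: continuous_intros)

lemma Ck_mult: "Ck k \<phi> \<Longrightarrow> Ck k \<eta> \<Longrightarrow> Ck k (\<lambda>x. \<phi> x * \<eta> x)"
proof (induction k arbitrary: \<phi> \<eta>)
  case (Suc k)
  from Suc.prems obtain D D' where "\<And>x. (\<phi> has_derivative D x) (at x)" "\<And>b. b \<in> Basis \<Longrightarrow> Ck k (\<lambda>x. D x b)"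
    "\<And>x. (\<eta> has_derivative D' x) (at x)" "\<And>b. b \<in> Basis \<Longrightarrow> Ck k (\<lambda>x. D' x b)"
    by (metis Ck_SucE)
  then show ?case
    by (intro Ck_SucI[where D = "\<lambda>x h. \<phi> x * D' x h + D x h * \<eta> x"] Ck_add has_derivative_mult)
      (simp_all add: Suc.IH Ck_pred[OF Suc.prems(1)] Ck_pred[OF Suc.prems(2)])
qed (auto intro: continuous_intros)

lemma Ck_prod: "(\<And>i. i \<in> I \<Longrightarrow> Ck k (\<phi> i)) \<Longrightarrow> Ck k (\<lambda>x. \<Prod>i\<in>I. \<phi> i x)"
  by (induction I rule: infinite_finite_induct) (auto intro: Ck_const Ck_mult)

lemma Ck_compose:
  fixes h :: "real \<Rightarrow> real"
  shows "Ck k h \<Longrightarrow> Ck k q \<Longrightarrow> Ck k (\<lambda>x. h (q x))"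
proof (induction k arbitrary: h)
  case 0
  then show ?case
    by (auto intro: continuous_on_compose2[where t = UNIV])
next
  case (Suc k)
  from Suc.prems obtain D D' where D: "\<And>x. (h has_derivative D x) (at x)" "\<And>b. b \<in> Basis \<Longrightarrow> Ck k (\<lambda>x. D x b)"
    and D': "\<And>x. (q has_derivative D' x) (at x)" "\<And>b. b \<in> Basis \<Longrightarrow> Ck k (\<lambda>x. D' x b)"
    by (metis Ck_SucE)
  have lin: "D x y = D x 1 * y" for x y
    using linear_scale[OF has_derivative_linear[OF D(1)], of x y 1] by (simp add: mult.commute)
  have "((\<lambda>x. h (q x)) has_derivative (\<lambda>y. D (q x) 1 * D' x y)) (at x)" for x
    using has_derivative_compose[OF D'(1) D(1), of x] by (subst lin[symmetric]) simp
  moreover have "Ck k (\<lambda>x. D (q x) 1)"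
    using Suc.IH[OF D(2) Ck_pred] Suc.prems by auto
  ultimately show ?case
    by (intro Ck_SucI[where D = "\<lambda>x y. D (q x) 1 * D' x y"]) (simp_all add: Ck_mult D')
qed

lemma Ck_real_SucI:
  fixes h :: "real \<Rightarrow> real"
  assumes "\<And>x. (h has_real_derivative h' x) (at x)" and "Ck k h'"
  shows "Ck (Suc k) h"
  by (rule Ck_SucI[where D = "\<lambda>x y. h' x * y"])
    (use assms in \<open>auto simp: has_field_derivative_def\<close>)

lemma Ck_real_SucE:
  fixes h :: "real \<Rightarrow> real"
  assumes "Ck (Suc k) h"
  obtains h' where "\<And>x. (h has_real_derivative h' x) (at x)" and "Ck k h'"
proof -
  from assms obtain D where D: "\<And>x. (h has_derivative D x) (at x)" "\<And>b. b \<in> Basis \<Longrightarrow> Ck k (\<lambda>x. D x b)"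
    by (metis Ck_SucE)
  have lin: "D x y = D x 1 * y" for x y
    using linear_scale[OF has_derivative_linear[OF D(1)], of x y 1] by (simp add: mult.commute)
  have "(h has_real_derivative D x 1) (at x)" for x
    using D(1)[of x] lin[of x] has_derivative_imp_has_field_derivative by (metis mult.commute)
  with D(2) show ?thesis
    using that[of "\<lambda>x. D x 1"] by auto
qed

text \<open>All derivatives of \<open>exp (-1/x)\<close>, extended by \<open>0\<close> to the left half line, stay in this family.\<close>

definition flat_exp :: "real poly \<Rightarrow> real \<Rightarrow> real" where
  "flat_exp p x = (if x > 0 then poly p (1 / x) * exp (- (1 / x)) else 0)"

lemma poly_times_exp_tendsto_0: "((\<lambda>y::real. poly p y * exp (- y)) \<longlongrightarrow> 0) at_top"
proof -
  have *: "((\<lambda>y::real. y ^ i * exp (- y)) \<longlongrightarrow> 0) at_top" for i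
    using tendsto_power_div_exp_0[of i] by (simp add: exp_minus divide_inverse)
  have "((\<lambda>y::real. \<Sum>i\<le>degree p. coeff p i * (y ^ i * exp (- y))) \<longlongrightarrow> (\<Sum>i\<le>degree p. coeff p i * 0)) at_top"
    by (intro tendsto_intros *)
  then show ?thesis
    by (simp add: poly_altdef sum_distrib_right mult.assoc)
qed

text \<open>The factor \<open>[:0, 0, 1:]\<close> is the 1/x^2 coming from the inner derivative of
  1/x. Only x = 0 is delicate: the right difference quotient is again a polynomial in 1/h times
  exp(-1/h), hence tends to 0.\<close>

lemma flat_exp_has_derivative:
  "(flat_exp p has_real_derivative flat_exp ([:0, 0, 1:] * (p - pderiv p)) x) (at x)"
proof -
  consider "x > 0" | "x < 0" | "x = 0" by linarith
  then show ?thesis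
  proof cases
    case 1
    have "((\<lambda>x. poly p (1 / x) * exp (- (1 / x))) has_real_derivative
        flat_exp ([:0, 0, 1:] * (p - pderiv p)) x) (at x)"
      using 1 by (auto intro!: derivative_eq_intros simp: flat_exp_def field_simps power2_eq_square)
    moreover have "\<forall>\<^sub>F y in nhds x. flat_exp p y = poly p (1 / y) * exp (- (1 / y))"
      by (rule eventually_mono[OF eventually_nhds_in_open[of "{0<..}" x]]) (use 1 in \<open>auto simp: flat_exp_def\<close>)
    ultimately show ?thesis
      by (rule DERIV_cong_ev[OF refl _ refl, THEN iffD2, rotated])
  next
    case 2
    have "\<forall>\<^sub>F y in nhds x. flat_exp p y = 0"
      by (rule eventually_mono[OF eventually_nhds_in_open[of "{..<0}" x]]) (use 2 in \<open>auto simp: flat_exp_def\<close>)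
    then show ?thesis
      using 2 DERIV_cong_ev[of x x "flat_exp p" "\<lambda>_. 0" 0 0] by (simp add: flat_exp_def)
  next
    case 3
    have "((\<lambda>h. flat_exp p h / h) \<longlongrightarrow> 0) (at_right 0)"
    proof -
      have "((\<lambda>h::real. poly (pCons 0 p) (inverse h) * exp (- (inverse h))) \<longlongrightarrow> 0) (at_right 0)"
        by (rule filterlim_compose[OF poly_times_exp_tendsto_0 filterlim_inverse_at_top_right])
      then show ?thesis
        by (rule Lim_transform_eventually)
          (auto simp: flat_exp_def divide_inverse eventually_at_filter)
    qed
    moreover have "((\<lambda>h. flat_exp p h / h) \<longlongrightarrow> 0) (at_left 0)"
      by (rule Lim_transform_eventually[OF tendsto_const]) (auto simp: flat_exp_def eventually_at_filter)
    ultimately have "((\<lambda>h. flat_exp p h / h) \<longlongrightarrow> 0) (at 0)"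
      by (simp add: filterlim_split_at)
    then show ?thesis
      using 3 by (simp add: DERIV_def flat_exp_def)
  qed
qed

lemma Ck_flat_exp: "Ck k (flat_exp p)"
proof (induction k arbitrary: p)
  case 0
  show ?case
    by (simp, rule DERIV_continuous_on) (rule DERIV_subset[OF flat_exp_has_derivative], simp)
next
  case (Suc k)
  show ?case
    by (rule Ck_real_SucI[OF flat_exp_has_derivative Suc])
qed

lemma has_real_derivative_left_zero:
  fixes h :: "real \<Rightarrow> real"
  assumes "(h has_real_derivative d) (at r)" and "\<And>r. r < a \<Longrightarrow> h r = 0" and "r < a"
  shows "d = 0"
proof -
  have "\<forall>\<^sub>F y in nhds r. h y = 0"
    by (rule eventually_mono[OF eventually_nhds_in_open[of "{..<a}" r]]) (use assms in auto)
  then have "(h has_real_derivative 0) (at r)"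
    using DERIV_cong_ev[of r r h "\<lambda>_. 0" 0 0] by simp
  then show ?thesis using assms(1) DERIV_unique by blast
qed

text \<open>The singularity of \<open>r powr s\<close> at 0 is harmless because \<open>h\<close>
  vanishes to the left of a > 0. The derivative is a sum of two products of the same kind, with
  exponents \<open>s\<close> and \<open>s - 1\<close>, so the induction runs over all
  \<open>h\<close> and \<open>s\<close>.\<close>

lemma Ck_mult_powr:
  fixes h :: "real \<Rightarrow> real"
  assumes "0 < a"
  shows "Ck k h \<Longrightarrow> (\<And>r. r < a \<Longrightarrow> h r = 0) \<Longrightarrow> Ck k (\<lambda>r. h r * r powr s)"
proof (induction k arbitrary: h s)
  case 0
  have "isCont (\<lambda>r. h r * r powr s) r" for r
  proof (cases "r > 0")
    case True
    have "isCont h r" using 0(1) by (simp add: continuous_on_eq_continuous_at)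
    then show ?thesis using True by (intro continuous_intros) auto
  next
    case False
    have "\<forall>\<^sub>F y in nhds r. h y * y powr s = 0"
      by (rule eventually_mono[OF eventually_nhds_in_open[of "{..<a}" r]]) (use False 0(2) assms in \<open>auto\<close>)
    then show ?thesis
      using isCont_cong by fastforce
  qed
  then show ?case by (simp add: continuous_on_eq_continuous_at)
next
  case (Suc k)
  from Suc.prems(1) obtain h' where h': "\<And>x. (h has_real_derivative h' x) (at x)" "Ck k h'"
    by (metis Ck_real_SucE)
  have h'0: "h' r = 0" if "r < a" for r
    using has_real_derivative_left_zero[OF h'(1) Suc.prems(2) that] .
  show ?case
  proof (rule Ck_real_SucI[where h' = "\<lambda>r. h' r * r powr s + h r * r powr (s - 1) * s"])
    show "((\<lambda>r. h r * r powr s) has_real_derivative h' r * r powr s + h r * r powr (s - 1) * s) (at r)" for r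
    proof (cases "r > 0")
      case True
      then show ?thesis
        by (auto intro!: derivative_eq_intros h' simp: algebra_simps powr_diff)
    next
      case False
      have "\<forall>\<^sub>F y in nhds r. h y * y powr s = 0"
        by (rule eventually_mono[OF eventually_nhds_in_open[of "{..<a}" r]]) (use Suc.prems(2) False assms in \<open>auto\<close>)
      then show ?thesis
        using DERIV_cong_ev[of r r "\<lambda>r. h r * r powr s" "\<lambda>_. 0" 0 0] h'0 Suc.prems(2) False assms by simp
    qed
    show "Ck k (\<lambda>r. h' r * r powr s + h r * r powr (s - 1) * s)"
    proof (intro Ck_add)
      show "Ck k (\<lambda>r. h' r * r powr s)"
        by (rule Suc.IH[OF h'(2) h'0])
      have "Ck k (\<lambda>r. h r * r powr (s - 1))"
        by (rule Suc.IH[OF Ck_pred[OF Suc.prems(1)] Suc.prems(2)])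
      then show "Ck k (\<lambda>r. h r * r powr (s - 1) * s)"
        by (rule Ck_mult[OF _ Ck_const])
    qed
  qed
qed

text \<open>The norm is not differentiable at 0, but \<open>h\<close> vanishes near 0, and the
  formula, read with \<open>0 powr -1 = 0\<close>, holds there too. One expression thus serves all
  points.\<close>

lemma norm_comp_has_derivative:
  fixes x :: "'a::euclidean_space"
  assumes "(h has_real_derivative h') (at (norm x))" and "0 < a" and "\<And>r. r < a \<Longrightarrow> h r = 0"
    and "norm x < a \<Longrightarrow> h' = 0"
  shows "((\<lambda>x. h (norm x)) has_derivative (\<lambda>y. h' * norm x powr -1 * inner y x)) (at x)"
proof (cases "x = 0")
  case False
  have "((\<lambda>x. h (norm x)) has_derivative (\<lambda>y. h' * inner y (sgn x))) (at x)"
    using has_derivative_compose[OF has_derivative_norm[OF False]] assms(1)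
    by (force simp: has_field_derivative_def)
  then show ?thesis
    using False by (simp add: sgn_div_norm powr_minus_divide divide_inverse mult_ac)
next
  case True
  have "((\<lambda>x::'a. h (norm x)) has_derivative (\<lambda>y. 0)) (at x)"
  proof (rule has_derivative_transform_within_open[where f = "\<lambda>_. 0"])
    show "0 = h (norm y)" if "y \<in> ball 0 a" for y :: 'a
      using that assms(3) by simp
  qed (use True assms(2) in auto)
  then show ?thesis using True assms by simp
qed

section \<open>Test functions\<close>

text \<open>Each partial derivative is the radial factor h'(|x|)/|x| times a coordinate. By
  \<open>Ck_mult_powr\<close> this factor comes from a profile that is smooth to one order less and
  still vanishes below \<open>a\<close>, so the induction hypothesis applies to it.\<close>

lemma Ck_comp_norm:
  fixes h :: "real \<Rightarrow> real"
  assumes "0 < a"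
  shows "Ck k h \<Longrightarrow> (\<And>r. r < a \<Longrightarrow> h r = 0) \<Longrightarrow> Ck k (\<lambda>x::'a::euclidean_space. h (norm x))"
proof (induction k arbitrary: h)
  case 0
  then show ?case
    by (auto intro: continuous_on_compose2[where t = UNIV] continuous_intros)
next
  case (Suc k)
  from Suc.prems(1) obtain h' where h': "\<And>x. (h has_real_derivative h' x) (at x)" "Ck k h'"
    by (metis Ck_real_SucE)
  have h'0: "h' r = 0" if "r < a" for r
    using has_real_derivative_left_zero[OF h'(1) Suc.prems(2) that] .
  show ?case
  proof (rule Ck_SucI[where D = "\<lambda>x y. h' (norm x) * norm x powr -1 * inner y x"])
    show "((\<lambda>x. h (norm x)) has_derivative (\<lambda>y. h' (norm x) * norm x powr - 1 * inner y x)) (at x)" for x :: 'a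
      by (rule norm_comp_has_derivative[OF h'(1) assms Suc.prems(2) h'0])
    have "Ck k (\<lambda>x::'a. h' (norm x) * norm x powr - 1)"
      by (rule Suc.IH[OF Ck_mult_powr[OF assms h'(2) h'0]]) (simp_all add: h'0)
    then show "Ck k (\<lambda>x::'a. h' (norm x) * norm x powr - 1 * inner b x)" for b
      by (rule Ck_mult) (simp add: inner_commute Ck_inner)
  qed
qed

lemma test_functionI:
  assumes "\<And>k. Ck k \<phi>" "compact K" "K \<subseteq> \<Omega>" "\<And>x. x \<notin> K \<Longrightarrow> \<phi> x = 0"
  shows "test_function \<Omega> \<phi>"
proof -
  have "closure {x. \<phi> x \<noteq> 0} \<subseteq> K"
    using assms by (intro closure_minimal compact_imp_closed) auto
  then show ?thesis
    using assms unfolding test_function_def by (meson bounded_closure bounded_subset closed_closure compact_eq_bounded_closed order_trans)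
qed

lemma test_functionE:
  assumes "test_function \<Omega> \<phi>"
  obtains K where "compact K" "K \<subseteq> \<Omega>" "\<And>x. x \<notin> K \<Longrightarrow> \<phi> x = 0"
  using assms that[of "closure {x. \<phi> x \<noteq> 0}"] closure_subset[of "{x. \<phi> x \<noteq> 0}"]
  unfolding test_function_def by blast

lemma test_function_Ck: "test_function \<Omega> \<phi> \<Longrightarrow> Ck k \<phi>"
  by (simp add: test_function_def)

lemma test_function_mono: "test_function \<Omega> \<phi> \<Longrightarrow> \<Omega> \<subseteq> \<Omega>' \<Longrightarrow> test_function \<Omega>' \<phi>"
  by (auto simp: test_function_def)

lemma test_function_0: "test_function \<Omega> \<phi> \<Longrightarrow> x \<notin> \<Omega> \<Longrightarrow> \<phi> x = 0"
  by (metis subset_iff test_functionE)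

lemma test_function_mult:
  assumes "test_function \<Omega> \<phi>" "\<And>k. Ck k \<eta>"
  shows "test_function \<Omega> (\<lambda>x. \<phi> x * \<eta> x)"
proof -
  from assms(1) obtain K where "compact K" "K \<subseteq> \<Omega>" "\<And>x. x \<notin> K \<Longrightarrow> \<phi> x = 0"
    by (metis test_functionE)
  then show ?thesis
    by (intro test_functionI[where K = K]) (auto intro: Ck_mult assms test_function_Ck)
qed

lemma test_function_add:
  assumes "test_function \<Omega> \<phi>" "test_function \<Omega> \<eta>"
  shows "test_function \<Omega> (\<lambda>x. \<phi> x + \<eta> x)"
proof -
  from assms obtain K K' where "compact K" "K \<subseteq> \<Omega>" "\<And>x. x \<notin> K \<Longrightarrow> \<phi> x = 0"
    "compact K'" "K' \<subseteq> \<Omega>" "\<And>x. x \<notin> K' \<Longrightarrow> \<eta> x = 0"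
    by (metis test_functionE)
  then show ?thesis
    by (intro test_functionI[where K = "K \<union> K'"]) (auto intro: Ck_add assms test_function_Ck)
qed

lemma grad_inner_Basis: "b \<in> Basis \<Longrightarrow> inner (grad \<phi> x) b = frechet_derivative \<phi> (at x) b"
  by (simp add: grad_def)

lemma grad_eqI:
  assumes "(\<phi> has_derivative (\<lambda>y. inner y w)) (at x)"
  shows "grad \<phi> x = w"
proof (rule euclidean_eqI)
  fix b :: 'a assume "b \<in> Basis"
  then show "inner (grad \<phi> x) b = inner w b"
    using frechet_derivative_at[OF assms, symmetric] by (simp add: grad_inner_Basis inner_commute[of w])
qed

lemma Ck_Suc_has_derivative: "Ck (Suc k) \<phi> \<Longrightarrow> (\<phi> has_derivative frechet_derivative \<phi> (at x)) (at x)"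
  by (simp add: differentiable_on_def frechet_derivative_works)

lemma test_function_deriv:
  assumes "test_function \<Omega> \<phi>" "b \<in> Basis"
  shows "test_function \<Omega> (\<lambda>x. inner (grad \<phi> x) b)"
proof -
  from assms obtain K where K: "compact K" "K \<subseteq> \<Omega>" "\<And>x. x \<notin> K \<Longrightarrow> \<phi> x = 0"
    by (metis test_functionE)
  show ?thesis
  proof (rule test_functionI[OF _ K(1,2)])
    show "Ck k (\<lambda>x. inner (grad \<phi> x) b)" for k
      using test_function_Ck[OF assms(1), of "Suc k"] assms(2) by (simp add: grad_inner_Basis)
    show "inner (grad \<phi> x) b = 0" if "x \<notin> K" for x
    proof -
      have "(\<phi> has_derivative (\<lambda>y. inner y 0)) (at x)"
      proof (rule has_derivative_transform_within_open[where f = "\<lambda>_. 0" and s = "- K"])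
        show "open (- K)" using K(1) compact_imp_closed by blast
      qed (use that K(3) in auto)
      then have "grad \<phi> x = 0" by (rule grad_eqI)
      then show ?thesis by simp
    qed
  qed
qed

lemma test_function_bounded:
  assumes "test_function \<Omega> \<phi>"
  obtains B where "B > 0" "\<And>x. \<bar>\<phi> x\<bar> \<le> B"
proof -
  from assms obtain K where K: "compact K" "K \<subseteq> \<Omega>" "\<And>x. x \<notin> K \<Longrightarrow> \<phi> x = 0"
    by (metis test_functionE)
  have "continuous_on K \<phi>"
    using Ck_continuous[OF test_function_Ck[OF assms]] continuous_on_subset by blast
  then have "bounded (\<phi> ` K)"
    using K(1) compact_continuous_image compact_imp_bounded by blast
  then obtain B where "B > 0" "\<And>x. x \<in> K \<Longrightarrow> \<bar>\<phi> x\<bar> \<le> B"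
    by (auto simp: bounded_pos)
  then show ?thesis
    using that[of B] K(3) by (metis abs_zero less_imp_le)
qed

lemma test_function_borel_measurable: "test_function \<Omega> \<phi> \<Longrightarrow> \<phi> \<in> borel_measurable borel"
  using Ck_continuous[OF test_function_Ck] borel_measurable_continuous_onI by blast

lemma test_function_integrable:
  fixes \<phi> :: "'a::euclidean_space \<Rightarrow> real"
  assumes "test_function \<Omega> \<phi>"
  shows "integrable lborel \<phi>"
proof -
  from assms obtain K where K: "compact K" "K \<subseteq> \<Omega>" "\<And>x. x \<notin> K \<Longrightarrow> \<phi> x = 0"
    by (metis test_functionE)
  have "continuous_on K \<phi>"
    using Ck_continuous[OF test_function_Ck[OF assms]] continuous_on_subset by blast
  then have "integrable lborel (\<lambda>x. indicator K x *\<^sub>R \<phi> x)"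
    by (rule borel_integrable_compact[OF K(1)])
  moreover have "(\<lambda>x. indicator K x *\<^sub>R \<phi> x) = \<phi>"
    using K(3) by (intro ext) (auto simp: indicator_def)
  ultimately show ?thesis by simp
qed

lemma integrable_mult_test_function:
  fixes \<phi> :: "'a::euclidean_space \<Rightarrow> real"
  assumes "integrable lborel q" "test_function \<Omega> \<phi>"
  shows "integrable lborel (\<lambda>x. q x * \<phi> x)"
proof -
  obtain B where B: "B > 0" "\<And>x. \<bar>\<phi> x\<bar> \<le> B"
    using test_function_bounded[OF assms(2)] by blast
  have "integrable lborel (\<lambda>x. B * q x)" using assms(1) by simp
  then show ?thesis
  proof (rule Bochner_Integration.integrable_bound)
    have "\<bar>q x\<bar> * \<bar>\<phi> x\<bar> \<le> \<bar>q x\<bar> * B" for x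
      using B(2) by (intro mult_left_mono) auto
    then show "AE x in lborel. norm (q x * \<phi> x) \<le> norm (B * q x)"
      using B(1) by (intro AE_I2) (simp add: abs_mult mult.commute)
  qed (use assms(1) test_function_borel_measurable[OF assms(2)] in auto)
qed

lemma set_integral_test_function:
  assumes "test_function \<Omega> \<phi>"
  shows "(LINT x:\<Omega>|M. g x * \<phi> x) = (LINT x|M. g x * \<phi> x)"
  unfolding set_lebesgue_integral_def
  by (intro Bochner_Integration.integral_cong) (auto simp: indicator_def test_function_0[OF assms])

section \<open>Difference quotients of test functions\<close>

lemma test_function_directional_Lipschitz:
  fixes \<phi> :: "'a::euclidean_space \<Rightarrow> real"
  assumes "test_function \<Omega> \<phi>" "b \<in> Basis"
  obtains L where "L > 0" "\<And>x t. \<bar>\<phi> (x + t *\<^sub>R b) - \<phi> x\<bar> \<le> L * \<bar>t\<bar>"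
proof -
  obtain B where B: "B > 0" "\<And>x. \<bar>inner (grad \<phi> x) b\<bar> \<le> B"
    using test_function_bounded[OF test_function_deriv[OF assms]] by metis
  have "\<bar>\<phi> (x + t *\<^sub>R b) - \<phi> x\<bar> \<le> B * \<bar>t\<bar>" for x t
  proof -
    define g where "g s = \<phi> (x + s *\<^sub>R b)" for s
    have der: "(g has_real_derivative inner (grad \<phi> (x + s *\<^sub>R b)) b) (at s)" for s
    proof -
      have 1: "((\<lambda>s. x + s *\<^sub>R b) has_derivative (\<lambda>s. s *\<^sub>R b)) (at s)"
        by (auto intro!: derivative_eq_intros)
      have 2: "(\<phi> has_derivative frechet_derivative \<phi> (at (x + s *\<^sub>R b))) (at (x + s *\<^sub>R b))"
        by (rule Ck_Suc_has_derivative[OF test_function_Ck[OF assms(1), of "Suc 0"]])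
      have "(g has_derivative (\<lambda>t. frechet_derivative \<phi> (at (x + s *\<^sub>R b)) (t *\<^sub>R b))) (at s)"
        unfolding g_def using has_derivative_compose[OF 1 2] .
      then show ?thesis
        unfolding linear_scale[OF has_derivative_linear[OF 2]] has_field_derivative_def
        by (simp add: grad_inner_Basis[OF assms(2)] mult.commute[of _ "frechet_derivative \<phi> (at (x + s *\<^sub>R b)) b"])
    qed
    have "norm (g t - g 0) \<le> B * norm (t - 0)"
      by (rule field_differentiable_bound[where S = UNIV]) (use der B in auto)
    then show ?thesis by (simp add: g_def)
  qed
  with B(1) show ?thesis using that by blast
qed

lemma directional_derivative_LIMSEQ:
  fixes \<phi> :: "'a::euclidean_space \<Rightarrow> real"
  assumes "test_function \<Omega> \<phi>" "b \<in> Basis"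
  shows "(\<lambda>n. (\<phi> (x + (1 / real (Suc n)) *\<^sub>R b) - \<phi> x) * real (Suc n)) \<longlonglongrightarrow> inner (grad \<phi> x) b"
proof -
  have 1: "((\<lambda>s. x + s *\<^sub>R b) has_derivative (\<lambda>s. s *\<^sub>R b)) (at 0)"
    by (auto intro!: derivative_eq_intros)
  have 2: "(\<phi> has_derivative frechet_derivative \<phi> (at x)) (at (x + 0 *\<^sub>R b))"
    using Ck_Suc_has_derivative[OF test_function_Ck[OF assms(1), of "Suc 0"], of x] by simp
  have "((\<lambda>s. \<phi> (x + s *\<^sub>R b)) has_derivative (\<lambda>t. frechet_derivative \<phi> (at x) (t *\<^sub>R b))) (at 0)"
    using has_derivative_compose[OF 1 2] .
  then have "((\<lambda>s. \<phi> (x + s *\<^sub>R b)) has_real_derivative inner (grad \<phi> x) b) (at 0)"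
    unfolding linear_scale[OF has_derivative_linear[OF 2]] has_field_derivative_def
    by (simp add: grad_inner_Basis[OF assms(2)] mult.commute[of _ "frechet_derivative \<phi> (at x) b"])
  then have "((\<lambda>h. (\<phi> (x + h *\<^sub>R b) - \<phi> x) / h) \<longlongrightarrow> inner (grad \<phi> x) b) (at 0)"
    by (simp add: DERIV_def)
  moreover have "filterlim (\<lambda>n. 1 / real (Suc n)) (at 0) sequentially"
    unfolding filterlim_at using LIMSEQ_inverse_real_of_nat by (auto simp: divide_inverse)
  ultimately have "(\<lambda>n. (\<phi> (x + (1 / real (Suc n)) *\<^sub>R b) - \<phi> x) / (1 / real (Suc n))) \<longlonglongrightarrow> inner (grad \<phi> x) b"
    by (rule filterlim_compose)
  then show ?thesis by simp
qed

text \<open>By translation invariance every difference quotient has integral 0. Dominated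
  convergence passes to the derivative, the Lipschitz constant on a large ball being the
  majorant.\<close>

lemma integral_deriv_test_function:
  fixes \<phi> :: "'a::euclidean_space \<Rightarrow> real"
  assumes "test_function \<Omega> \<phi>" "b \<in> Basis"
  shows "(LINT x|lborel. inner (grad \<phi> x) b) = 0"
proof -
  from assms obtain K where K: "compact K" "K \<subseteq> \<Omega>" "\<And>x. x \<notin> K \<Longrightarrow> \<phi> x = 0"
    by (metis test_functionE)
  obtain r where r: "\<And>x. x \<in> K \<Longrightarrow> norm x \<le> r"
    using compact_imp_bounded[OF K(1)] unfolding bounded_iff by metis
  obtain L where L: "L > 0" "\<And>x t. \<bar>\<phi> (x + t *\<^sub>R b) - \<phi> x\<bar> \<le> L * \<bar>t\<bar>"
    using test_function_directional_Lipschitz[OF assms] by metis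
  define D where "D n x = (\<phi> (x + (1 / real (Suc n)) *\<^sub>R b) - \<phi> x) * real (Suc n)" for n x
  note [measurable] = test_function_borel_measurable[OF assms(1)]
    test_function_borel_measurable[OF test_function_deriv[OF assms]]
  note int = test_function_integrable[OF assms(1)]
  have shift: "integrable lborel (\<lambda>x. \<phi> (x + v))" "(LINT x|lborel. \<phi> (x + v)) = (LINT x|lborel. \<phi> x)" for v
  proof -
    have "integrable (distr lborel borel (\<lambda>x. v + x)) \<phi>"
      using int by (simp add: lborel_distr_plus)
    then show "integrable lborel (\<lambda>x. \<phi> (x + v))"
      by (subst (asm) integrable_distr_eq) (auto simp: add.commute)
    have "(LINT x|distr lborel borel (\<lambda>x. v + x). \<phi> x) = (LINT x|lborel. \<phi> x)"
      by (simp add: lborel_distr_plus)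
    then show "(LINT x|lborel. \<phi> (x + v)) = (LINT x|lborel. \<phi> x)"
      by (subst (asm) integral_distr) (auto simp: add.commute)
  qed
  \<comment> \<open>The step \<open>1 / Suc n\<close> is at most 1, so all quotients vanish outside
    the ball of radius \<open>r + 1\<close>.\<close>
  have "(\<lambda>n. LINT x|lborel. D n x) \<longlonglongrightarrow> (LINT x|lborel. inner (grad \<phi> x) b)"
  proof (rule integral_dominated_convergence[where w = "\<lambda>x. L * indicator (cball 0 (r + 1)) x"])
    show "integrable lborel (\<lambda>x. L * indicator (cball 0 (r + 1)) x :: real)"
      by (intro integrable_mult_right integrable_real_indicator)
        (auto intro!: emeasure_bounded_finite simp flip: infinity_ennreal_def)
    show "AE x in lborel. (\<lambda>n. D n x) \<longlonglongrightarrow> inner (grad \<phi> x) b"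
      unfolding D_def using directional_derivative_LIMSEQ[OF assms] by auto
    show "AE x in lborel. norm (D n x) \<le> L * indicator (cball 0 (r + 1)) x" for n
    proof (rule AE_I2)
      fix x
      show "norm (D n x) \<le> L * indicator (cball 0 (r + 1)) x"
      proof (cases "norm x \<le> r + 1")
        case True
        have "\<bar>D n x\<bar> \<le> (L * \<bar>1 / real (Suc n)\<bar>) * real (Suc n)"
          unfolding D_def abs_mult using L(2)[of x "1 / real (Suc n)"] by (intro mult_mono) auto
        then show ?thesis using True by simp
      next
        case False
        have "norm x - norm ((1 / real (Suc n)) *\<^sub>R b) \<le> norm (x + (1 / real (Suc n)) *\<^sub>R b)"
          by (metis norm_diff_ineq)
        moreover have "norm ((1 / real (Suc n)) *\<^sub>R b) \<le> 1"
          using assms(2) by (simp add: divide_simps)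
        ultimately have "r < norm (x + (1 / real (Suc n)) *\<^sub>R b)" "r < norm x"
          using False by linarith+
        then show ?thesis using K(3) r L(1) unfolding D_def
          by (metis abs_zero diff_self indicator_pos_le less_imp_le mult_nonneg_nonneg mult_zero_left not_le real_norm_def)
      qed
    qed
  qed (simp_all add: D_def)
  moreover have "(LINT x|lborel. D n x) = 0" for n
    unfolding D_def using shift int by simp
  ultimately show ?thesis
    by (simp add: LIMSEQ_const_iff)
qed

section \<open>Smooth bumps and the fundamental lemma of the calculus of variations\<close>

definition bump :: "'a::euclidean_space \<Rightarrow> 'a \<Rightarrow> nat \<Rightarrow> 'a \<Rightarrow> real" where
  "bump l u n x = (\<Prod>b\<in>Basis. flat_exp 1 (real n * (inner x b - inner l b)) * flat_exp 1 (real n * (inner u b - inner x b)))"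

lemma flat_exp_1_bounds: "0 \<le> flat_exp 1 t" "flat_exp 1 t \<le> 1" "t \<le> 0 \<Longrightarrow> flat_exp 1 t = 0"
  by (auto simp: flat_exp_def)

lemma bump_bounds: "0 \<le> bump l u n x" "bump l u n x \<le> 1"
  unfolding bump_def by (auto intro!: prod_nonneg prod_le_1 mult_nonneg_nonneg mult_le_one simp: flat_exp_1_bounds)

lemma bump_0:
  assumes "x \<notin> box l u"
  shows "bump l u n x = 0"
proof -
  from assms obtain b where "b \<in> Basis" "inner x b \<le> inner l b \<or> inner u b \<le> inner x b"
    by (auto simp: mem_box not_less)
  then show ?thesis unfolding bump_def
    by (auto intro!: prod_zero bexI[of _ b] simp: flat_exp_1_bounds mult_nonneg_nonpos)
qed

lemma test_function_bump:
  assumes "cbox l u \<subseteq> \<Omega>"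
  shows "test_function \<Omega> (bump l u n)"
proof (rule test_functionI[OF _ compact_cbox assms])
  show "Ck k (bump l u n)" for k
  proof -
    have aff: "Ck k (\<lambda>x::'a. real n * (inner x b - inner l b))" "Ck k (\<lambda>x::'a. real n * (inner u b - inner x b))" for b
      using Ck_add[OF Ck_mult[OF Ck_const[of k "real n"] Ck_inner[of k b]] Ck_const[of k "- (real n * inner l b)"]]
        Ck_add[OF Ck_mult[OF Ck_const[of k "- real n"] Ck_inner[of k b]] Ck_const[of k "real n * inner u b"]]
      by (simp_all add: algebra_simps)
    show ?thesis
      unfolding bump_def by (intro Ck_prod Ck_mult Ck_compose[OF Ck_flat_exp] aff)
  qed
  show "bump l u n x = 0" if "x \<notin> cbox l u" for x
    using that box_subset_cbox bump_0 by blast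
qed

lemma flat_exp_1_LIMSEQ:
  assumes "t > 0"
  shows "(\<lambda>n. flat_exp 1 (real n * t)) \<longlonglongrightarrow> 1"
proof -
  have "(\<lambda>n. exp (- (inverse (real (Suc n)) * (1 / t)))) \<longlonglongrightarrow> exp (- (0 * (1 / t)))"
    by (intro tendsto_intros LIMSEQ_inverse_real_of_nat)
  moreover have "exp (- (inverse (real (Suc n)) * (1 / t))) = flat_exp 1 (real (Suc n) * t)" for n
    using assms by (simp add: flat_exp_def divide_inverse)
  ultimately show ?thesis
    using LIMSEQ_imp_Suc[of "\<lambda>n. flat_exp 1 (real n * t)"] by simp
qed

text \<open>For t > 0 the factor \<open>flat_exp 1 (n * t)\<close> equals exp(-1/(n t)) and tends to
  1, while it is 0 for t \<le> 0. The parameter \<open>n\<close> thus sharpens the bump without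
  enlarging its support.\<close>

lemma bump_LIMSEQ: "(\<lambda>n. bump l u n x) \<longlonglongrightarrow> indicator (box l u) x"
proof (cases "x \<in> box l u")
  case True
  have "(\<lambda>n. bump l u n x) \<longlonglongrightarrow> (\<Prod>b\<in>(Basis::'a set). 1 * 1)"
    unfolding bump_def using True by (intro tendsto_prod tendsto_mult flat_exp_1_LIMSEQ) (auto simp: mem_box)
  then show ?thesis using True by simp
qed (simp add: bump_0)

text \<open>Bumps give vanishing integrals over open boxes, a Dynkin argument extends this to Borel
  sets, and the sets where \<open>H\<close> is positive or negative are then null.\<close>

lemma AE_zero_if_test_integrals_zero:
  fixes H :: "'a::euclidean_space \<Rightarrow> real"
  assumes int: "integrable lborel H" and "open \<Omega>"
    and zero: "\<And>\<phi>. test_function \<Omega> \<phi> \<Longrightarrow> (LINT x|lborel. H x * \<phi> x) = 0"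
  shows "AE x in lborel. x \<in> \<Omega> \<longrightarrow> H x = 0"
proof -
  have [measurable]: "H \<in> borel_measurable borel"
    using int by auto
  have box0: "(LINT x|lborel. H x * indicator (box l u) x) = 0" if "cbox l u \<subseteq> \<Omega>" for l u
  proof -
    have "(\<lambda>n. LINT x|lborel. H x * bump l u n x) \<longlonglongrightarrow> (LINT x|lborel. H x * indicator (box l u) x)"
    proof (rule integral_dominated_convergence[where w = "\<lambda>x. \<bar>H x\<bar>"])
      show "AE x in lborel. (\<lambda>n. H x * bump l u n x) \<longlonglongrightarrow> H x * indicator (box l u) x"
        by (intro AE_I2 tendsto_intros bump_LIMSEQ)
      show "AE x in lborel. norm (H x * bump l u n x) \<le> \<bar>H x\<bar>" for n
        by (intro AE_I2) (simp add: abs_mult mult_left_le bump_bounds)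
      show "(\<lambda>x. H x * bump l u n x) \<in> borel_measurable lborel" for n
        using test_function_borel_measurable[OF test_function_bump[OF subset_UNIV], of l u n] by measurable
    qed (use int in auto)
    then show ?thesis
      using zero[OF test_function_bump[OF that]] by (simp add: LIMSEQ_const_iff)
  qed
  have cbox: "AE x in lborel. x \<in> cbox p q \<longrightarrow> H x = 0" if pq: "cbox p q \<subseteq> \<Omega>" for p q
  proof -
    \<comment> \<open>Cutting \<open>H\<close> off outside one box makes the total integral 0, as
      the complement case of the induction needs, and lets arbitrary boxes serve as generators,
      since their traces lie in \<open>\<Omega>\<close>.\<close>
    define Q where "Q x = H x * indicator (box p q) x" for x
    have intQ: "integrable lborel (\<lambda>x. Q x * indicator B x)" if "B \<in> sets borel" for B
      unfolding Q_def using int that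
      by (intro integrable_real_mult_indicator) auto
    have Q0: "(LINT x|lborel. Q x) = 0"
      using box0[OF pq] by (simp add: Q_def)
    have borel0: "(LINT x|lborel. Q x * indicator B x) = 0" if "B \<in> sets borel" for B
    proof -
      let ?G = "range (\<lambda>(a, b). box a b :: 'a set)"
      have "Int_stable ?G"
        by (auto simp: Int_stable_def box_Int_box)
      moreover have "?G \<subseteq> Pow UNIV" by auto
      moreover have "B \<in> sigma_sets UNIV ?G"
        using that unfolding borel_eq_box by simp
      ultimately show ?thesis
      proof (induction rule: sigma_sets_induct_disjoint)
        case (basic A)
        then obtain a b where A: "A = box a b" by auto
        obtain a' b' where ab: "box p q \<inter> box a b = box a' b'" "box a' b' = {} \<or> cbox a' b' \<subseteq> cbox p q"
        proof -
          define a' where "a' = (\<Sum>i\<in>Basis. max (p \<bullet> i) (a \<bullet> i) *\<^sub>R i)"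
          define b' where "b' = (\<Sum>i\<in>Basis. min (q \<bullet> i) (b \<bullet> i) *\<^sub>R i)"
          have "box p q \<inter> box a b = box a' b'"
            by (simp add: box_Int_box a'_def b'_def)
          moreover have "cbox a' b' \<subseteq> cbox p q"
            by (auto simp: mem_box a'_def b'_def)
          ultimately show ?thesis using that by blast
        qed
        have "(LINT x|lborel. Q x * indicator A x) = (LINT x|lborel. H x * indicator (box a' b') x)"
          unfolding Q_def A ab(1)[symmetric] by (simp add: indicator_inter_arith mult.assoc)
        also have "\<dots> = 0"
          using ab(2) box0[of a' b'] pq by auto
        finally show ?case .
      next
        case empty
        then show ?case by simp
      next
        case (compl A)
        then have A: "A \<in> sets borel" by (simp add: borel_eq_box)
        have "(LINT x|lborel. Q x * indicator (UNIV - A) x) = (LINT x|lborel. Q x * indicator UNIV x - Q x * indicator A x)"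
          by (intro Bochner_Integration.integral_cong) (auto simp: indicator_def)
        also have "\<dots> = 0"
          using intQ[OF A] intQ[of UNIV] compl Q0 by (subst Bochner_Integration.integral_diff) auto
        finally show ?case .
      next
        case (union F)
        then have F: "F i \<in> sets borel" for i by (auto simp: borel_eq_box)
        have "(\<lambda>n. LINT x|lborel. Q x * indicator (\<Union>i<n. F i) x) \<longlonglongrightarrow> (LINT x|lborel. Q x * indicator (\<Union>(range F)) x)"
        proof (rule integral_dominated_convergence[where w = "\<lambda>x. \<bar>Q x\<bar>"])
          have "(\<lambda>n. indicator (\<Union>i<n. F i) x :: real) \<longlonglongrightarrow> indicator (\<Union>(range F)) x" for x
          proof (cases "x \<in> \<Union>(range F)")
            case True
            then obtain m where "x \<in> F m" by auto
            then have "\<forall>\<^sub>F n in sequentially. (indicator (\<Union>i<n. F i) x :: real) = 1"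
              by (auto simp: eventually_sequentially indicator_def intro!: exI[of _ "Suc m"])
            then show ?thesis using True by (simp add: tendsto_eventually)
          qed auto
          then show "AE x in lborel. (\<lambda>n. Q x * indicator (\<Union>i<n. F i) x) \<longlonglongrightarrow> Q x * indicator (\<Union>(range F)) x"
            by (intro AE_I2 tendsto_intros)
          show "AE x in lborel. norm (Q x * indicator (\<Union>i<n. F i) x) \<le> \<bar>Q x\<bar>" for n
            by (auto simp: indicator_def)
        qed (use intQ[of UNIV] F in \<open>auto simp: Q_def\<close>)
        moreover have "(LINT x|lborel. Q x * indicator (\<Union>i<n. F i) x) = 0" for n
        proof -
          have "(LINT x|lborel. Q x * indicator (\<Union>i<n. F i) x) = (LINT x|lborel. (\<Sum>i<n. Q x * indicator (F i) x))"
            using union(1) by (subst indicator_UN_disjoint)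
              (auto simp: sum_distrib_left disjoint_family_on_def)
          also have "\<dots> = (\<Sum>i<n. LINT x|lborel. Q x * indicator (F i) x)"
            by (rule Bochner_Integration.integral_sum) (simp add: intQ F)
          finally show ?thesis using union by simp
        qed
        ultimately show ?case by (simp add: LIMSEQ_const_iff)
      qed
    qed
    have [measurable]: "Q \<in> borel_measurable borel" unfolding Q_def by measurable
    \<comment> \<open>Used with s = 1 and s = -1, for the positive and the negative set.\<close>
    have half: "AE x in lborel. \<not> 0 < s * Q x" for s :: real
    proof -
      have *: "integrable lborel (\<lambda>x. (s * Q x) * indicator {x. 0 < s * Q x} x)"
        using intQ[of "{x. 0 < s * Q x}"] by (simp add: mult.assoc)
      have "(LINT x|lborel. (s * Q x) * indicator {x. 0 < s * Q x} x) = 0"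
        using borel0[of "{x. 0 < s * Q x}"] by (simp add: mult.assoc)
      then have "AE x in lborel. (s * Q x) * indicator {x. 0 < s * Q x} x = 0"
        by (subst (asm) integral_nonneg_eq_0_iff_AE[OF *]) (auto simp: indicator_def)
      then show ?thesis
        by eventually_elim (auto simp: indicator_def split: if_splits)
    qed
    have "AE x in lborel. x \<notin> cbox p q - box p q"
    proof (rule AE_not_in)
      have "negligible (cbox p q - box p q)" by (rule negligible_frontier_interval)
      then show "cbox p q - box p q \<in> null_sets lborel"
        by (auto simp: negligible_iff_null_sets null_sets_def)
    qed
    with half[of 1] half[of "-1"] show ?thesis
      by eventually_elim (auto simp: Q_def indicator_def split: if_splits)
  qed
  obtain \<D> where D: "countable \<D>" "\<D> \<subseteq> Pow \<Omega>" "\<And>X. X \<in> \<D> \<Longrightarrow> \<exists>a b. X = cbox a b" "\<Union>\<D> = \<Omega>"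
    using open_countable_Union_open_cbox[OF \<open>open \<Omega>\<close>] by metis
  have "AE x in lborel. \<forall>X\<in>\<D>. x \<in> X \<longrightarrow> H x = 0"
    unfolding AE_ball_countable[OF D(1)]
  proof
    fix X assume X: "X \<in> \<D>"
    then obtain a b where ab: "X = cbox a b" using D(3) by blast
    moreover have "X \<subseteq> \<Omega>" using X D(2) by blast
    ultimately show "AE x in lborel. x \<in> X \<longrightarrow> H x = 0" using cbox by simp
  qed
  then show ?thesis
    by eventually_elim (use D(4) in auto)
qed

section \<open>Integration in the radial variable\<close>

text \<open>The area of the sphere of radius \<open>r\<close>, that is, the derivative of the volume
  of the ball. The value 0 for negative \<open>r\<close> makes it the density of the distribution of
  \<open>norm\<close> on the whole line.\<close>

definition radial_weight :: "'a::euclidean_space itself \<Rightarrow> real \<Rightarrow> real" where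
  "radial_weight _ r = (if r < 0 then 0 else real DIM('a) * unit_ball_vol (real DIM('a)) * r ^ (DIM('a) - 1))"

lemma radial_weight_nonneg: "0 \<le> radial_weight T r"
  unfolding radial_weight_def by auto

lemma radial_weight_measurable [measurable]: "radial_weight T \<in> borel_measurable borel"
  unfolding radial_weight_def[abs_def] by measurable

text \<open>Both measures agree on the half-lines \<open>{..a}\<close>, by the volume of a ball on
  the left and the fundamental theorem of calculus on the right, and half-lines generate the Borel
  sets.\<close>

lemma distr_norm_lborel:
  "distr lborel borel (norm :: 'a::euclidean_space \<Rightarrow> real) = density lborel (\<lambda>r. ennreal (radial_weight TYPE('a) r))"
    (is "?D = ?W")
proof (rule measure_eqI_generator_eq[where E = "range (\<lambda>a::real. {..a})" and \<Omega> = UNIV and A = "\<lambda>n. {..real n}"])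
  show "Int_stable (range (\<lambda>a::real. {..a}))"
    by (auto simp: Int_stable_def)
  have eq: "emeasure ?D {..a} = ennreal (if a < 0 then 0 else unit_ball_vol (real DIM('a)) * a ^ DIM('a))" for a
  proof -
    have "norm -` {..a} = (cball 0 a :: 'a set)" by auto
    then show ?thesis
      by (cases "a < 0") (simp_all add: emeasure_distr emeasure_cball)
  qed
  show "emeasure ?D X = emeasure ?W X" if "X \<in> range (\<lambda>a. {..a})" for X
  proof -
    from that obtain a where X: "X = {..a}" by auto
    let ?w = "\<lambda>r. real DIM('a) * unit_ball_vol (real DIM('a)) * r ^ (DIM('a) - 1)"
    have "emeasure ?W X = (\<integral>\<^sup>+r. ennreal (?w r) * indicator {0..a} r \<partial>lborel)"
      unfolding X by (simp add: emeasure_density)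
        (auto intro!: nn_integral_cong simp: radial_weight_def indicator_def)
    also have "\<dots> = ennreal (if a < 0 then 0 else unit_ball_vol (real DIM('a)) * a ^ DIM('a))"
    proof (cases "a < 0")
      case False
      have "(\<integral>\<^sup>+r. ennreal (?w r) * indicator {0..a} r \<partial>lborel)
          = ennreal (unit_ball_vol (real DIM('a)) * a ^ DIM('a) - unit_ball_vol (real DIM('a)) * 0 ^ DIM('a))"
        by (rule nn_integral_FTC_Icc) (use False in \<open>auto intro!: derivative_eq_intros\<close>)
      then show ?thesis using False by simp
    qed simp
    finally show ?thesis using eq[of a] X by simp
  qed
  show "emeasure ?D {..real n} \<noteq> \<infinity>" for n
    by (simp add: eq)
  show "(\<Union>n. {..real n}) = UNIV"
    using real_arch_simple by auto
qed (auto simp: borel_eq_atMost)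

lemma radial_integrable_iff:
  fixes k :: "real \<Rightarrow> real"
  assumes [measurable]: "k \<in> borel_measurable borel"
  shows "integrable lborel (\<lambda>x::'a::euclidean_space. k (norm x))
    \<longleftrightarrow> integrable lborel (\<lambda>r. radial_weight TYPE('a) r * k r)"
proof -
  have "integrable lborel (\<lambda>x::'a. k (norm x)) \<longleftrightarrow> integrable (distr lborel borel (norm :: 'a \<Rightarrow> real)) k"
    by (simp add: integrable_distr_eq)
  also have "\<dots> \<longleftrightarrow> integrable lborel (\<lambda>r. radial_weight TYPE('a) r * k r)"
    unfolding distr_norm_lborel by (simp add: integrable_density radial_weight_nonneg)
  finally show ?thesis .
qed

lemma radial_integral:
  fixes k :: "real \<Rightarrow> real"
  assumes [measurable]: "k \<in> borel_measurable borel"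
  shows "(LINT x|lborel. k (norm (x::'a::euclidean_space))) = (LINT r|lborel. radial_weight TYPE('a) r * k r)"
proof -
  have "(LINT x|lborel. k (norm (x::'a))) = (LINT r|distr lborel borel (norm :: 'a \<Rightarrow> real). k r)"
    by (simp add: integral_distr)
  also have "\<dots> = (LINT r|lborel. radial_weight TYPE('a) r * k r)"
    unfolding distr_norm_lborel by (simp add: integral_density radial_weight_nonneg)
  finally show ?thesis .
qed

text \<open>The distribution of the norm has a density, so preimages of null sets under
  \<open>norm\<close> are null.\<close>

lemma AE_norm_lborel:
  assumes "AE r in lborel. P r"
  shows "AE x::'a::euclidean_space in lborel. P (norm x)"
proof -
  from assms obtain N where N: "N \<in> null_sets lborel" "{r \<in> space lborel. \<not> P r} \<subseteq> N"
    by (auto simp: eventually_ae_filter)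
  have "N \<in> null_sets (distr lborel borel (norm :: 'a \<Rightarrow> real))"
    unfolding distr_norm_lborel using N(1) AE_not_in[OF N(1)]
    by (subst null_sets_density_iff) (auto elim: eventually_mono)
  then have "(norm :: 'a \<Rightarrow> real) -` N \<in> null_sets lborel"
    by (subst (asm) null_sets_distr_iff) auto
  from AE_not_in[OF this] show ?thesis
    by eventually_elim (use N(2) in auto)
qed

text \<open>The density \<open>h\<close> is, up to a factor, the mean of \<open>\<rho>\<close> over spheres. It is obtained by the
  Radon-Nikodym theorem, which avoids polar coordinates.\<close>

lemma radial_density_nonneg:
  fixes \<rho> :: "'a::euclidean_space \<Rightarrow> real"
  assumes int: "integrable lborel \<rho>" and nn: "\<And>x. 0 \<le> \<rho> x"
  shows "\<exists>h. integrable lborel h \<and> (\<forall>g. g \<in> borel_measurable borel \<longrightarrow> integrable lborel (\<lambda>x. g (norm x) * \<rho> x) \<longrightarrow>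
      integrable lborel (\<lambda>r. g r * h r) \<and> (LINT x|lborel. g (norm x) * \<rho> x) = (LINT r|lborel. g r * h r :: real))"
proof -
  have [measurable]: "\<rho> \<in> borel_measurable borel" using int by auto
  let ?N = "distr (density lborel (\<lambda>x. ennreal (\<rho> x))) borel norm"
  have fin: "emeasure ?N UNIV < \<infinity>"
    using int nn by (simp add: emeasure_distr emeasure_density integrable_iff_bounded)
  have "absolutely_continuous lborel ?N"
    unfolding absolutely_continuous_def
  proof
    fix A :: "real set" assume A: "A \<in> null_sets lborel"
    have "AE x::'a in lborel. norm x \<notin> A"
      by (rule AE_norm_lborel[OF AE_not_in[OF A]])
    then have "AE x::'a in density lborel (\<lambda>x. ennreal (\<rho> x)). norm x \<notin> A"
      by (simp add: AE_density) (auto elim: eventually_mono)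
    then have "norm -` A \<in> null_sets (density lborel (\<lambda>x::'a. ennreal (\<rho> x)))"
      using measurable_sets[of "norm :: 'a \<Rightarrow> real" borel borel A] A
      by (subst AE_iff_null_sets) (auto simp: null_sets_def)
    then show "A \<in> null_sets ?N"
      using A by (subst null_sets_distr_iff) auto
  qed
  then obtain f where f[measurable]: "f \<in> borel_measurable borel" and dens: "density lborel f = ?N"
    using sigma_finite_measure.Radon_Nikodym[OF sigma_finite_lborel, of ?N] by auto
  have "(\<integral>\<^sup>+r. f r \<partial>lborel) < \<infinity>"
  proof -
    have "emeasure (density lborel f) UNIV = (\<integral>\<^sup>+r. f r \<partial>lborel)"
      by (simp add: emeasure_density)
    then show ?thesis using fin dens by simp
  qed
  \<comment> \<open>The Radon-Nikodym density takes values in \<open>ennreal\<close>. Its total mass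
    is finite, so it is finite almost everywhere and can be read as a real function.\<close>
  then have finf: "AE r in lborel. f r \<noteq> \<infinity>"
    by (intro nn_integral_noteq_infinite) auto
  define h where "h r = enn2real (f r)" for r
  have [measurable]: "h \<in> borel_measurable borel" unfolding h_def[abs_def] by measurable
  have "AE r in lborel. f r = ennreal (h r)"
    using finf by eventually_elim (simp add: h_def less_top)
  then have N: "?N = density lborel (\<lambda>r. ennreal (h r))"
    unfolding dens[symmetric] by (intro density_cong) auto
  have hnn: "0 \<le> h r" for r by (simp add: h_def)
  have *: "integrable lborel (\<lambda>r. g r * h r) \<and> (LINT x|lborel. g (norm x) * \<rho> x) = (LINT r|lborel. g r * h r)"
    if [measurable]: "g \<in> borel_measurable borel" and g: "integrable lborel (\<lambda>x. g (norm x) * \<rho> x)" for g :: "real \<Rightarrow> real"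
  proof -
    have "integrable ?N g"
      using g by (simp add: integrable_distr_eq integrable_density nn mult.commute)
    then have "integrable lborel (\<lambda>r. g r * h r)"
      unfolding N by (simp add: integrable_density hnn mult.commute)
    moreover have "(LINT x|lborel. g (norm x) * \<rho> x) = (LINT r|?N. g r)"
      by (simp add: integral_distr integral_density nn mult.commute)
    moreover have "\<dots> = (LINT r|lborel. g r * h r)"
      unfolding N by (simp add: integral_density hnn mult.commute)
    ultimately show ?thesis by simp
  qed
  have "integrable lborel h"
    using *[of "\<lambda>_. 1"] int by simp
  with * show ?thesis by blast
qed

lemma radial_density:
  fixes \<rho> :: "'a::euclidean_space \<Rightarrow> real"
  assumes int: "integrable lborel \<rho>"
  shows "\<exists>h. integrable lborel h \<and> (\<forall>g. g \<in> borel_measurable borel \<longrightarrow> integrable lborel (\<lambda>x. g (norm x) * \<rho> x) \<longrightarrow>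
      integrable lborel (\<lambda>r. g r * h r) \<and> (LINT x|lborel. g (norm x) * \<rho> x) = (LINT r|lborel. g r * h r :: real))"
proof -
  have [measurable]: "\<rho> \<in> borel_measurable borel" using int by auto
  have int': "integrable lborel (\<lambda>x. max 0 (\<rho> x))" "integrable lborel (\<lambda>x. max 0 (- \<rho> x))"
    using int by auto
  obtain h1 where h1: "integrable lborel h1"
    "\<And>g. g \<in> borel_measurable borel \<Longrightarrow> integrable lborel (\<lambda>x. g (norm x) * max 0 (\<rho> x)) \<Longrightarrow>
      integrable lborel (\<lambda>r. g r * h1 r) \<and> (LINT x|lborel. g (norm x) * max 0 (\<rho> x)) = (LINT r|lborel. g r * h1 r :: real)"
    using radial_density_nonneg[OF int'(1) max.cobounded1] by blast
  obtain h2 where h2: "integrable lborel h2"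
    "\<And>g. g \<in> borel_measurable borel \<Longrightarrow> integrable lborel (\<lambda>x. g (norm x) * max 0 (- \<rho> x)) \<Longrightarrow>
      integrable lborel (\<lambda>r. g r * h2 r) \<and> (LINT x|lborel. g (norm x) * max 0 (- \<rho> x)) = (LINT r|lborel. g r * h2 r :: real)"
    using radial_density_nonneg[OF int'(2) max.cobounded1] by blast
  show ?thesis
  proof (intro exI[of _ "\<lambda>r. h1 r - h2 r"] conjI allI impI)
    show "integrable lborel (\<lambda>r. h1 r - h2 r)" using h1(1) h2(1) by simp
    fix g :: "real \<Rightarrow> real"
    assume [measurable]: "g \<in> borel_measurable borel" and g: "integrable lborel (\<lambda>x. g (norm x) * \<rho> x)"
    have i1: "integrable lborel (\<lambda>x. g (norm x) * max 0 (\<rho> x))"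
      by (rule Bochner_Integration.integrable_bound[OF g]) (auto simp: abs_mult intro!: mult_left_mono)
    have i2: "integrable lborel (\<lambda>x. g (norm x) * max 0 (- \<rho> x))"
      by (rule Bochner_Integration.integrable_bound[OF g]) (auto simp: abs_mult intro!: mult_left_mono)
    have "(LINT x|lborel. g (norm x) * \<rho> x) = (LINT x|lborel. g (norm x) * max 0 (\<rho> x) - g (norm x) * max 0 (- \<rho> x))"
      by (intro Bochner_Integration.integral_cong) (auto simp: max_def algebra_simps)
    also have "\<dots> = (LINT r|lborel. g r * h1 r) - (LINT r|lborel. g r * h2 r)"
      using i1 i2 h1(2)[of g] h2(2)[of g] by (subst Bochner_Integration.integral_diff) auto
    also have "\<dots> = (LINT r|lborel. g r * h1 r - g r * h2 r)"
      using h1(2)[of g] h2(2)[of g] i1 i2 by (subst Bochner_Integration.integral_diff) auto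
    finally show "(LINT x|lborel. g (norm x) * \<rho> x) = (LINT r|lborel. g r * (h1 r - h2 r))"
      by (simp only: right_diff_distrib)
    show "integrable lborel (\<lambda>r. g r * (h1 r - h2 r))"
      using h1(2)[of g] h2(2)[of g] i1 i2 by (simp add: right_diff_distrib)
  qed
qed

text \<open>The double integrand is dominated by the product of \<open>q\<close> and
  \<open>\<eta>\<close>. Two different spaces are allowed because the kernel is [s \<le> r] on the
  line in one application and [s \<le> |x|], linking space and line, in the other.\<close>

lemma Fubini_bounded_kernel:
  fixes q :: "'b::euclidean_space \<Rightarrow> real" and \<eta> :: "'a::euclidean_space \<Rightarrow> real"
  assumes q: "integrable lborel q" and \<eta>: "integrable lborel \<eta>"
    and [measurable]: "(\<lambda>(x, y). K x y) \<in> borel_measurable (borel \<Otimes>\<^sub>M borel)"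
    and K: "\<And>x y. \<bar>K x y\<bar> \<le> (1::real)"
  shows "(LINT x|lborel. q x * (LINT y|lborel. K x y * \<eta> y)) = (LINT y|lborel. \<eta> y * (LINT x|lborel. K x y * q x))"
    and "integrable lborel (\<lambda>x. q x * (LINT y|lborel. K x y * \<eta> y))"
    and "integrable lborel (\<lambda>y. \<eta> y * (LINT x|lborel. K x y * q x))"
proof -
  have [measurable]: "q \<in> borel_measurable borel" "\<eta> \<in> borel_measurable borel"
    using q \<eta> by auto
  have "integrable (lborel \<Otimes>\<^sub>M lborel) (\<lambda>(x, y). q x * \<eta> y)"
  proof (rule lborel_pair.Fubini_integrable)
    show "integrable lborel (\<lambda>x. LINT y|lborel. norm (case (x, y) of (x, y) \<Rightarrow> q x * \<eta> y))"
      using q by (simp add: abs_mult)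
  qed (use \<eta> in auto)
  then have *: "integrable (lborel \<Otimes>\<^sub>M lborel) (\<lambda>(x, y). q x * (K x y * \<eta> y))"
  proof (rule Bochner_Integration.integrable_bound)
    have "\<bar>q x * (K x y * \<eta> y)\<bar> \<le> \<bar>q x * \<eta> y\<bar>" for x y
      using K[of x y] by (simp add: abs_mult mult_left_le_one_le mult_left_mono)
    then show "AE p in lborel \<Otimes>\<^sub>M lborel. norm (case p of (x, y) \<Rightarrow> q x * (K x y * \<eta> y)) \<le> norm (case p of (x, y) \<Rightarrow> q x * \<eta> y)"
      by (intro AE_I2) (simp add: split_beta)
  qed measurable
  show "integrable lborel (\<lambda>x. q x * (LINT y|lborel. K x y * \<eta> y))"
    using lborel_pair.integrable_fst'[OF *] by simp
  have sw: "(\<lambda>y. LINT x|lborel. q x * (K x y * \<eta> y)) = (\<lambda>y. \<eta> y * (LINT x|lborel. K x y * q x))"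
    by (intro ext) (simp add: mult_ac flip: integral_mult_right_zero)
  show "integrable lborel (\<lambda>y. \<eta> y * (LINT x|lborel. K x y * q x))"
    using lborel_pair.integrable_snd[OF *] unfolding sw .
  show "(LINT x|lborel. q x * (LINT y|lborel. K x y * \<eta> y)) = (LINT y|lborel. \<eta> y * (LINT x|lborel. K x y * q x))"
    using lborel_pair.Fubini_integral[OF *] unfolding sw by simp
qed

section \<open>The one-dimensional du Bois-Reymond lemma\<close>

text \<open>Written with a 0-1 kernel over the whole line, rather than as an integral over a
  half-line, so that \<open>Fubini_bounded_kernel\<close> applies directly.\<close>

definition antideriv :: "(real \<Rightarrow> real) \<Rightarrow> real \<Rightarrow> real" where
  "antideriv q r = (LINT s|lborel. (if s \<le> r then 1 else 0) * q s)"

lemma step_kernel_measurable [measurable]: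
  "(\<lambda>(r, s). if (s::real) \<le> r then 1 else 0 :: real) \<in> borel_measurable (borel \<Otimes>\<^sub>M borel)"
  by measurable

lemma antideriv_measurable [measurable]:
  assumes [measurable]: "q \<in> borel_measurable borel"
  shows "antideriv q \<in> borel_measurable borel"
  unfolding antideriv_def[abs_def] by measurable

text \<open>A compact support keeps a distance from both ends. The smaller interval later provides
  compact supports for antiderivatives and for compositions with the norm.\<close>

lemma test_function_real_bounds:
  fixes \<psi> :: "real \<Rightarrow> real"
  assumes "test_function {a<..<b} \<psi>" "a < b"
  obtains a' b' where "a < a'" "a' < b'" "b' < b" "test_function {a'<..<b'} \<psi>"
proof -
  from assms(1) obtain K where K: "compact K" "K \<subseteq> {a<..<b}" "\<And>x. x \<notin> K \<Longrightarrow> \<psi> x = 0"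
    by (metis test_functionE)
  obtain l u where lu: "a < l" "l \<le> u" "u < b" "K \<subseteq> {l..u}"
  proof (cases "K = {}")
    case True
    show ?thesis by (rule that[of "(a + b) / 2" "(a + b) / 2"]) (use assms True in auto)
  next
    case False
    obtain l where l: "l \<in> K" "\<And>x. x \<in> K \<Longrightarrow> l \<le> x" using compact_attains_inf[OF K(1) False] by blast
    obtain u where u: "u \<in> K" "\<And>x. x \<in> K \<Longrightarrow> x \<le> u" using compact_attains_sup[OF K(1) False] by blast
    show ?thesis by (rule that[of l u]) (use l u K(2) in auto)
  qed
  show ?thesis
  proof (rule that[of "(a + l) / 2" "(u + b) / 2"])
    show "test_function {(a + l) / 2<..<(u + b) / 2} \<psi>"
      by (rule test_functionI[OF test_function_Ck[OF assms(1)] K(1) _ K(3)]) (use lu in auto)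
  qed (use lu in auto)
qed

lemma antideriv_test_function_has_derivative:
  assumes "test_function \<Omega> \<eta>"
  shows "(antideriv \<eta> has_real_derivative \<eta> r) (at r)"
proof -
  from assms obtain K where K: "compact K" "\<And>x. x \<notin> K \<Longrightarrow> \<eta> x = 0"
    by (metis test_functionE)
  obtain B where B: "\<And>x. x \<in> K \<Longrightarrow> \<bar>x\<bar> \<le> B"
    using compact_imp_bounded[OF K(1)] unfolding bounded_iff by auto
  \<comment> \<open>\<open>c\<close> lies to the left of \<open>r\<close> and of the support, so the
    antiderivative becomes an integral over a compact interval starting at \<open>c\<close>.\<close>
  define c where "c = min (- \<bar>B\<bar>) r - 1"
  have cont: "continuous_on S \<eta>" for S
    using Ck_continuous[OF test_function_Ck[OF assms]] continuous_on_subset by blast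
  have eq: "antideriv \<eta> t = integral {c..t} \<eta>" for t
  proof -
    have "antideriv \<eta> t = (LINT s:{c..t}|lborel. \<eta> s)"
      unfolding antideriv_def set_lebesgue_integral_def
    proof (intro Bochner_Integration.integral_cong refl)
      fix s show "(if s \<le> t then 1 else 0) * \<eta> s = indicator {c..t} s *\<^sub>R \<eta> s"
        using K(2)[of s] B[of s] by (cases "s \<in> K") (auto simp: indicator_def c_def)
    qed
    also have "\<dots> = integral {c..t} \<eta>"
      by (rule set_borel_integral_eq_integral) (unfold set_integrable_def, rule borel_integrable_compact[OF compact_Icc cont])
    finally show ?thesis .
  qed
  have "((\<lambda>t. integral {c..t} \<eta>) has_real_derivative \<eta> r) (at r within {c..r + 1})"
    by (rule integral_has_real_derivative[OF cont]) (auto simp: c_def)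
  then have "(antideriv \<eta> has_real_derivative \<eta> r) (at r within {c..r + 1})"
    unfolding eq[abs_def, symmetric] by (simp add: eq[abs_def])
  then show ?thesis
    by (subst (asm) at_within_interior) (auto simp: c_def)
qed

lemma Ck_antideriv:
  assumes "test_function \<Omega> \<eta>"
  shows "Ck k (antideriv \<eta>)"
  by (rule Ck_pred) (rule Ck_real_SucI[OF antideriv_test_function_has_derivative[OF assms] test_function_Ck[OF assms]])

lemma antideriv_left:
  assumes "test_function {a<..<b} \<eta>" "r \<le> a"
  shows "antideriv \<eta> r = 0"
proof -
  have "(if s \<le> r then 1 else 0) * \<eta> s = 0" for s
    using test_function_0[OF assms(1), of s] assms(2) by auto
  then show ?thesis unfolding antideriv_def by (simp only: Bochner_Integration.integral_zero)
qed

lemma antideriv_right: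
  assumes "test_function {a<..<b} \<eta>" "b \<le> r"
  shows "antideriv \<eta> r = (LINT s|lborel. \<eta> s)"
proof -
  have "(if s \<le> r then 1 else 0) * \<eta> s = \<eta> s" for s
    using test_function_0[OF assms(1), of s] assms(2) by auto
  then show ?thesis unfolding antideriv_def by (simp only:)
qed

text \<open>Mean zero is what makes the antiderivative vanish to the right of the support as
  well.\<close>

lemma test_function_antideriv:
  assumes "test_function {a<..<b} \<eta>" "a < b" "(LINT s|lborel. \<eta> s) = 0"
  shows "test_function {a<..<b} (antideriv \<eta>)"
proof -
  obtain a' b' where ab: "a < a'" "a' < b'" "b' < b" "test_function {a'<..<b'} \<eta>"
    using test_function_real_bounds[OF assms(1,2)] by blast
  show ?thesis
  proof (rule test_functionI[OF Ck_antideriv[OF assms(1)], where K = "{a'..b'}"])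
    show "antideriv \<eta> r = 0" if "r \<notin> {a'..b'}" for r
      using that antideriv_left[OF ab(4), of r] antideriv_right[OF ab(4), of r] assms(3) by fastforce
  qed (use ab in auto)
qed

text \<open>Integration by parts as an instance of Fubini for the kernel [s \<le> r]: the integral
  of \<open>q\<close> over r \<ge> s is its total integral minus \<open>antideriv q s\<close>, up to
  the null set r = s.\<close>

lemma integral_mult_antideriv:
  assumes q: "integrable lborel q" and \<eta>: "integrable lborel \<eta>"
  shows "(LINT r|lborel. q r * antideriv \<eta> r) = (LINT s|lborel. \<eta> s) * (LINT r|lborel. q r) - (LINT s|lborel. \<eta> s * antideriv q s)"
    and "integrable lborel (\<lambda>s. \<eta> s * antideriv q s)"
proof -
  have K: "\<bar>if (s::real) \<le> r then 1 else 0\<bar> \<le> (1::real)" for r s by auto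
  note F = Fubini_bounded_kernel[OF q \<eta> step_kernel_measurable K]
  have eq: "(LINT r|lborel. (if s \<le> r then 1 else 0) * q r) = (LINT r|lborel. q r) - antideriv q s" for s
  proof -
    have i: "integrable lborel (\<lambda>r. (if r \<le> s then 1 else 0) * q r)"
      by (rule Bochner_Integration.integrable_bound[OF q]) (use q in auto)
    have "(LINT r|lborel. (if s \<le> r then 1 else 0) * q r) = (LINT r|lborel. q r - (if r \<le> s then 1 else 0) * q r)"
    proof (rule integral_cong_AE)
      have "AE r in lborel. r \<noteq> s" by (rule AE_lborel_singleton)
      then show "AE r in lborel. (if s \<le> r then 1 else 0) * q r = q r - (if r \<le> s then 1 else 0) * q r"
        by eventually_elim auto
    qed (use q in auto)
    then show ?thesis
      unfolding antideriv_def using q i by simp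
  qed
  have i2: "integrable lborel (\<lambda>s. \<eta> s * ((LINT r|lborel. q r) - antideriv q s))"
    using F(3) unfolding eq .
  have i3: "integrable lborel (\<lambda>s. \<eta> s * (LINT r|lborel. q r) - \<eta> s * ((LINT r|lborel. q r) - antideriv q s))"
    by (intro Bochner_Integration.integrable_diff integrable_mult_left \<eta> i2)
  then show *: "integrable lborel (\<lambda>s. \<eta> s * antideriv q s)"
    by (simp add: algebra_simps)
  have "(LINT r|lborel. q r * antideriv \<eta> r) = (LINT s|lborel. \<eta> s * ((LINT r|lborel. q r) - antideriv q s))"
    using F(1) unfolding eq antideriv_def[symmetric] .
  also have "\<dots> = (LINT s|lborel. \<eta> s) * (LINT r|lborel. q r) - (LINT s|lborel. \<eta> s * antideriv q s)"
    unfolding right_diff_distrib using * \<eta> by simp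
  finally show "(LINT r|lborel. q r * antideriv \<eta> r) = (LINT s|lborel. \<eta> s) * (LINT r|lborel. q r) - (LINT s|lborel. \<eta> s * antideriv q s)" .
qed

text \<open>A test function of mean zero is the derivative of a test function, so
  \<open>p - antideriv q\<close> is orthogonal to all of them. Any test function has mean zero after
  subtraction of a multiple of the fixed bump \<open>k0\<close>, which leaves one free
  constant.\<close>

lemma du_Bois_Reymond:
  fixes p q :: "real \<Rightarrow> real"
  assumes "a < b" and p: "integrable lborel p" and q: "integrable lborel q"
    and weak: "\<And>\<psi> \<psi>'. test_function {a<..<b} \<psi> \<Longrightarrow> test_function {a<..<b} \<psi>' \<Longrightarrow> (\<And>r. (\<psi> has_real_derivative \<psi>' r) (at r)) \<Longrightarrow>
      (LINT r|lborel. p r * \<psi>' r) = - (LINT r|lborel. q r * \<psi> r)"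
  shows "\<exists>C. AE r in lborel. r \<in> {a<..<b} \<longrightarrow> p r = C + antideriv q r"
proof -
  note [measurable] = borel_measurable_integrable[OF p, simplified] borel_measurable_integrable[OF q, simplified]
  define l u where "l = a + (b - a) / 3" and "u = a + 2 * (b - a) / 3"
  have lu: "a < l" "l < u" "u < b" using \<open>a < b\<close> by (auto simp: l_def u_def field_simps)
  define k0 where "k0 = bump l u 1"
  have k0: "test_function {a<..<b} k0"
    unfolding k0_def using lu by (intro test_function_bump) auto
  have pq: "integrable lborel (\<lambda>r. p r * k r)" "integrable lborel (\<lambda>r. antideriv q r * k r)" if "test_function {a<..<b} k" for k
  proof -
    show "integrable lborel (\<lambda>r. p r * k r)"
      by (rule integrable_mult_test_function[OF p that])
    show "integrable lborel (\<lambda>r. antideriv q r * k r)"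
      using integral_mult_antideriv(2)[OF q test_function_integrable[OF that]] by (simp add: mult.commute)
  qed
  have c0: "(LINT r|lborel. k0 r) > 0"
  proof (rule ccontr)
    assume "\<not> ?thesis"
    then have "(LINT r|lborel. k0 r) = 0"
      using Bochner_Integration.integral_nonneg[of lborel k0] by (simp add: k0_def bump_bounds not_less order_antisym)
    then have "AE r in lborel. k0 r = 0"
      by (subst (asm) integral_nonneg_eq_0_iff_AE[OF test_function_integrable[OF k0]]) (auto simp: k0_def bump_bounds)
    then have "AE r in lborel. r \<notin> {l<..<u}"
    proof eventually_elim
      case (elim r)
      then show ?case by (auto simp: k0_def bump_def flat_exp_def)
    qed
    then have "emeasure lborel {l<..<u} = 0"
      by (subst (asm) AE_iff_null_sets[symmetric]) auto
    then show False using lu by simp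
  qed
  define d where "d r = p r - antideriv q r" for r
  \<comment> \<open>The value that the claim forces when it is tested with
    \<open>k0\<close>.\<close>
  define C where "C = (LINT r|lborel. d r * k0 r) / (LINT r|lborel. k0 r)"
  have main: "(LINT r|lborel. d r * k r) = C * (LINT r|lborel. k r)" if k: "test_function {a<..<b} k" for k
  proof -
    \<comment> \<open>With this multiple of \<open>k0\<close> subtracted, \<open>\<eta>\<close> has
      mean zero.\<close>
    define m where "m = (LINT r|lborel. k r) / (LINT r|lborel. k0 r)"
    define \<eta> where "\<eta> r = k r + k0 r * (- m)" for r
    have \<eta>: "test_function {a<..<b} \<eta>"
      unfolding \<eta>_def by (intro test_function_add k test_function_mult k0 Ck_const)
    have "(LINT r|lborel. \<eta> r) = (LINT r|lborel. k r) + (LINT r|lborel. k0 r) * (- m)"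
      unfolding \<eta>_def using test_function_integrable[OF k] test_function_integrable[OF k0]
      by (subst Bochner_Integration.integral_add) auto
    then have \<eta>0: "(LINT r|lborel. \<eta> r) = 0" using c0 by (simp add: m_def)
    have "(LINT r|lborel. p r * \<eta> r) = - (LINT r|lborel. q r * antideriv \<eta> r)"
      by (rule weak[OF test_function_antideriv[OF \<eta> \<open>a < b\<close> \<eta>0] \<eta> antideriv_test_function_has_derivative[OF \<eta>]])
    also have "\<dots> = (LINT r|lborel. antideriv q r * \<eta> r)"
      unfolding integral_mult_antideriv(1)[OF q test_function_integrable[OF \<eta>]] \<eta>0 by (simp add: mult.commute)
    finally have "(LINT r|lborel. d r * \<eta> r) = 0"
      unfolding d_def left_diff_distrib using pq[OF \<eta>] by simp
    moreover have "(LINT r|lborel. d r * \<eta> r) = (LINT r|lborel. d r * k r) - m * (LINT r|lborel. d r * k0 r)"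
    proof -
      have "integrable lborel (\<lambda>r. d r * k r)" "integrable lborel (\<lambda>r. d r * k0 r)"
        unfolding d_def left_diff_distrib using pq[OF k] pq[OF k0] by auto
      then show ?thesis
        unfolding \<eta>_def by (simp add: algebra_simps)
    qed
    ultimately show ?thesis by (simp add: C_def m_def)
  qed
  \<comment> \<open>\<open>antideriv q\<close> need not be integrable over the line, hence the
    cutoff to the bounded interval.\<close>
  define H where "H r = indicator {a<..<b} r * (d r - C)" for r
  have Ibd: "integrable lborel (indicator {a<..<b} :: real \<Rightarrow> real)"
    using \<open>a < b\<close> by (simp add: integrable_indicator_iff)
  have iQ: "integrable lborel (\<lambda>r. indicator {a<..<b} r * antideriv q r)"
    by (rule integral_mult_antideriv(2)[OF q Ibd])
  have H: "integrable lborel H"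
  proof -
    have "integrable lborel (\<lambda>r. indicator {a<..<b} r * p r - indicator {a<..<b} r * antideriv q r - C * indicator {a<..<b} r)"
      by (intro Bochner_Integration.integrable_diff iQ integrable_mult_right Ibd integrable_real_mult_indicator p)
        (use p in \<open>auto intro: integrable_real_mult_indicator simp: mult.commute\<close>)
    then show ?thesis unfolding H_def d_def by (simp add: algebra_simps)
  qed
  have "AE r in lborel. r \<in> {a<..<b} \<longrightarrow> H r = 0"
  proof (rule AE_zero_if_test_integrals_zero[OF H])
    fix k assume k: "test_function {a<..<b} k"
    have "(LINT r|lborel. H r * k r) = (LINT r|lborel. d r * k r - C * k r)"
      by (intro Bochner_Integration.integral_cong) (auto simp: H_def indicator_def algebra_simps test_function_0[OF k])
    also have "\<dots> = 0"
      using pq[OF k] test_function_integrable[OF k] main[OF k]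
      by (subst Bochner_Integration.integral_diff) (auto simp: d_def left_diff_distrib)
    finally show "(LINT r|lborel. H r * k r) = 0" .
  qed simp
  then have "AE r in lborel. r \<in> {a<..<b} \<longrightarrow> p r = C + antideriv q r"
    by eventually_elim (auto simp: H_def d_def)
  then show ?thesis by blast
qed

section \<open>Weak gradients of radial functions\<close>

lemma test_function_mult_powr:
  fixes \<psi> :: "real \<Rightarrow> real"
  assumes "test_function {a<..<b} \<psi>" "0 < a"
  shows "test_function {a<..<b} (\<lambda>r. \<psi> r * r powr s)"
proof -
  from assms(1) obtain K where K: "compact K" "K \<subseteq> {a<..<b}" "\<And>x. x \<notin> K \<Longrightarrow> \<psi> x = 0"
    by (metis test_functionE)
  show ?thesis
  proof (rule test_functionI[OF _ K(1,2)])
    show "Ck k (\<lambda>r. \<psi> r * r powr s)" for k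
      by (rule Ck_mult_powr[OF assms(2) test_function_Ck[OF assms(1)]]) (simp add: test_function_0[OF assms(1)])
  qed (simp add: K(3))
qed

lemma test_function_comp_norm:
  fixes \<psi> :: "real \<Rightarrow> real"
  assumes "test_function {a<..<b} \<psi>" "0 < a" "a < b"
  shows "test_function {x::'a::euclidean_space. a < norm x \<and> norm x < b} (\<lambda>x. \<psi> (norm x))"
proof -
  obtain a' b' where ab: "a < a'" "a' < b'" "b' < b" "test_function {a'<..<b'} \<psi>"
    using test_function_real_bounds[OF assms(1,3)] by blast
  show ?thesis
  proof (rule test_functionI[where K = "cball 0 b' - ball 0 a'"])
    show "Ck k (\<lambda>x::'a. \<psi> (norm x))" for k
      by (rule Ck_comp_norm[OF assms(2) test_function_Ck[OF assms(1)]]) (simp add: test_function_0[OF assms(1)])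
    show "compact (cball (0::'a) b' - ball 0 a')"
      by (intro compact_diff) auto
  qed (use ab in \<open>auto intro: test_function_0[OF ab(4)]\<close>)
qed

lemma has_derivative_grad:
  assumes "test_function \<Omega> \<phi>"
  shows "(\<phi> has_derivative (\<lambda>y. inner y (grad \<phi> x))) (at x)"
proof -
  have "\<phi> differentiable (at x)"
    using Ck_Suc_has_derivative[OF test_function_Ck[OF assms, of "Suc 0"], of x] by (auto simp: differentiable_def)
  from grad_GDERIV[OF this] show ?thesis
    by (simp add: gderiv_def)
qed

lemma grad_antideriv_norm_mult:
  fixes \<phi> :: "'a::euclidean_space \<Rightarrow> real"
  assumes "test_function \<Omega> \<phi>" "test_function {a<..<b} k" "0 < a"
  shows "grad (\<lambda>x. \<phi> x * antideriv k (norm x)) x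
     = antideriv k (norm x) *\<^sub>R grad \<phi> x + (\<phi> x * (k (norm x) * norm x powr -1)) *\<^sub>R x"
proof (rule grad_eqI)
  have "((\<lambda>x. antideriv k (norm x)) has_derivative (\<lambda>y. k (norm x) * norm x powr -1 * inner y x)) (at x)"
    by (rule norm_comp_has_derivative[OF antideriv_test_function_has_derivative[OF assms(2)] assms(3)])
      (use assms in \<open>auto intro: antideriv_left[OF assms(2)] test_function_0[OF assms(2)]\<close>)
  from has_derivative_mult[OF has_derivative_grad[OF assms(1)] this]
  show "((\<lambda>x. \<phi> x * antideriv k (norm x)) has_derivative
     (\<lambda>y. inner y (antideriv k (norm x) *\<^sub>R grad \<phi> x + (\<phi> x * (k (norm x) * norm x powr -1)) *\<^sub>R x))) (at x)"
    by (simp add: inner_add_right algebra_simps)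
qed

text \<open>The field x / |x|^N is divergence free away from 0. With this exponent only the
  derivative of the profile survives in the divergence of \<open>\<psi>\<close>(|x|) x /
  |x|^N.\<close>

lemma sum_grad_radial_field:
  fixes x :: "'a::euclidean_space"
  assumes \<psi>: "test_function {a<..<b} \<psi>" "(\<psi> has_real_derivative \<psi>') (at (norm x))" and "0 < a" "a < norm x"
  shows "(\<Sum>e\<in>Basis. inner (grad (\<lambda>x. \<psi> (norm x) * norm x powr (- real DIM('a)) * inner x e) x) e)
     = \<psi>' * norm x powr (1 - real DIM('a))"
proof -
  let ?N = "real DIM('a)" and ?r = "norm x"
  define h' where "h' = \<psi>' * ?r powr (- ?N) + \<psi> ?r * (- ?N * ?r powr (- ?N - 1))"
  have r: "?r > 0" using assms by linarith
  have h: "((\<lambda>r. \<psi> r * r powr (- ?N)) has_real_derivative h') (at ?r)"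
    unfolding h'_def using r \<psi>(2) by (auto intro!: derivative_eq_intros)
  have "((\<lambda>x::'a. \<psi> (norm x) * norm x powr (- ?N)) has_derivative (\<lambda>y. h' * ?r powr -1 * inner y x)) (at x)"
    by (rule norm_comp_has_derivative[OF h \<open>0 < a\<close>]) (use assms in \<open>auto simp: test_function_0[OF \<psi>(1)]\<close>)
  then have d: "((\<lambda>x. \<psi> (norm x) * norm x powr (- ?N) * inner x e) has_derivative
      (\<lambda>y. inner y ((\<psi> ?r * ?r powr (- ?N)) *\<^sub>R e + (h' * ?r powr -1 * inner x e) *\<^sub>R x))) (at x)" for e
    by (rule has_derivative_eq_rhs[OF has_derivative_mult[OF _ has_derivative_inner_left[OF has_derivative_ident]]])
      (auto simp: inner_add_right algebra_simps)
  have "(\<Sum>e\<in>Basis. inner (grad (\<lambda>x. \<psi> (norm x) * norm x powr (- ?N) * inner x e) x) e)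
      = (\<Sum>e\<in>Basis. \<psi> ?r * ?r powr (- ?N) + h' * ?r powr -1 * (inner x e * inner x e))"
    by (intro sum.cong refl) (simp add: grad_eqI[OF d] inner_add_left)
  also have "\<dots> = ?N * (\<psi> ?r * ?r powr (- ?N)) + h' * ?r powr -1 * inner x x"
    by (simp add: sum.distrib euclidean_inner[of x x] sum_distrib_left)
  also have "h' * ?r powr -1 * inner x x = h' * ?r"
    using r by (simp add: powr_minus_divide power2_norm_eq_inner[symmetric] power2_eq_square)
  also have "?N * (\<psi> ?r * ?r powr (- ?N)) + h' * ?r = \<psi>' * ?r powr (1 - ?N)"
  proof -
    have "?r powr (- ?N - 1) * ?r = ?r powr (- ?N)" "?r powr (- ?N) * ?r = ?r powr (1 - ?N)"
      using r powr_add[of ?r "- ?N - 1" 1] powr_add[of ?r "- ?N" 1] by simp_all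
    then show ?thesis unfolding h'_def by (simp add: algebra_simps)
  qed
  finally show ?thesis .
qed

text \<open>The factor r^(1-N) produced by \<open>sum_grad_radial_field\<close> cancels the sphere
  area up to a constant, which turns spatial integrals into unweighted integrals over the
  line.\<close>

lemma radial_weight_powr:
  assumes "r > 0"
  shows "radial_weight TYPE('a::euclidean_space) r * r powr (1 - real DIM('a)) = real DIM('a) * unit_ball_vol (real DIM('a))"
proof -
  have "r ^ (DIM('a) - 1) = r powr (real DIM('a) - 1)"
    using powr_realpow[OF assms, of "DIM('a) - 1"] by (simp add: of_nat_diff Suc_leI)
  then have "r ^ (DIM('a) - 1) * r powr (1 - real DIM('a)) = 1"
    using assms by (simp flip: powr_add)
  then show ?thesis
    using assms by (simp add: radial_weight_def)
qed

lemma integrable_comp_norm: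
  fixes g :: "real \<Rightarrow> real"
  assumes g: "integrable lborel g" "\<And>r. r \<notin> {a<..<b} \<Longrightarrow> g r = 0" and "0 < a"
  shows "integrable lborel (\<lambda>x::'a::euclidean_space. g (norm x))"
proof -
  have [measurable]: "g \<in> borel_measurable borel" using g(1) by auto
  define c where "c = radial_weight TYPE('a) b"
  have "integrable lborel (\<lambda>r. c * g r)" using g(1) by simp
  then have "integrable lborel (\<lambda>r. radial_weight TYPE('a) r * g r)"
  proof (rule Bochner_Integration.integrable_bound)
    have "\<bar>radial_weight TYPE('a) r * g r\<bar> \<le> \<bar>c * g r\<bar>" for r
    proof (cases "r \<in> {a<..<b}")
      case True
      then have "radial_weight TYPE('a) r \<le> c"
        using \<open>0 < a\<close> unfolding c_def radial_weight_def by (auto intro!: mult_left_mono power_mono)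
      then show ?thesis
        using radial_weight_nonneg[of "TYPE('a)" r] by (auto simp: abs_mult intro!: mult_right_mono)
    qed (simp add: g(2))
    then show "AE r in lborel. norm (radial_weight TYPE('a) r * g r) \<le> norm (c * g r)" by simp
  qed simp
  then show ?thesis by (subst radial_integrable_iff) auto
qed

lemma cartesian_kernel_measurable [measurable]:
  "(\<lambda>(x::'a::euclidean_space, s). if (s::real) \<le> norm x then 1 else 0 :: real) \<in> borel_measurable (borel \<Otimes>\<^sub>M borel)"
  by measurable

text \<open>By Fubini the left-hand side is an integral of \<open>g s\<close> against \<open>M s\<close>, the integral of the partial
  derivative over \<open>norm x \<ge> s\<close>. For smooth \<open>g\<close> the claim is the product rule, and this
  identifies \<open>M\<close> almost everywhere with a radial density, so that it extends to all integrable \<open>g\<close>.\<close>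

lemma radial_integration_by_parts:
  fixes \<phi> :: "'a::euclidean_space \<Rightarrow> real"
  assumes "0 < a" "a < b" and \<phi>: "test_function {x. a < norm x \<and> norm x < b} \<phi>" and e: "e \<in> Basis"
    and g: "integrable lborel g" "\<And>r. r \<notin> {a<..<b} \<Longrightarrow> g r = 0"
  shows "(LINT x|lborel. inner (grad \<phi> x) e * antideriv g (norm x))
      = - (LINT x|lborel. g (norm x) * (norm x powr -1 * inner x e) * \<phi> x)"
    and "integrable lborel (\<lambda>x. inner (grad \<phi> x) e * antideriv g (norm x))"
    and "integrable lborel (\<lambda>x. g (norm x) * (norm x powr -1 * inner x e))"
proof -
  let ?A = "{x::'a. a < norm x \<and> norm x < b}"
  define q where "q x = inner (grad \<phi> x) e" for x
  define M where "M s = (LINT x|lborel. (if s \<le> norm x then 1 else 0) * q x)" for s :: real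
  define \<rho> where "\<rho> x = norm x powr -1 * inner x e * \<phi> x" for x
  have [measurable]: "g \<in> borel_measurable borel" using g by auto
  note [measurable] = test_function_borel_measurable[OF \<phi>]
  have q: "test_function ?A q" unfolding q_def by (rule test_function_deriv[OF \<phi> e])
  note qi = test_function_integrable[OF q]
  have unit: "\<bar>norm x powr -1 * inner x e\<bar> \<le> 1" for x :: 'a
    using Basis_le_norm[OF e, of x] by (cases "x = 0") (simp_all add: abs_mult powr_minus_divide)
  have \<rho>: "integrable lborel \<rho>"
  proof (rule Bochner_Integration.integrable_bound[OF test_function_integrable[OF \<phi>]])
    show "AE x in lborel. norm (\<rho> x) \<le> norm (\<phi> x)"
      using mult_right_mono[OF unit abs_ge_zero] by (intro AE_I2) (simp add: \<rho>_def abs_mult)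
  qed (simp add: \<rho>_def[abs_def])
  have unit_int: "integrable lborel (\<lambda>x. w (norm x) * (norm x powr -1 * inner x e))"
    if w: "integrable lborel (\<lambda>x::'a. w (norm x))" "w \<in> borel_measurable borel" for w :: "real \<Rightarrow> real"
  proof (rule Bochner_Integration.integrable_bound[OF w(1)])
    show "AE x in lborel. norm (w (norm x) * (norm x powr - 1 * inner x e)) \<le> norm (w (norm x))"
      using mult_left_mono[OF unit abs_ge_zero] by (intro AE_I2) (simp add: abs_mult)
  qed (use w(2) in measurable)
  obtain h where h: "integrable lborel h"
    and h_eq: "\<And>g. g \<in> borel_measurable borel \<Longrightarrow> integrable lborel (\<lambda>x. g (norm x) * \<rho> x) \<Longrightarrow>
      integrable lborel (\<lambda>r. g r * h r) \<and> (LINT x|lborel. g (norm x) * \<rho> x) = (LINT r|lborel. g r * h r :: real)"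
    using radial_density[OF \<rho>] by blast
  have [measurable]: "h \<in> borel_measurable borel" using h by auto
  have K: "\<bar>if (s::real) \<le> norm (x::'a) then 1 else 0\<bar> \<le> (1::real)" for x s by auto
  have F: "(LINT x|lborel. q x * antideriv w (norm x)) = (LINT s|lborel. w s * M s)"
    "integrable lborel (\<lambda>x. q x * antideriv w (norm x))" "integrable lborel (\<lambda>s. w s * M s)"
    if "integrable lborel w" for w
    using Fubini_bounded_kernel[OF qi that cartesian_kernel_measurable K] unfolding M_def antideriv_def by auto
  have *: "(LINT s|lborel. k s * M s) = - (LINT s|lborel. k s * h s)" if k: "test_function {a<..<b} k" for k
  proof -
    have kn: "test_function ?A (\<lambda>x. k (norm x))"
      by (rule test_function_comp_norm[OF k assms(1,2)])
    have ki: "integrable lborel (\<lambda>x::'a. k (norm x) * \<rho> x)"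
      using integrable_mult_test_function[OF \<rho> kn] by (simp add: mult.commute)
    \<comment> \<open>The antiderivative of \<open>k\<close> vanishes below \<open>a\<close>, so its
      composition with the norm is smooth, and multiplication by \<open>\<phi>\<close> gives a test
      function whose derivative integrates to 0.\<close>
    have "Ck j (\<lambda>x::'a. antideriv k (norm x))" for j
      by (rule Ck_comp_norm[OF assms(1) Ck_antideriv[OF k]]) (simp add: antideriv_left[OF k])
    then have "test_function ?A (\<lambda>x. \<phi> x * antideriv k (norm x))"
      by (rule test_function_mult[OF \<phi>])
    from integral_deriv_test_function[OF this e]
    have "0 = (LINT x|lborel. q x * antideriv k (norm x) + k (norm x) * \<rho> x)"
      unfolding grad_antideriv_norm_mult[OF \<phi> k assms(1)]
      by (simp add: inner_add_left q_def \<rho>_def mult_ac)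
    also have "\<dots> = (LINT x|lborel. q x * antideriv k (norm x)) + (LINT x|lborel. k (norm x) * \<rho> x)"
      by (rule Bochner_Integration.integral_add[OF F(2)[OF test_function_integrable[OF k]] ki])
    finally show ?thesis
      using F(1)[OF test_function_integrable[OF k]] h_eq[OF test_function_borel_measurable[OF k] ki] by linarith
  qed
  define H where "H s = indicator {a<..<b} s * M s + indicator {a<..<b} s * h s" for s
  have H: "integrable lborel H"
    unfolding H_def using h assms(2)
    by (intro Bochner_Integration.integrable_add F(3) integrable_real_mult_indicator)
      (auto simp: integrable_indicator_iff intro: integrable_real_mult_indicator simp: mult.commute)
  have "AE s in lborel. s \<in> {a<..<b} \<longrightarrow> H s = 0"
  proof (rule AE_zero_if_test_integrals_zero[OF H])
    fix k assume k: "test_function {a<..<b} k"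
    have "(LINT s|lborel. H s * k s) = (LINT s|lborel. k s * M s + h s * k s)"
      by (intro Bochner_Integration.integral_cong) (auto simp: H_def indicator_def algebra_simps test_function_0[OF k])
    also have "\<dots> = (LINT s|lborel. k s * M s) + (LINT s|lborel. h s * k s)"
      by (rule Bochner_Integration.integral_add[OF F(3)[OF test_function_integrable[OF k]] integrable_mult_test_function[OF h k]])
    finally show "(LINT s|lborel. H s * k s) = 0"
      using *[OF k] by (simp add: mult.commute)
  qed simp
  then have MH: "AE s in lborel. g s * M s = - (g s * h s)"
  proof eventually_elim
    case (elim s)
    show ?case
    proof (cases "s \<in> {a<..<b}")
      case True
      then have "M s = - h s" using elim by (simp add: H_def)
      then show ?thesis by simp
    qed (simp add: g(2))
  qed
  have gn: "integrable lborel (\<lambda>x::'a. g (norm x))"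
    by (rule integrable_comp_norm[OF g assms(1)])
  show gu: "integrable lborel (\<lambda>x. g (norm x) * (norm x powr -1 * inner x e))"
    by (rule unit_int[OF gn]) simp
  have gi: "integrable lborel (\<lambda>x. g (norm x) * \<rho> x)"
    using integrable_mult_test_function[OF gu \<phi>] by (simp add: \<rho>_def mult.assoc)
  have gh: "integrable lborel (\<lambda>r. g r * h r)" "(LINT x|lborel. g (norm x) * \<rho> x) = (LINT r|lborel. g r * h r)"
    using h_eq[OF _ gi] by auto
  have [measurable]: "(\<lambda>s. g s * M s) \<in> borel_measurable lborel"
    using F(3)[OF g(1)] by simp
  have "(LINT s|lborel. g s * M s) = (LINT s|lborel. - (g s * h s))"
    by (rule integral_cong_AE[OF _ _ MH]) auto
  then show "(LINT x|lborel. inner (grad \<phi> x) e * antideriv g (norm x))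
      = - (LINT x|lborel. g (norm x) * (norm x powr -1 * inner x e) * \<phi> x)"
    using F(1)[OF g(1)] gh(2) by (simp add: q_def \<rho>_def mult.assoc)
  show "integrable lborel (\<lambda>x. inner (grad \<phi> x) e * antideriv g (norm x))"
    using F(2)[OF g(1)] by (simp add: q_def)
qed

text \<open>The fields \<open>\<psi>\<close>(|x|) x / |x|^N see only the radial component of
  \<open>G\<close>; its radial density, divided by the area constant, is the weak derivative of
  \<open>v\<close>. Testing single components afterwards shows that \<open>G\<close> minus the
  resulting radial field is orthogonal to all test functions, so nothing tangential remains.\<close>

lemma weak_gradient_radial:
  fixes v :: "real \<Rightarrow> real" and G :: "'a::euclidean_space \<Rightarrow> 'a"
  assumes "0 < a" "a < b"
    and v: "integrable lborel v" "\<And>r. r \<notin> {a<..<b} \<Longrightarrow> v r = 0"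
    and G: "integrable lborel G" "\<And>x. \<not> (a < norm x \<and> norm x < b) \<Longrightarrow> G x = 0"
    and weak: "\<And>\<phi> e. test_function {x. a < norm x \<and> norm x < b} \<phi> \<Longrightarrow> e \<in> Basis \<Longrightarrow>
      (LINT x|lborel. v (norm x) * inner (grad \<phi> x) e) = - (LINT x|lborel. inner (G x) e * \<phi> x)"
  shows "\<exists>g C. integrable lborel g \<and> (\<forall>r. r \<notin> {a<..<b} \<longrightarrow> g r = 0) \<and>
    (AE r in lborel. r \<in> {a<..<b} \<longrightarrow> v r = C + antideriv g r) \<and>
    (AE x in lborel. a < norm x \<and> norm x < b \<longrightarrow> G x = (g (norm x) / norm x) *\<^sub>R x)"
proof -
  let ?A = "{x::'a. a < norm x \<and> norm x < b}"
  let ?N = "real DIM('a)"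
  define \<sigma> where "\<sigma> = ?N * unit_ball_vol ?N"
  have \<sigma>: "\<sigma> > 0" unfolding \<sigma>_def by simp
  have [measurable]: "G \<in> borel_measurable borel" "v \<in> borel_measurable borel" using G(1) v(1) by auto
  have vn: "integrable lborel (\<lambda>x::'a. v (norm x))"
    by (rule integrable_comp_norm[OF v assms(1)])
  \<comment> \<open>\<open>G\<close> paired with the field x / |x|^N; the profile
    \<open>\<psi>\<close> is multiplied in later.\<close>
  define \<rho> where "\<rho> x = inner (G x) x * norm x powr (- ?N)" for x
  have \<rho>: "integrable lborel \<rho>"
  proof (rule Bochner_Integration.integrable_bound)
    show "integrable lborel (\<lambda>x. (b * a powr (- ?N)) *\<^sub>R G x)"
      using G(1) by (rule integrable_scaleR_right)
    have "\<bar>\<rho> x\<bar> \<le> norm ((b * a powr (- ?N)) *\<^sub>R G x)" for x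
    proof (cases "x \<in> ?A")
      case True
      have "\<bar>\<rho> x\<bar> \<le> (norm (G x) * norm x) * norm x powr (- ?N)"
        unfolding \<rho>_def abs_mult using Cauchy_Schwarz_ineq2[of "G x" x] by (intro mult_mono) auto
      also have "\<dots> \<le> (norm (G x) * b) * a powr (- ?N)"
        using True assms(1) by (intro mult_mono powr_mono2') auto
      finally show ?thesis using assms by (simp add: mult_ac)
    qed (use G(2) in \<open>auto simp: \<rho>_def\<close>)
    then show "AE x in lborel. norm (\<rho> x) \<le> norm ((b * a powr (- ?N)) *\<^sub>R G x)" by simp
  qed (simp add: \<rho>_def[abs_def])
  obtain h where h: "integrable lborel h"
    and h_eq: "\<And>g. g \<in> borel_measurable borel \<Longrightarrow> integrable lborel (\<lambda>x. g (norm x) * \<rho> x) \<Longrightarrow>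
      integrable lborel (\<lambda>r. g r * h r) \<and> (LINT x|lborel. g (norm x) * \<rho> x) = (LINT r|lborel. g r * h r :: real)"
    using radial_density[OF \<rho>] by blast
  define g where "g r = indicator {a<..<b} r * h r / \<sigma>" for r
  have g: "integrable lborel g" "\<And>r. r \<notin> {a<..<b} \<Longrightarrow> g r = 0"
    unfolding g_def using h by (auto intro!: integrable_divide_zero integrable_real_mult_indicator simp: mult.commute[of "indicator _ _"])
  have [measurable]: "g \<in> borel_measurable borel" using g(1) by auto
  have "\<exists>C. AE r in lborel. r \<in> {a<..<b} \<longrightarrow> v r = C + antideriv g r"
  proof (rule du_Bois_Reymond[OF assms(2) v(1) g(1)])
    fix \<psi> \<psi>' :: "real \<Rightarrow> real"
    assume \<psi>: "test_function {a<..<b} \<psi>" and \<psi>': "test_function {a<..<b} \<psi>'"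
      and d: "\<And>r. (\<psi> has_real_derivative \<psi>' r) (at r)"
    define \<phi> where "\<phi> e x = \<psi> (norm x) * norm x powr (- ?N) * inner x e" for e x :: 'a
    have \<phi>: "test_function ?A (\<phi> e)" for e
      unfolding \<phi>_def by (intro test_function_mult Ck_inner
        test_function_comp_norm[OF test_function_mult_powr[OF \<psi> assms(1)] assms(1,2)])
    note [measurable] = test_function_borel_measurable[OF \<psi>] test_function_borel_measurable[OF \<psi>']
    have "\<sigma> * (LINT r|lborel. v r * \<psi>' r) = (LINT r|lborel. radial_weight TYPE('a) r * (v r * \<psi>' r * r powr (1 - ?N)))"
    proof -
      have "\<sigma> * (v r * \<psi>' r) = radial_weight TYPE('a) r * (v r * \<psi>' r * r powr (1 - ?N))" for r
        using radial_weight_powr[of r, where 'a = 'a] v(2)[of r] assms(1)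
        by (cases "r > a") (auto simp: \<sigma>_def mult_ac)
      then show ?thesis by (subst integral_mult_right_zero[symmetric]) (simp only:)
    qed
    also have "\<dots> = (LINT x|lborel. v (norm (x::'a)) * \<psi>' (norm x) * norm x powr (1 - ?N))"
      by (rule radial_integral[symmetric]) measurable
    \<comment> \<open>The divergence is assembled from one scalar test function per coordinate,
      because the weak gradient is tested componentwise.\<close>
    also have "\<dots> = (LINT x|lborel. (\<Sum>e\<in>Basis. v (norm x) * inner (grad (\<phi> e) x) e))"
    proof (intro Bochner_Integration.integral_cong refl)
      fix x :: 'a
      show "v (norm x) * \<psi>' (norm x) * norm x powr (1 - ?N) = (\<Sum>e\<in>Basis. v (norm x) * inner (grad (\<phi> e) x) e)"
      proof (cases "a < norm x")
        case True
        then show ?thesis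
          unfolding \<phi>_def sum_distrib_left[symmetric] sum_grad_radial_field[OF \<psi> d assms(1) True] by simp
      qed (simp add: v(2))
    qed
    also have "\<dots> = (\<Sum>e\<in>Basis. LINT x|lborel. v (norm x) * inner (grad (\<phi> e) x) e)"
      by (intro Bochner_Integration.integral_sum integrable_mult_test_function[OF vn test_function_deriv[OF \<phi>]])
    also have "\<dots> = - (\<Sum>e\<in>Basis. LINT x|lborel. inner (G x) e * \<phi> e x)"
      by (simp add: weak[OF \<phi>] sum_negf)
    also have "(\<Sum>e\<in>Basis. LINT x|lborel. inner (G x) e * \<phi> e x) = (LINT x|lborel. (\<Sum>e\<in>Basis. inner (G x) e * \<phi> e x))"
      using G(1) by (intro Bochner_Integration.integral_sum[symmetric] integrable_mult_test_function[OF _ \<phi>]) auto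
    also have "\<dots> = (LINT x|lborel. \<psi> (norm x) * \<rho> x)"
    proof (intro Bochner_Integration.integral_cong refl)
      fix x :: 'a
      show "(\<Sum>e\<in>Basis. inner (G x) e * \<phi> e x) = \<psi> (norm x) * \<rho> x"
        by (simp add: \<phi>_def \<rho>_def euclidean_inner[of "G x" x] sum_distrib_left sum_distrib_right mult_ac)
    qed
    also have "\<dots> = (LINT r|lborel. \<psi> r * h r)"
      using h_eq[of \<psi>] integrable_mult_test_function[OF \<rho> test_function_comp_norm[OF \<psi> assms(1,2)]]
      by (simp add: mult.commute)
    also have "\<dots> = (LINT r|lborel. \<sigma> * (g r * \<psi> r))"
    proof (intro Bochner_Integration.integral_cong refl)
      show "\<psi> r * h r = \<sigma> * (g r * \<psi> r)" for r
        using \<sigma> test_function_0[OF \<psi>, of r] by (cases "r \<in> {a<..<b}") (auto simp: g_def)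
    qed
    also have "\<dots> = \<sigma> * (LINT r|lborel. g r * \<psi> r)" by simp
    finally have "\<sigma> * (LINT r|lborel. v r * \<psi>' r) = \<sigma> * - (LINT r|lborel. g r * \<psi> r)"
      by (simp only: mult_minus_right)
    then show "(LINT r|lborel. v r * \<psi>' r) = - (LINT r|lborel. g r * \<psi> r)"
      using \<sigma> by (metis less_irrefl mult_left_cancel)
  qed
  then obtain C where C: "AE r in lborel. r \<in> {a<..<b} \<longrightarrow> v r = C + antideriv g r" by blast
  have "AE x in lborel. \<forall>e\<in>(Basis::'a set). x \<in> ?A \<longrightarrow> inner (G x) e - g (norm x) * (norm x powr -1 * inner x e) = 0"
    unfolding AE_ball_countable[OF countable_finite[OF finite_Basis]]
  proof
    fix e :: 'a assume e: "e \<in> Basis"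
    have openA: "open ?A" by (intro open_Collect_conj open_Collect_less continuous_intros)
    have Ge: "integrable lborel (\<lambda>x. inner (G x) e)" using G(1) by simp
    show "AE x in lborel. x \<in> ?A \<longrightarrow> inner (G x) e - g (norm x) * (norm x powr -1 * inner x e) = 0"
    proof (rule AE_zero_if_test_integrals_zero[OF _ openA])
      \<comment> \<open>The conclusion wanted here is the integrability of the radial field built
        from \<open>g\<close>, which any test function makes available; zero is the
        simplest.\<close>
      have "test_function ?A (\<lambda>_. 0)"
        by (rule test_functionI[OF Ck_const compact_empty]) auto
      from radial_integration_by_parts(3)[OF assms(1,2) this e g]
      show "integrable lborel (\<lambda>x. inner (G x) e - g (norm x) * (norm x powr -1 * inner x e))"
        by (intro Bochner_Integration.integrable_diff Ge)
    next
      fix \<phi> :: "'a \<Rightarrow> real" assume \<phi>: "test_function ?A \<phi>"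
      note parts = radial_integration_by_parts[OF assms(1,2) \<phi> e g]
      note gq = test_function_deriv[OF \<phi> e]
      \<comment> \<open>After the substitution for \<open>v\<close> the constant \<open>C\<close>
        drops out, because the derivative of \<open>\<phi>\<close> has integral 0.\<close>
      have "(LINT x|lborel. v (norm x) * inner (grad \<phi> x) e)
          = (LINT x|lborel. C * inner (grad \<phi> x) e + inner (grad \<phi> x) e * antideriv g (norm x))"
      proof (rule integral_cong_AE)
        show "AE x in lborel. v (norm x) * inner (grad \<phi> x) e = C * inner (grad \<phi> x) e + inner (grad \<phi> x) e * antideriv g (norm x)"
          using AE_norm_lborel[OF C, where 'a = 'a]
        proof eventually_elim
          case (elim x)
          then show ?case using test_function_0[OF gq, of x] by (cases "x \<in> ?A") (auto simp: algebra_simps)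
        qed
      qed (use parts(2) test_function_borel_measurable[OF gq] in auto)
      also have "\<dots> = C * (LINT x|lborel. inner (grad \<phi> x) e) + (LINT x|lborel. inner (grad \<phi> x) e * antideriv g (norm x))"
        by (subst Bochner_Integration.integral_add[OF integrable_mult_right[OF test_function_integrable[OF gq]] parts(2)])
          simp_all
      also have "\<dots> = - (LINT x|lborel. g (norm x) * (norm x powr -1 * inner x e) * \<phi> x)"
        by (subst parts(1)) (simp_all add: integral_deriv_test_function[OF \<phi> e])
      finally have "(LINT x|lborel. inner (G x) e * \<phi> x) = (LINT x|lborel. g (norm x) * (norm x powr -1 * inner x e) * \<phi> x)"
        using weak[OF \<phi> e] by simp
      then show "(LINT x|lborel. (inner (G x) e - g (norm x) * (norm x powr -1 * inner x e)) * \<phi> x) = 0"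
        unfolding left_diff_distrib
        using integrable_mult_test_function[OF Ge \<phi>] integrable_mult_test_function[OF parts(3) \<phi>]
        by (subst Bochner_Integration.integral_diff) auto
    qed
  qed
  then have "AE x in lborel. a < norm x \<and> norm x < b \<longrightarrow> G x = (g (norm x) / norm x) *\<^sub>R x"
  proof eventually_elim
    case (elim x)
    show ?case
    proof
      assume x: "a < norm x \<and> norm x < b"
      show "G x = (g (norm x) / norm x) *\<^sub>R x"
        by (rule euclidean_eqI) (use elim x in \<open>auto simp: powr_minus_divide\<close>)
    qed
  qed
  with C g show ?thesis by blast
qed

section \<open>The radial equation\<close>

text \<open>Near \<open>r\<close> the antiderivative is a constant plus the integral of the
  continuous \<open>q'\<close> over a compact interval inside (a, b). This upgrades an almost
  everywhere identity to a classical derivative.\<close>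

lemma antideriv_has_derivative:
  fixes q q' :: "real \<Rightarrow> real"
  assumes q: "integrable lborel q" and ae: "AE r in lborel. r \<in> {a<..<b} \<longrightarrow> q r = q' r"
    and cont: "continuous_on {a<..<b} q'" and r: "a < r" "r < b"
  shows "(antideriv q has_real_derivative q' r) (at r)"
proof -
  have [measurable]: "q \<in> borel_measurable borel" using q by auto
  define l u where "l = (a + r) / 2" and "u = (r + b) / 2"
  have lu: "a < l" "l < r" "r < u" "u < b" using r by (auto simp: l_def u_def)
  have c: "continuous_on {l..t} q'" if "t \<le> u" for t
    using cont lu that by (auto intro: continuous_on_subset)
  have eq: "antideriv q t = antideriv q l + integral {l..t} q'" if t: "l \<le> t" "t \<le> u" for t
  proof -
    have i: "integrable lborel (\<lambda>s. (if s \<le> t then 1 else 0) * q s)" for t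
      by (rule Bochner_Integration.integrable_bound[OF q]) auto
    have i': "set_integrable lborel {l..t} q'"
      unfolding set_integrable_def by (rule borel_integrable_compact[OF compact_Icc c[OF t(2)]])
    have "antideriv q t - antideriv q l = (LINT s|lborel. (if s \<le> t then 1 else 0) * q s - (if s \<le> l then 1 else 0) * q s)"
      unfolding antideriv_def by (rule Bochner_Integration.integral_diff[OF i i, symmetric])
    also have "\<dots> = (LINT s:{l..t}|lborel. q' s)"
      unfolding set_lebesgue_integral_def
    proof (rule integral_cong_AE)
      show "(\<lambda>s. indicator {l..t} s *\<^sub>R q' s) \<in> borel_measurable lborel"
        using i' unfolding set_integrable_def by auto
      \<comment> \<open>The point \<open>l\<close> belongs to \<open>{l..t}\<close> but cancels in
        the difference of the two kernels, so it is excluded as a null set.\<close>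
      show "AE s in lborel. (if s \<le> t then 1 else 0) * q s - (if s \<le> l then 1 else 0) * q s = indicator {l..t} s *\<^sub>R q' s"
        using ae AE_lborel_singleton[of l]
      proof eventually_elim
        case (elim s)
        then show ?case using lu t by (auto simp: indicator_def)
      qed
    qed measurable
    also have "\<dots> = integral {l..t} q'"
      by (rule set_borel_integral_eq_integral[OF i'])
    finally show ?thesis by simp
  qed
  have "((\<lambda>t. integral {l..t} q') has_real_derivative q' r) (at r within {l..u})"
    by (rule integral_has_real_derivative[OF c]) (use lu in auto)
  then have "((\<lambda>t. antideriv q l + integral {l..t} q') has_real_derivative q' r) (at r within {l..u})"
    by (auto intro!: derivative_eq_intros)
  then have "((\<lambda>t. antideriv q l + integral {l..t} q') has_real_derivative q' r) (at r)"
    using lu by (subst (asm) at_within_interior) auto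
  then show ?thesis
  proof (rule has_field_derivative_transform_within_open[where S = "{l<..<u}"])
    show "antideriv q l + integral {l..t} q' = antideriv q t" if "t \<in> {l<..<u}" for t
      by (rule eq[symmetric]) (use that in auto)
  qed (use lu in auto)
qed

text \<open>The set where the functions differ is open and null, hence empty.\<close>

lemma continuous_AE_eq_imp_eq:
  fixes p q :: "real \<Rightarrow> real"
  assumes "AE r in lborel. r \<in> {a<..<b} \<longrightarrow> p r = q r" "continuous_on {a<..<b} p" "continuous_on {a<..<b} q"
    and "r \<in> {a<..<b}"
  shows "p r = q r"
proof (rule ccontr)
  assume ne: "p r \<noteq> q r"
  let ?S = "{x \<in> {a<..<b}. p x - q x \<in> - {0}}"
  have "continuous_on {a<..<b} (\<lambda>x. p x - q x)"
    by (intro continuous_intros assms)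
  then have "open ({a<..<b} \<inter> (\<lambda>x. p x - q x) -` (- {0}))"
    by (rule continuous_open_preimage) auto
  moreover have "{a<..<b} \<inter> (\<lambda>x. p x - q x) -` (- {0}) = ?S"
    by auto
  ultimately have op: "open ?S" by simp
  have "AE x in lborel. x \<notin> ?S"
    using assms(1) by eventually_elim auto
  then have "?S \<in> null_sets lborel"
    using op by (subst (asm) AE_iff_null_sets[symmetric]) auto
  then have "negligible ?S"
    by (auto simp: negligible_iff_null_sets intro: null_sets_completionI)
  then have "?S = {}"
    using op open_not_negligible by blast
  then show False using ne assms(4) by auto
qed

text \<open>Weak gradients are only Lebesgue measurable, whereas the radial arguments use Borel
  functions and \<open>lborel\<close>. The representative is chosen componentwise.\<close>

lemma AE_borel_representative:
  fixes G :: "'a::euclidean_space \<Rightarrow> 'b::euclidean_space"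
  assumes "G \<in> borel_measurable lebesgue"
  obtains G' where "G' \<in> borel_measurable borel" "AE x in lborel. G x = G' x"
proof -
  have "\<exists>g\<in>borel_measurable lborel. AE x in lborel. inner (G x) e = g x" for e
    by (rule completion_ex_borel_measurable_real) (use assms in measurable)
  then obtain g where g: "\<And>e. g e \<in> borel_measurable lborel" "\<And>e. AE x in lborel. inner (G x) e = g e x"
    by metis
  show ?thesis
  proof (rule that[of "\<lambda>x. \<Sum>e\<in>Basis. g e x *\<^sub>R e"])
    show "(\<lambda>x. \<Sum>e\<in>Basis. g e x *\<^sub>R e) \<in> borel_measurable borel"
      using g(1) by simp
    have "AE x in lborel. \<forall>e\<in>(Basis::'b set). inner (G x) e = g e x"
      unfolding AE_ball_countable[OF countable_finite[OF finite_Basis]] using g(2) by blast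
    then show "AE x in lborel. G x = (\<Sum>e\<in>Basis. g e x *\<^sub>R e)"
    proof eventually_elim
      case (elim x)
      have "G x = (\<Sum>e\<in>Basis. inner (G x) e *\<^sub>R e)" by (simp add: euclidean_representation)
      then show ?case using elim by simp
    qed
  qed
qed

lemma grad_comp_norm:
  fixes x :: "'a::euclidean_space"
  assumes "test_function {a<..<b} \<psi>" "test_function {a<..<b} \<psi>'" "0 < a" "\<And>r. (\<psi> has_real_derivative \<psi>' r) (at r)"
  shows "grad (\<lambda>x. \<psi> (norm x)) x = (\<psi>' (norm x) * norm x powr -1) *\<^sub>R x"
proof (rule grad_eqI)
  have "((\<lambda>x. \<psi> (norm x)) has_derivative (\<lambda>y. \<psi>' (norm x) * norm x powr -1 * inner y x)) (at x)"
    by (rule norm_comp_has_derivative[OF assms(4,3)])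
      (auto intro: test_function_0[OF assms(1)] test_function_0[OF assms(2)])
  then show "((\<lambda>x. \<psi> (norm x)) has_derivative (\<lambda>y. inner y ((\<psi>' (norm x) * norm x powr -1) *\<^sub>R x))) (at x)"
    by simp
qed

text \<open>The map y -> |y|^(n-2) y equals sgn(y) |y|^(n-1), and \<open>root\<close> is odd, so it
  inverts this map for negative arguments too. This is how v' is recovered from the flux.\<close>

lemma root_signed_power:
  fixes y :: real
  assumes "n \<ge> 2"
  shows "root (n - 1) (\<bar>y\<bar> ^ (n - 2) * y) = y" "\<bar>root (n - 1) y\<bar> ^ (n - 2) * root (n - 1) y = y"
proof -
  have eq: "\<bar>z\<bar> ^ (n - 2) * z = sgn z * \<bar>z\<bar> ^ (n - 1)" for z :: real
  proof -
    have "n - 1 = Suc (n - 2)" using assms by simp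
    then have "sgn z * \<bar>z\<bar> ^ (n - 1) = \<bar>z\<bar> ^ (n - 2) * (sgn z * \<bar>z\<bar>)" by simp
    then show ?thesis by (simp add: sgn_mult_abs)
  qed
  show "root (n - 1) (\<bar>y\<bar> ^ (n - 2) * y) = y"
    unfolding eq using assms by (intro root_sgn_power) auto
  show "\<bar>root (n - 1) y\<bar> ^ (n - 2) * root (n - 1) y = y"
    unfolding eq using assms by (intro sgn_power_root) auto
qed

text \<open>A bootstrap. The weak gradient yields a merely integrable derivative \<open>g\<close> of
  \<open>v\<close>; the flux built from \<open>g\<close> has a continuous weak derivative, hence
  agrees almost everywhere with a differentiable function; taking the root replaces \<open>g\<close>
  by a continuous function, and \<open>v\<close> becomes continuously differentiable.\<close>

lemma solution_ode_annulus:
  fixes u :: "'a::euclidean_space \<Rightarrow> real"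
  assumes N: "DIM('a) \<ge> 2" and sol: "solution_PR f R u"
    and v: "continuous_on {0<..<R} v" "\<And>x::'a. 0 < norm x \<Longrightarrow> norm x < R \<Longrightarrow> u x = v (norm x)"
    and fv: "continuous_on {0<..<R} (\<lambda>r. f (v r))"
    and ab: "0 < a" "a < b" "b < R"
  shows "\<exists>v'. \<forall>r\<in>{a<..<b}. (v has_real_derivative v' r) (at r) \<and>
    ((\<lambda>r. r ^ (DIM('a) - 1) * (\<bar>v' r\<bar> ^ (DIM('a) - 2) * v' r)) has_real_derivative - (r ^ (DIM('a) - 1) * f (v r))) (at r)"
proof -
  let ?N = "DIM('a)"
  let ?\<Omega> = "ball 0 R - {0::'a}"
  let ?A = "{x::'a. a < norm x \<and> norm x < b}"
  let ?w = "radial_weight TYPE('a)"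
  define \<sigma> where "\<sigma> = real ?N * unit_ball_vol (real ?N)"
  have \<sigma>: "\<sigma> > 0" unfolding \<sigma>_def using N by simp
  have A\<Omega>: "?A \<subseteq> ?\<Omega>" using ab by auto
  have [measurable]: "?A \<in> sets borel" by measurable
  obtain G where weak_G: "weak_gradient_on ?\<Omega> u G"
    and loc: "locally_integrable_on (\<lambda>x. norm (G x) ^ (?N - 1)) ?\<Omega>"
    and eqn: "\<And>\<phi>. test_function ?\<Omega> \<phi> \<Longrightarrow>
           (LINT x:?\<Omega>|lebesgue. norm (G x) ^ (?N - 2) * inner (G x) (grad \<phi> x)) = (LINT x:?\<Omega>|lebesgue. f (u x) * \<phi> x)"
    using sol unfolding solution_PR_def by blast
  \<comment> \<open>Extension by zero from the annulus gives globally integrable functions; local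
    integrability is invoked on the compact shell \<open>?K\<close>.\<close>
  define G1 where "G1 x = indicator ?A x *\<^sub>R G x" for x
  let ?K = "cball 0 b - ball 0 a :: 'a set"
  have K: "compact ?K" "?K \<subseteq> ?\<Omega>" using ab by (auto intro: compact_diff)
  have restrict: "integrable lebesgue (\<lambda>x. indicator ?A x *\<^sub>R h x)" if "locally_integrable_on h ?\<Omega>" for h :: "'a \<Rightarrow> 'c::euclidean_space"
  proof -
    have "set_integrable lebesgue ?K h" using that K unfolding locally_integrable_on_def by blast
    then have "set_integrable lebesgue ?A h"
      by (rule set_integrable_subset) auto
    then show ?thesis by (simp add: set_integrable_def)
  qed
  have G1: "integrable lebesgue G1"
    unfolding G1_def using restrict weak_G unfolding weak_gradient_on_def by blast
  obtain G' where G': "G' \<in> borel_measurable borel" "AE x in lborel. G1 x = G' x"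
    using AE_borel_representative[OF borel_measurable_integrable[OF G1]] by blast
  note [measurable] = G'(1)
  \<comment> \<open>The Borel representative is cut off again, since it may be nonzero on a null set
    outside the annulus.\<close>
  define G2 where "G2 x = indicator ?A x *\<^sub>R G' x" for x
  have [measurable]: "G2 \<in> borel_measurable borel" unfolding G2_def[abs_def] by measurable
  have G12: "AE x in lborel. G1 x = G2 x"
    using G'(2) by eventually_elim (auto simp: G1_def G2_def indicator_def split: if_splits)
  have G12': "AE x in lebesgue. G1 x = G2 x" using G12 by (rule AE_completion)
  have G2: "integrable lborel G2"
  proof -
    have "integrable lebesgue G2"
      by (rule integrable_cong_AE_imp[OF G1]) (use G12' in \<open>auto elim: eventually_mono intro: measurable_completion\<close>)
    then show ?thesis by (simp add: integrable_completion)
  qed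
  have trunc: "integrable lborel (\<lambda>r. indicator {a<..<b} r * h r)" if "continuous_on {0<..<R} h" for h :: "real \<Rightarrow> real"
  proof -
    have "continuous_on {a..b} h" using that ab by (auto intro: continuous_on_subset)
    then have "set_integrable lborel {a..b} h"
      unfolding set_integrable_def by (rule borel_integrable_compact[OF compact_Icc])
    then have "set_integrable lborel {a<..<b} h"
      by (rule set_integrable_subset) auto
    then show ?thesis by (simp add: set_integrable_def)
  qed
  define v2 where "v2 r = indicator {a<..<b} r * v r" for r
  have v2: "integrable lborel v2" unfolding v2_def by (rule trunc[OF v(1)])
  have [measurable]: "v2 \<in> borel_measurable borel" using v2 by auto
  have uv: "u x = v2 (norm x)" if "x \<in> ?A" for x
  proof -
    have "0 < norm x" "norm x < R" using that ab by auto
    then show ?thesis using that v(2)[of x] by (simp add: v2_def)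
  qed
  have "\<exists>g C. integrable lborel g \<and> (\<forall>r. r \<notin> {a<..<b} \<longrightarrow> g r = 0) \<and>
    (AE r in lborel. r \<in> {a<..<b} \<longrightarrow> v2 r = C + antideriv g r) \<and>
    (AE x in lborel. a < norm x \<and> norm x < b \<longrightarrow> G2 x = (g (norm x) / norm x) *\<^sub>R x)"
  proof (rule weak_gradient_radial[OF ab(1,2) v2 _ G2])
    fix \<phi> :: "'a \<Rightarrow> real" and e :: 'a
    assume \<phi>: "test_function ?A \<phi>" and e: "e \<in> Basis"
    note q = test_function_deriv[OF \<phi> e]
    note \<phi>\<Omega> = test_function_mono[OF \<phi> A\<Omega>]
    note [measurable] = test_function_borel_measurable[OF \<phi>] test_function_borel_measurable[OF q]
    have "(LINT x|lborel. v2 (norm x) * inner (grad \<phi> x) e) = (LINT x|lebesgue. v2 (norm x) * inner (grad \<phi> x) e)"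
      by (rule integral_completion[symmetric]) measurable
    also have "\<dots> = (LINT x|lebesgue. u x * inner (grad \<phi> x) e)"
      by (intro Bochner_Integration.integral_cong refl) (use uv test_function_0[OF q] in fastforce)
    also have "\<dots> = (LINT x:?\<Omega>|lebesgue. u x * inner (grad \<phi> x) e)"
      by (rule set_integral_test_function[OF test_function_mono[OF q A\<Omega>], symmetric])
    also have "\<dots> = - (LINT x:?\<Omega>|lebesgue. inner (G x) e * \<phi> x)"
      using weak_G \<phi>\<Omega> e unfolding weak_gradient_on_def by blast
    also have "(LINT x:?\<Omega>|lebesgue. inner (G x) e * \<phi> x) = (LINT x|lebesgue. inner (G x) e * \<phi> x)"
      by (rule set_integral_test_function[OF \<phi>\<Omega>])
    also have "\<dots> = (LINT x|lebesgue. inner (G1 x) e * \<phi> x)"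
    proof (intro Bochner_Integration.integral_cong refl)
      show "inner (G x) e * \<phi> x = inner (G1 x) e * \<phi> x" for x
        using test_function_0[OF \<phi>, of x] by (cases "x \<in> ?A") (auto simp: G1_def)
    qed
    also have "\<dots> = (LINT x|lebesgue. inner (G2 x) e * \<phi> x)"
    proof (rule integral_cong_AE)
      have [measurable]: "G1 \<in> borel_measurable lebesgue" "\<phi> \<in> borel_measurable lebesgue"
        using G1 test_function_borel_measurable[OF \<phi>] by (auto intro: measurable_completion)
      show "(\<lambda>x. inner (G1 x) e * \<phi> x) \<in> borel_measurable lebesgue"
        by measurable
      show "(\<lambda>x. inner (G2 x) e * \<phi> x) \<in> borel_measurable lebesgue"
        by (rule measurable_completion) measurable
      show "AE x in lebesgue. inner (G1 x) e * \<phi> x = inner (G2 x) e * \<phi> x"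
        using G12' by eventually_elim simp
    qed
    also have "\<dots> = (LINT x|lborel. inner (G2 x) e * \<phi> x)"
      by (rule integral_completion) measurable
    finally show "(LINT x|lborel. v2 (norm x) * inner (grad \<phi> x) e) = - (LINT x|lborel. inner (G2 x) e * \<phi> x)" .
  qed (auto simp: v2_def G2_def)
  then obtain g C where g: "integrable lborel g" "\<And>r. r \<notin> {a<..<b} \<Longrightarrow> g r = 0"
    and vg: "AE r in lborel. r \<in> {a<..<b} \<longrightarrow> v2 r = C + antideriv g r"
    and Gg: "AE x in lborel. a < norm x \<and> norm x < b \<longrightarrow> G2 x = (g (norm x) / norm x) *\<^sub>R x"
    by blast
  have [measurable]: "g \<in> borel_measurable borel" using g(1) by auto
  \<comment> \<open>The radial component of |G|^(N-2) G. Its integrability below rests on that of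
    |G|^(N-1).\<close>
  define P where "P r = \<bar>g r\<bar> ^ (?N - 2) * g r" for r
  have [measurable]: "P \<in> borel_measurable borel" unfolding P_def[abs_def] by measurable
  have P0: "P r = 0" if "r \<notin> {a<..<b}" for r using g(2)[OF that] by (simp add: P_def)
  have pow: "z ^ (?N - 2) * z = z ^ (?N - 1)" for z :: real
  proof -
    have "?N - 1 = Suc (?N - 2)" using N by simp
    then show ?thesis by simp
  qed
  have G1g: "AE x in lebesgue. G1 x = (g (norm x) / norm x) *\<^sub>R x"
    using G12' AE_completion[OF Gg]
  proof eventually_elim
    case (elim x)
    then show ?case
      using g(2)[of "norm x"] by (cases "x \<in> ?A") (auto simp: G1_def indicator_def)
  qed
  \<comment> \<open>At x = 0 both sides vanish, because 0 lies outside (a, b), where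
    \<open>g\<close> is 0.\<close>
  have norm_g: "norm ((g (norm x) / norm x) *\<^sub>R x) = \<bar>g (norm x)\<bar>" for x :: 'a
    using g(2)[of 0] ab by (cases "x = 0") auto
  have intP: "integrable lborel (\<lambda>r. ?w r * P r)"
  proof -
    have "integrable lebesgue (\<lambda>x::'a. P (norm x))"
    proof (rule Bochner_Integration.integrable_bound[OF restrict[OF loc]])
      show "(\<lambda>x::'a. P (norm x)) \<in> borel_measurable lebesgue"
        by (rule measurable_completion) measurable
      show "AE x in lebesgue. norm (P (norm x)) \<le> norm (indicator ?A x *\<^sub>R norm (G x) ^ (?N - 1))"
        using G1g
      proof eventually_elim
        case (elim x)
        then have "norm (G1 x) = \<bar>g (norm x)\<bar>" using norm_g by simp
        then show ?case using P0[of "norm x"]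
          by (cases "x \<in> ?A") (auto simp: G1_def P_def abs_mult pow[simplified])
      qed
    qed
    then have "integrable lborel (\<lambda>x::'a. P (norm x))"
      by (simp add: integrable_completion)
    then show ?thesis by (simp add: radial_integrable_iff)
  qed
  \<comment> \<open>The area constant is kept because \<open>?w\<close> contains it;
    \<open>q\<close> is the weak derivative of the weighted flux \<open>?w r * P r\<close>.\<close>
  define q where "q r = indicator {a<..<b} r * (- (\<sigma> * r ^ (?N - 1) * f (v r)))" for r
  have q: "integrable lborel q"
    unfolding q_def by (rule trunc) (intro continuous_intros fv)
  have [measurable]: "q \<in> borel_measurable borel" using q by auto
  have "\<exists>C. AE r in lborel. r \<in> {a<..<b} \<longrightarrow> ?w r * P r = C + antideriv q r"
  proof (rule du_Bois_Reymond[OF ab(2) intP q])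
    fix \<psi> \<psi>' :: "real \<Rightarrow> real"
    assume \<psi>: "test_function {a<..<b} \<psi>" and \<psi>': "test_function {a<..<b} \<psi>'"
      and d: "\<And>r. (\<psi> has_real_derivative \<psi>' r) (at r)"
    note [measurable] = test_function_borel_measurable[OF \<psi>] test_function_borel_measurable[OF \<psi>']
    have \<phi>: "test_function ?A (\<lambda>x. \<psi> (norm x))"
      by (rule test_function_comp_norm[OF \<psi> ab(1,2)])
    note \<phi>\<Omega> = test_function_mono[OF \<phi> A\<Omega>]
    note gr = grad_comp_norm[OF \<psi> \<psi>' ab(1) d, where 'a = 'a]
    have "(LINT r|lborel. ?w r * P r * \<psi>' r) = (LINT x|lborel. P (norm (x::'a)) * \<psi>' (norm x))"
      by (subst radial_integral[where 'a = 'a]) (auto simp: mult.assoc)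
    also have "\<dots> = (LINT x|lebesgue. P (norm (x::'a)) * \<psi>' (norm x))"
      by (rule integral_completion[symmetric]) measurable
    also have "\<dots> = (LINT x|lebesgue. norm (G1 x) ^ (?N - 2) * (inner (G1 x) x * (\<psi>' (norm x) * norm x powr -1)))"
    proof (rule integral_cong_AE)
      show "(\<lambda>x::'a. P (norm x) * \<psi>' (norm x)) \<in> borel_measurable lebesgue"
        by (rule measurable_completion) measurable
      have [measurable]: "G1 \<in> borel_measurable lebesgue" using G1 by auto
      have [measurable]: "(\<lambda>x::'a. \<psi>' (norm x) * norm x powr -1) \<in> borel_measurable lebesgue"
        by (rule measurable_completion) measurable
      have [measurable]: "(\<lambda>x::'a. x) \<in> borel_measurable lebesgue"
        by (rule measurable_completion) measurable
      show "(\<lambda>x. norm (G1 x) ^ (?N - 2) * (inner (G1 x) x * (\<psi>' (norm x) * norm x powr -1))) \<in> borel_measurable lebesgue"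
        by measurable
      show "AE x in lebesgue. P (norm x) * \<psi>' (norm x) = norm (G1 x) ^ (?N - 2) * (inner (G1 x) x * (\<psi>' (norm x) * norm x powr -1))"
        using G1g
      proof eventually_elim
        case (elim x)
        have "inner (G1 x) x * norm x powr -1 = g (norm x)"
          unfolding elim using g(2)[of 0] ab
          by (cases "x = 0") (auto simp: powr_minus_divide power2_norm_eq_inner[symmetric] power2_eq_square)
        note inner_eq = this
        have "norm (G1 x) = \<bar>g (norm x)\<bar>" unfolding elim by (rule norm_g)
        then have "P (norm x) * \<psi>' (norm x) = norm (G1 x) ^ (?N - 2) * (inner (G1 x) x * norm x powr -1) * \<psi>' (norm x)"
          unfolding inner_eq P_def by (simp only:)
        also have "\<dots> = norm (G1 x) ^ (?N - 2) * (inner (G1 x) x * (\<psi>' (norm x) * norm x powr -1))"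
          by (simp only: mult_ac)
        finally show ?case .
      qed
    qed
    also have "\<dots> = (LINT x:?\<Omega>|lebesgue. norm (G x) ^ (?N - 2) * inner (G x) (grad (\<lambda>x. \<psi> (norm x)) x))"
      unfolding set_lebesgue_integral_def
    proof (intro Bochner_Integration.integral_cong refl)
      fix x :: 'a
      show "norm (G1 x) ^ (?N - 2) * (inner (G1 x) x * (\<psi>' (norm x) * norm x powr -1))
        = indicator ?\<Omega> x *\<^sub>R (norm (G x) ^ (?N - 2) * inner (G x) (grad (\<lambda>x. \<psi> (norm x)) x))"
      proof (cases "x \<in> ?A")
        case True
        then show ?thesis using A\<Omega> by (auto simp: gr G1_def)
      next
        case False
        then have "\<psi>' (norm x) = 0" using test_function_0[OF \<psi>', of "norm x"] by auto
        then show ?thesis by (simp add: gr)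
      qed
    qed
    also have "\<dots> = (LINT x:?\<Omega>|lebesgue. f (u x) * \<psi> (norm x))"
      by (rule eqn[OF \<phi>\<Omega>])
    also have "\<dots> = (LINT x|lebesgue. f (u x) * \<psi> (norm x))"
      by (rule set_integral_test_function[OF \<phi>\<Omega>])
    also have "\<dots> = (LINT x|lebesgue. (indicator {a<..<b} (norm x) * f (v (norm x))) * \<psi> (norm (x::'a)))"
    proof (intro Bochner_Integration.integral_cong refl)
      fix x :: 'a
      show "f (u x) * \<psi> (norm x) = (indicator {a<..<b} (norm x) * f (v (norm x))) * \<psi> (norm x)"
      proof (cases "norm x \<in> {a<..<b}")
        case True
        then have "u x = v (norm x)" by (intro v(2)) (use ab in auto)
        then show ?thesis using True by simp
      qed (simp add: test_function_0[OF \<psi>])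
    qed
    also have "\<dots> = (LINT x|lborel. (indicator {a<..<b} (norm x) * f (v (norm x))) * \<psi> (norm (x::'a)))"
    proof (rule integral_completion)
      have [measurable]: "(\<lambda>r. indicator {a<..<b} r * f (v r)) \<in> borel_measurable borel"
        using borel_measurable_integrable[OF trunc[OF fv]] by simp
      show "(\<lambda>x. (indicator {a<..<b} (norm x) * f (v (norm x))) * \<psi> (norm (x::'a))) \<in> borel_measurable lborel"
        by measurable
    qed
    also have "\<dots> = (LINT r|lborel. ?w r * ((indicator {a<..<b} r * f (v r)) * \<psi> r))"
    proof (rule radial_integral)
      have [measurable]: "(\<lambda>r. indicator {a<..<b} r * f (v r)) \<in> borel_measurable borel"
        using borel_measurable_integrable[OF trunc[OF fv]] by simp
      show "(\<lambda>r. (indicator {a<..<b} r * f (v r)) * \<psi> r) \<in> borel_measurable borel"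
        by measurable
    qed
    also have "\<dots> = (LINT r|lborel. - (q r * \<psi> r))"
      by (intro Bochner_Integration.integral_cong refl)
        (use ab in \<open>auto simp: q_def indicator_def radial_weight_def \<sigma>_def\<close>)
    finally show "(LINT r|lborel. ?w r * P r * \<psi>' r) = - (LINT r|lborel. q r * \<psi> r)"
      by simp
  qed
  then obtain C2 where C2: "AE r in lborel. r \<in> {a<..<b} \<longrightarrow> ?w r * P r = C2 + antideriv q r" by blast
  \<comment> \<open>The continuous representative of the weighted flux; \<open>v'\<close> is
    obtained from it by inverting the power, and only afterwards identified with
    \<open>g\<close>.\<close>
  define Q where "Q r = C2 + antideriv q r" for r
  have contq: "continuous_on {a<..<b} (\<lambda>r. - (\<sigma> * r ^ (?N - 1) * f (v r)))"
    by (intro continuous_intros continuous_on_subset[OF fv]) (use ab in auto)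
  have dQ: "(Q has_real_derivative - (\<sigma> * r ^ (?N - 1) * f (v r))) (at r)" if "r \<in> {a<..<b}" for r
  proof -
    have "(antideriv q has_real_derivative - (\<sigma> * r ^ (?N - 1) * f (v r))) (at r)"
      by (rule antideriv_has_derivative[OF q _ contq]) (use that in \<open>auto simp: q_def\<close>)
    then show ?thesis
      unfolding Q_def by (auto intro!: derivative_eq_intros)
  qed
  then have contQ: "continuous_on {a<..<b} Q"
    by (meson DERIV_isCont continuous_at_imp_continuous_on)
  define v' where "v' r = root (?N - 1) (Q r / (\<sigma> * r ^ (?N - 1)))" for r
  have v'P: "\<bar>v' r\<bar> ^ (?N - 2) * v' r = Q r / (\<sigma> * r ^ (?N - 1))" for r
    unfolding v'_def by (rule root_signed_power(2)[OF N])
  have gv': "AE r in lborel. r \<in> {a<..<b} \<longrightarrow> g r = v' r"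
    using C2
  proof eventually_elim
    case (elim r)
    show ?case
    proof
      assume r: "r \<in> {a<..<b}"
      then have "\<sigma> * r ^ (?N - 1) \<noteq> 0"
        using \<sigma> ab by auto
      moreover have "?w r = \<sigma> * r ^ (?N - 1)"
        using r ab by (auto simp: radial_weight_def \<sigma>_def)
      ultimately have "P r = Q r / (\<sigma> * r ^ (?N - 1))"
        using elim r by (simp add: Q_def field_simps)
      then show "g r = v' r"
        unfolding v'_def P_def using root_signed_power(1)[OF N, of "g r"] by simp
    qed
  qed
  have contv': "continuous_on {a<..<b} v'"
    unfolding v'_def using \<sigma> ab by (intro continuous_intros contQ) auto
  have dg: "(antideriv g has_real_derivative v' r) (at r)" if "r \<in> {a<..<b}" for r
    by (rule antideriv_has_derivative[OF g(1) gv' contv']) (use that in auto)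
  have "continuous_on {a<..<b} (antideriv g)"
    using dg by (meson DERIV_isCont continuous_at_imp_continuous_on)
  then have cg: "continuous_on {a<..<b} (\<lambda>r. C + antideriv g r)"
    by (intro continuous_intros)
  \<comment> \<open>\<open>v\<close> is continuous, so its representation by
    \<open>antideriv g\<close> holds at every point and not only almost everywhere.\<close>
  have veq: "v r = C + antideriv g r" if "r \<in> {a<..<b}" for r
  proof (rule continuous_AE_eq_imp_eq[OF _ _ cg that])
    show "AE r in lborel. r \<in> {a<..<b} \<longrightarrow> v r = C + antideriv g r"
      using vg by eventually_elim (auto simp: v2_def)
    show "continuous_on {a<..<b} v"
      using v(1) by (rule continuous_on_subset) (use ab in auto)
  qed
  show ?thesis
  proof (intro exI[of _ v'] ballI conjI)
    fix r assume r: "r \<in> {a<..<b}"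
    have "((\<lambda>r. C + antideriv g r) has_real_derivative v' r) (at r)"
      using dg[OF r] by (auto intro!: derivative_eq_intros)
    then show "(v has_real_derivative v' r) (at r)"
      by (rule has_field_derivative_transform_within_open[where S = "{a<..<b}"]) (use r veq in auto)
    have "((\<lambda>r. Q r / \<sigma>) has_real_derivative - (r ^ (?N - 1) * f (v r))) (at r)"
      using DERIV_cdivide[OF dQ[OF r], of \<sigma>] \<sigma> by simp
    then show "((\<lambda>r. r ^ (?N - 1) * (\<bar>v' r\<bar> ^ (?N - 2) * v' r)) has_real_derivative - (r ^ (?N - 1) * f (v r))) (at r)"
    proof (rule has_field_derivative_transform_within_open[where S = "{a<..<b}"])
      show "Q s / \<sigma> = s ^ (?N - 1) * (\<bar>v' s\<bar> ^ (?N - 2) * v' s)" if "s \<in> {a<..<b}" for s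
        unfolding v'P using that ab \<sigma> by simp
    qed (use r in auto)
  qed
qed

text \<open>A priori the derivative found on an annulus depends on that annulus. By uniqueness
  \<open>deriv v\<close> names all of them at once.\<close>

lemma solution_ode:
  fixes u :: "'a::euclidean_space \<Rightarrow> real"
  assumes N: "DIM('a) \<ge> 2" and sol: "solution_PR f R u"
    and v: "continuous_on {0<..<R} v" "\<And>x::'a. 0 < norm x \<Longrightarrow> norm x < R \<Longrightarrow> u x = v (norm x)"
    and fv: "continuous_on {0<..<R} (\<lambda>r. f (v r))"
    and r: "0 < r" "r < R"
  shows "(v has_real_derivative deriv v r) (at r)"
    and "((\<lambda>r. r ^ (DIM('a) - 1) * (\<bar>deriv v r\<bar> ^ (DIM('a) - 2) * deriv v r)) has_real_derivative
      - (r ^ (DIM('a) - 1) * f (v r))) (at r)"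
proof -
  obtain a b where ab: "0 < a" "a < r" "r < b" "b < R"
    using r dense by meson
  obtain v' where v': "\<And>s. s \<in> {a<..<b} \<Longrightarrow> (v has_real_derivative v' s) (at s)"
    "\<And>s. s \<in> {a<..<b} \<Longrightarrow> ((\<lambda>r. r ^ (DIM('a) - 1) * (\<bar>v' r\<bar> ^ (DIM('a) - 2) * v' r)) has_real_derivative
      - (s ^ (DIM('a) - 1) * f (v s))) (at s)"
    using solution_ode_annulus[OF N sol v fv, of a b] ab by force
  have eq: "deriv v s = v' s" if "s \<in> {a<..<b}" for s
    using v'(1)[OF that] by (rule DERIV_imp_deriv)
  show "(v has_real_derivative deriv v r) (at r)"
    using v'(1)[of r] eq[of r] ab by simp
  show "((\<lambda>r. r ^ (DIM('a) - 1) * (\<bar>deriv v r\<bar> ^ (DIM('a) - 2) * deriv v r)) has_real_derivative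
      - (r ^ (DIM('a) - 1) * f (v r))) (at r)"
    by (rule has_field_derivative_transform_within_open[OF v'(2), where S = "{a<..<b}"]) (use ab eq in auto)
qed

section \<open>Radial solutions that blow up at the origin\<close>

text \<open>Here \<open>n\<close> is N - 1, so \<open>n - 1\<close> is the exponent N - 2 of the
  operator. The constants \<open>m\<close> and \<open>T\<close> make the liminf condition on f
  explicit, and nothing of the space remains except the two differential identities for
  \<open>v\<close>.\<close>

locale radial_blowup =
  fixes n :: nat and R \<kappa> m T :: real and f F v v' :: "real \<Rightarrow> real"
  assumes n: "n \<ge> 1" and R: "R > 0" and \<kappa>: "\<kappa> \<ge> 0" and m: "m > 0" and T: "T \<ge> 0"
    and f_nonneg: "\<And>t. t \<ge> 0 \<Longrightarrow> f t \<ge> 0"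
    and f_growth: "\<And>t. t \<ge> T \<Longrightarrow> m * t ^ n \<le> f t"
    and F_def: "\<And>t. F t = f t + \<kappa> * t ^ n"
    and F_mono: "strict_mono_on {0..} F"
    and v_deriv: "\<And>r. 0 < r \<Longrightarrow> r < R \<Longrightarrow> (v has_real_derivative v' r) (at r)"
    and flux_deriv: "\<And>r. 0 < r \<Longrightarrow> r < R \<Longrightarrow>
      ((\<lambda>r. r ^ n * (\<bar>v' r\<bar> ^ (n - 1) * v' r)) has_real_derivative - (r ^ n * f (v r))) (at r)"
    and v_nonneg: "\<And>r. 0 < r \<Longrightarrow> r < R \<Longrightarrow> 0 \<le> v r"
    and v_unbounded: "\<And>M \<rho>. 0 < \<rho> \<Longrightarrow> \<rho> < R \<Longrightarrow> \<exists>r. 0 < r \<and> r < \<rho> \<and> M < v r"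
begin

lemma F_le: "0 \<le> s \<Longrightarrow> s \<le> t \<Longrightarrow> F s \<le> F t"
  using strict_mono_on_leD[OF F_mono, of s t] by simp

definition w :: "real \<Rightarrow> real" where
  "w r = - (r ^ n * (\<bar>v' r\<bar> ^ (n - 1) * v' r))"

text \<open>Up to a constant, \<open>\<alpha>\<close> is the mass of the Dirac measure at the origin in \<open>-\<Delta>\<^sub>N u = f(u) + \<alpha> \<delta>\<^sub>0\<close>.\<close>

definition \<alpha> :: real where
  "\<alpha> = Inf (w ` {0<..<R})"

lemma w_deriv: "0 < r \<Longrightarrow> r < R \<Longrightarrow> (w has_real_derivative r ^ n * f (v r)) (at r)"
  unfolding w_def[abs_def] using DERIV_minus[OF flux_deriv] by simp

section \<open>Monotonicity of the flux and of the solution\<close>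

lemma w_mono:
  assumes "0 < s" "s \<le> r" "r < R"
  shows "w s \<le> w r"
proof (rule DERIV_nonneg_imp_nondecreasing[OF assms(2)])
  fix x assume "s \<le> x" "x \<le> r"
  then show "\<exists>y. (w has_real_derivative y) (at x) \<and> 0 \<le> y"
    using assms w_deriv[of x] v_nonneg[of x] f_nonneg[of "v x"] by (intro exI[of _ "x ^ n * f (v x)"]) auto
qed

text \<open>Since \<open>w\<close> is nondecreasing, a negative value persists at all smaller radii;
  there \<open>v\<close> would be increasing in the radius and stay below its value at
  \<open>r\<close>.\<close>

lemma w_nonneg:
  assumes r: "0 < r" "r < R"
  shows "0 \<le> w r"
proof (rule ccontr)
  assume neg: "\<not> ?thesis"
  obtain s where s: "0 < s" "s < r" "v r < v s"
    using v_unbounded[OF r, of "v r"] by blast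
  have "v s \<le> v r"
  proof (rule DERIV_nonneg_imp_nondecreasing[where f = v])
    fix x assume x: "s \<le> x" "x \<le> r"
    have "w x < 0" using w_mono[of x r] x s r neg by simp
    then have "0 < x ^ n * (\<bar>v' x\<bar> ^ (n - 1) * v' x)" by (simp add: w_def)
    then have "0 < v' x"
      using x s by (auto simp: zero_less_mult_iff)
    then show "\<exists>y. (v has_real_derivative y) (at x) \<and> 0 \<le> y"
      using v_deriv[of x] x s r by (intro exI[of _ "v' x"]) auto
  qed (use s in simp)
  then show False using s by simp
qed

lemma v'_nonpos:
  assumes r: "0 < r" "r < R"
  shows "v' r \<le> 0"
proof (rule ccontr)
  assume "\<not> ?thesis"
  then have "0 < r ^ n * (\<bar>v' r\<bar> ^ (n - 1) * v' r)" using r by simp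
  then show False using w_nonneg[OF r] by (simp add: w_def)
qed

lemma v_antimono:
  assumes "0 < s" "s \<le> r" "r < R"
  shows "v r \<le> v s"
proof (rule DERIV_nonpos_imp_nonincreasing[OF assms(2)])
  fix x assume "s \<le> x" "x \<le> r"
  then show "\<exists>y. (v has_real_derivative y) (at x) \<and> y \<le> 0"
    using assms v_deriv[of x] v'_nonpos[of x] by (intro exI[of _ "v' x"]) auto
qed

lemma w_eq:
  assumes r: "0 < r" "r < R"
  shows "(- v' r) ^ n = w r / r ^ n"
proof -
  have "n = Suc (n - 1)" using n by simp
  then have "(- v' r) ^ n = (- v' r) ^ (n - 1) * (- v' r)" by (metis power_Suc2)
  then show ?thesis
    using v'_nonpos[OF r] r by (simp add: w_def)
qed

text \<open>Monotonicity upgrades unboundedness near 0 to divergence to infinity.\<close>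

lemma v_large:
  obtains \<rho> where "0 < \<rho>" "\<rho> < R" "\<And>r. 0 < r \<Longrightarrow> r < \<rho> \<Longrightarrow> M < v r"
proof -
  obtain s where s: "0 < s" "s < R / 2" "M < v s"
    using v_unbounded[of "R / 2" M] R by auto
  show ?thesis
  proof (rule that[of s])
    show "M < v r" if "0 < r" "r < s" for r
      using v_antimono[of r s] that s by linarith
  qed (use s in auto)
qed

section \<open>The limit of the flux at the origin and its consequences\<close>

lemma \<alpha>_le:
  assumes "0 < r" "r < R"
  shows "\<alpha> \<le> w r"
  unfolding \<alpha>_def by (rule cINF_lower) (use assms in \<open>auto intro!: bdd_belowI2[where m = 0] w_nonneg\<close>)

lemma \<alpha>_nonneg: "0 \<le> \<alpha>"
  unfolding \<alpha>_def by (rule cINF_greatest) (use R w_nonneg in auto)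

lemma w_near_\<alpha>:
  assumes "e > 0"
  obtains \<rho> where "0 < \<rho>" "\<rho> < R" "\<And>r. 0 < r \<Longrightarrow> r \<le> \<rho> \<Longrightarrow> w r < \<alpha> + e"
proof -
  have "\<exists>y\<in>w ` {0<..<R}. y < \<alpha> + e"
    unfolding \<alpha>_def using R assms
    by (subst cInf_less_iff[symmetric]) (auto intro!: bdd_belowI2[where m = 0] w_nonneg)
  then obtain s where s: "0 < s" "s < R" "w s < \<alpha> + e" by auto
  show ?thesis
  proof (rule that[of s])
    show "w r < \<alpha> + e" if "0 < r" "r \<le> s" for r
      using w_mono[of r s] that s by linarith
  qed (use s in auto)
qed

text \<open>For t \<ge> T the growth of f gives t^n \<le> f(t)/m, hence F \<le> (1 + \<kappa>/m) f;
  this is the origin of the constant. For x \<le> r monotonicity gives F(v(r)) \<le> F(v(x)), so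
  F(v(r)) x^n is dominated by the derivative of (1 + \<kappa>/m) w.\<close>

lemma F_v_bound:
  assumes r: "0 < r" "r < R" "T \<le> v r"
  shows "F (v r) * r ^ Suc n / Suc n \<le> (1 + \<kappa> / m) * (w r - \<alpha>)"
proof -
  let ?L = "1 + \<kappa> / m"
  have L: "0 < ?L" using \<kappa> m by (simp add: add_pos_nonneg)
  have *: "F (v r) * r ^ Suc n / Suc n - F (v r) * s ^ Suc n / Suc n \<le> ?L * (w r - \<alpha>)" if s: "0 < s" "s < r" for s
  proof -
    have "?L * w s - F (v r) * s ^ Suc n / Suc n \<le> ?L * w r - F (v r) * r ^ Suc n / Suc n"
    proof (rule DERIV_nonneg_imp_nondecreasing[where f = "\<lambda>x. ?L * w x - F (v r) * x ^ Suc n / Suc n"])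
      fix x assume x: "s \<le> x" "x \<le> r"
      have vx: "v r \<le> v x" using v_antimono[of x r] x s r by simp
      have "F (v r) \<le> F (v x)"
        using F_le[OF _ vx] v_nonneg[of r] r by simp
      also have "\<dots> \<le> ?L * f (v x)"
      proof -
        have "v x ^ n \<le> f (v x) / m"
          using f_growth[of "v x"] vx r m by (simp add: pos_le_divide_eq mult.commute)
        from mult_left_mono[OF this \<kappa>] show ?thesis
          unfolding F_def by (simp add: algebra_simps)
      qed
      finally have "0 \<le> x ^ n * (?L * f (v x) - F (v r))"
        using x s by simp
      moreover have "((\<lambda>x. ?L * w x - F (v r) * x ^ Suc n / Suc n) has_real_derivative
          ?L * (x ^ n * f (v x)) - F (v r) * x ^ n) (at x)"
        using x s r by (auto intro!: derivative_eq_intros w_deriv simp del: power_Suc)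
      ultimately show "\<exists>y. ((\<lambda>x. ?L * w x - F (v r) * x ^ Suc n / Suc n) has_real_derivative y) (at x) \<and> 0 \<le> y"
        by (intro exI[of _ "?L * (x ^ n * f (v x)) - F (v r) * x ^ n"]) (simp add: algebra_simps)
    qed (use s in simp)
    moreover have "?L * \<alpha> \<le> ?L * w s"
      using \<alpha>_le[of s] s r L by (intro mult_left_mono) auto
    ultimately show ?thesis by (simp add: right_diff_distrib)
  qed
  \<comment> \<open>The right-hand side of the estimate is free of s, so s may tend to 0.\<close>
  have "((\<lambda>s. F (v r) * r ^ Suc n / Suc n - F (v r) * s ^ Suc n / Suc n) \<longlongrightarrow> F (v r) * r ^ Suc n / Suc n - F (v r) * 0 ^ Suc n / Suc n) (at_right 0)"
    by (intro tendsto_intros) auto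
  moreover have "\<forall>\<^sub>F s in at_right 0. F (v r) * r ^ Suc n / Suc n - F (v r) * s ^ Suc n / Suc n \<le> ?L * (w r - \<alpha>)"
    using eventually_at_right_less[of 0] eventually_at_right_real[OF r(1)]
    by eventually_elim (use * in auto)
  ultimately have "F (v r) * r ^ Suc n / Suc n - F (v r) * 0 ^ Suc n / Suc n \<le> ?L * (w r - \<alpha>)"
    by (rule tendsto_upperbound) simp
  then show ?thesis by simp
qed

lemma F_v_small:
  assumes "\<epsilon> > 0"
  obtains \<rho> where "0 < \<rho>" "\<rho> < R" "\<And>r. 0 < r \<Longrightarrow> r < \<rho> \<Longrightarrow> F (v r) \<le> \<epsilon> / r ^ Suc n"
proof -
  let ?L = "1 + \<kappa> / m"
  have L: "0 < ?L" using \<kappa> m by (simp add: add_pos_nonneg)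
  \<comment> \<open>Chosen to absorb the factor \<open>?L\<close> and the divisor
    \<open>Suc n\<close> of \<open>F_v_bound\<close>.\<close>
  define e where "e = \<epsilon> / (?L * Suc n)"
  have e: "e > 0" unfolding e_def using assms L by simp
  obtain \<rho>1 where \<rho>1: "0 < \<rho>1" "\<rho>1 < R" "\<And>r. 0 < r \<Longrightarrow> r < \<rho>1 \<Longrightarrow> T < v r"
    using v_large by blast
  obtain \<rho>2 where \<rho>2: "0 < \<rho>2" "\<rho>2 < R" "\<And>r. 0 < r \<Longrightarrow> r \<le> \<rho>2 \<Longrightarrow> w r < \<alpha> + e"
    using w_near_\<alpha>[OF e] by blast
  show ?thesis
  proof (rule that[of "min \<rho>1 \<rho>2"])
    fix r assume r: "0 < r" "r < min \<rho>1 \<rho>2"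
    have "F (v r) * r ^ Suc n / Suc n \<le> ?L * (w r - \<alpha>)"
      using r \<rho>1 by (intro F_v_bound) (auto intro: less_imp_le)
    also have "\<dots> \<le> ?L * e"
      using \<rho>2(3)[of r] r L by (intro mult_left_mono) auto
    also have "\<dots> = \<epsilon> / Suc n"
      unfolding e_def using L by simp
    finally have "F (v r) * r ^ Suc n \<le> \<epsilon>"
      by (simp add: divide_le_cancel del: power_Suc)
    then show "F (v r) \<le> \<epsilon> / r ^ Suc n"
      using r by (simp add: pos_le_divide_eq del: power_Suc)
  qed (use \<rho>1 \<rho>2 in auto)
qed

text \<open>A positive limit flux gives -v' \<ge> \<beta>/r, so the level t is reached at a radius
  proportional to exp(-t/\<beta>). At this radius the bound F(v) \<le> r^(-N) becomes f(t) \<le> C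
  exp(N t/\<beta>).\<close>

lemma sub_exponential_if_\<alpha>_pos:
  assumes "\<alpha> > 0"
  shows "sub_exponential f"
proof -
  define \<beta> where "\<beta> = root n \<alpha>"
  have \<beta>: "\<beta> > 0" "\<beta> ^ n = \<alpha>"
    unfolding \<beta>_def using assms n by (auto simp: real_root_pow_pos)
  have v'_le: "v' r \<le> - (\<beta> / r)" if r: "0 < r" "r < R" for r
  proof -
    have "(\<beta> / r) ^ n \<le> (- v' r) ^ n"
      unfolding w_eq[OF r] power_divide \<beta>(2) using \<alpha>_le[OF r] r by (simp add: divide_right_mono)
    then have "\<beta> / r \<le> - v' r"
      using v'_nonpos[OF r] n r \<beta> by (subst (asm) power_mono_iff) auto
    then show ?thesis by simp
  qed
  have log: "v r + \<beta> * ln r \<le> v s + \<beta> * ln s" if s: "0 < s" "s \<le> r" "r < R" for s r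
  proof (rule DERIV_nonpos_imp_nonincreasing[OF s(2), where f = "\<lambda>x. v x + \<beta> * ln x"])
    fix x assume x: "s \<le> x" "x \<le> r"
    have "((\<lambda>x. v x + \<beta> * ln x) has_real_derivative v' x + \<beta> / x) (at x)"
      using x s by (auto intro!: derivative_eq_intros v_deriv)
    then show "\<exists>y. ((\<lambda>x. v x + \<beta> * ln x) has_real_derivative y) (at x) \<and> y \<le> 0"
      using v'_le[of x] x s by (intro exI[of _ "v' x + \<beta> / x"]) auto
  qed
  obtain \<rho> where \<rho>: "0 < \<rho>" "\<rho> < R" "\<And>r. 0 < r \<Longrightarrow> r < \<rho> \<Longrightarrow> F (v r) \<le> 1 / r ^ Suc n"
    using F_v_small[of 1] by auto
  define r1 where "r1 = \<rho> / 2"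
  have r1: "0 < r1" "r1 < \<rho>" "r1 < R" using \<rho> by (auto simp: r1_def)
  have bound: "f t * exp (- (Suc n / \<beta>) * t) \<le> 1 / r1 ^ Suc n" if t: "t \<ge> 0" for t
  proof -
    \<comment> \<open>The radius at which the logarithmic lower bound guarantees v(r) \<ge> v(r1) +
      t.\<close>
    define r where "r = r1 * exp (- (t / \<beta>))"
    have r: "0 < r" "r \<le> r1" using r1 t \<beta> by (auto simp: r_def mult_le_cancel_left1)
    have "ln r = ln r1 - t / \<beta>" unfolding r_def using r1 by (simp add: ln_mult)
    then have "\<beta> * ln r = \<beta> * ln r1 - t"
      using \<beta> by (simp add: right_diff_distrib)
    then have "v r1 + t \<le> v r"
      using log[of r r1] r r1 by linarith
    then have tv: "t \<le> v r" using v_nonneg[of r1] r1 by simp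
    have "f t \<le> F t" unfolding F_def using \<kappa> t by simp
    also have "\<dots> \<le> F (v r)"
      using F_le[OF t tv] .
    also have "\<dots> \<le> 1 / r ^ Suc n" using \<rho>(3)[of r] r r1 by simp
    also have "\<dots> = exp (Suc n * (t / \<beta>)) / r1 ^ Suc n"
    proof -
      have "r ^ Suc n * exp (Suc n * (t / \<beta>)) = r1 ^ Suc n * (exp (- (t / \<beta>)) * exp (t / \<beta>)) ^ Suc n"
        unfolding r_def exp_of_nat_mult power_mult_distrib by (simp only: mult_ac)
      also have "exp (- (t / \<beta>)) * exp (t / \<beta>) = 1"
        by (simp flip: exp_add)
      finally show ?thesis
        using r r1 by (simp add: field_simps del: power_Suc of_nat_Suc)
    qed
    finally have "f t * exp (- (Suc n / \<beta>) * t) \<le> exp (Suc n * (t / \<beta>)) / r1 ^ Suc n * exp (- (Suc n / \<beta>) * t)"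
      by (intro mult_right_mono) auto
    also have "\<dots> = exp (Suc n * (t / \<beta>) + - (Suc n / \<beta>) * t) / r1 ^ Suc n"
      unfolding exp_add by simp
    also have "\<dots> = 1 / r1 ^ Suc n"
      by simp
    finally show ?thesis .
  qed
  show ?thesis unfolding sub_exponential_def
  proof (intro exI[of _ "Suc n / \<beta>"] conjI)
    show "bdd_above ((\<lambda>t. f t * exp (- (Suc n / \<beta>) * t)) ` {0..})"
      by (rule bdd_aboveI2[where M = "1 / r1 ^ Suc n"]) (use bound in auto)
  qed (use \<beta> in simp)
qed

lemma no_small_power_bound:
  assumes \<alpha>: "\<alpha> = 0" and \<mu>: "0 < \<mu>" "\<mu> < 1" and A: "A > 0" and \<rho>: "0 < \<rho>" "\<rho> < R"
    and f_bound: "\<And>r. 0 < r \<Longrightarrow> r < \<rho> \<Longrightarrow> f (v r) \<le> A * r powr (- (real (Suc n) * \<mu>))"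
  shows False
proof -
  \<comment> \<open>Since n - (n + 1) \<mu> = \<delta> - 1, this is the exponent of the primitive of
    r^n r^(-(n + 1) \<mu>).\<close>
  define \<delta> where "\<delta> = real (Suc n) * (1 - \<mu>)"
  have \<delta>: "\<delta> > 0" unfolding \<delta>_def using \<mu> by simp
  \<comment> \<open>The n-th root of r^\<delta> / r^n is r^(\<gamma> - 1), and \<open>B\<close>
    below is the n-th root of the constant in front.\<close>
  define \<gamma> where "\<gamma> = \<delta> / n"
  have \<gamma>: "\<gamma> > 0" unfolding \<gamma>_def using \<delta> n by simp
  define B where "B = root n (A / \<delta>)"
  have B: "B > 0" "B ^ n = A / \<delta>" unfolding B_def using A \<delta> n by (auto simp: real_root_pow_pos)
  \<comment> \<open>That \<open>w\<close> vanishes at the origin is known only as a limit. The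
    comparison therefore starts at some s > 0 with w(s) < e, and e is removed at the end.\<close>
  have w_le: "w r \<le> A / \<delta> * r powr \<delta>" if r: "0 < r" "r < \<rho>" for r
  proof (rule field_le_epsilon)
    fix e :: real assume "e > 0"
    then obtain \<rho>' where \<rho>': "0 < \<rho>'" "\<rho>' < R" "\<And>s. 0 < s \<Longrightarrow> s \<le> \<rho>' \<Longrightarrow> w s < e"
      using w_near_\<alpha>[of e] \<alpha> by auto
    define s where "s = min r \<rho>'"
    have s: "0 < s" "s \<le> r" "w s < e" using r \<rho>' by (auto simp: s_def)
    have "w r - A / \<delta> * r powr \<delta> \<le> w s - A / \<delta> * s powr \<delta>"
    proof (rule DERIV_nonpos_imp_nonincreasing[OF s(2), where f = "\<lambda>x. w x - A / \<delta> * x powr \<delta>"])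
      fix x assume x: "s \<le> x" "x \<le> r"
      have x0: "0 < x" "x < \<rho>" using x s r by auto
      have "((\<lambda>x. w x - A / \<delta> * x powr \<delta>) has_real_derivative x ^ n * f (v x) - A / \<delta> * (\<delta> * x powr (\<delta> - 1))) (at x)"
        using x0 \<rho> by (auto intro!: derivative_eq_intros w_deriv)
      moreover have "x ^ n * f (v x) \<le> A * x powr (\<delta> - 1)"
      proof -
        have "x ^ n * f (v x) \<le> x ^ n * (A * x powr (- (real (Suc n) * \<mu>)))"
          using f_bound[OF x0] x0 by (intro mult_left_mono) auto
        also have "\<dots> = A * (x powr n * x powr (- (real (Suc n) * \<mu>)))"
          using x0 by (simp add: powr_realpow)
        also have "x powr n * x powr (- (real (Suc n) * \<mu>)) = x powr (\<delta> - 1)"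
          unfolding powr_add[symmetric] \<delta>_def by (simp add: algebra_simps)
        finally show ?thesis .
      qed
      ultimately show "\<exists>y. ((\<lambda>x. w x - A / \<delta> * x powr \<delta>) has_real_derivative y) (at x) \<and> y \<le> 0"
        using \<delta> by (intro exI[of _ "x ^ n * f (v x) - A / \<delta> * (\<delta> * x powr (\<delta> - 1))"]) auto
    qed
    moreover have "0 \<le> A / \<delta> * s powr \<delta>" using A \<delta> by simp
    ultimately show "w r \<le> A / \<delta> * r powr \<delta> + e" using s(3) by linarith
  qed
  have v'_ge: "- (B * r powr (\<gamma> - 1)) \<le> v' r" if r: "0 < r" "r < \<rho>" for r
  proof -
    have "(- v' r) ^ n = w r / r ^ n"
      using r \<rho> by (intro w_eq) auto
    also have "\<dots> \<le> A / \<delta> * r powr \<delta> / r ^ n"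
      by (rule divide_right_mono[OF w_le[OF r]]) (use r in simp)
    also have "\<dots> = (B * r powr (\<gamma> - 1)) ^ n"
    proof -
      have "(r powr (\<gamma> - 1)) ^ n = r powr (n * (\<gamma> - 1))"
        using r by (simp add: powr_power mult.commute)
      also have "\<dots> = r powr (\<delta> - n)" proof -
        have "real n * (\<gamma> - 1) = \<delta> - n" unfolding \<gamma>_def using n by (simp add: right_diff_distrib)
        then show ?thesis by simp
      qed
      also have "\<dots> = r powr \<delta> / r ^ n" using r by (simp add: powr_diff powr_realpow)
      finally show ?thesis by (simp add: power_mult_distrib B(2))
    qed
    finally have "- v' r \<le> B * r powr (\<gamma> - 1)"
      using v'_nonpos[of r] n r \<rho> B by (subst (asm) power_mono_iff) auto
    then show ?thesis by simp
  qed
  define r1 where "r1 = \<rho> / 2"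
  have r1: "0 < r1" "r1 < \<rho>" "r1 < R" using \<rho> by (auto simp: r1_def)
  \<comment> \<open>The level to be exceeded is the value at \<open>r1\<close> of v + (B/\<gamma>)
    x^\<gamma>, which the lower bound for v' makes nondecreasing.\<close>
  obtain s where s: "0 < s" "s < r1" "v r1 + B / \<gamma> * r1 powr \<gamma> < v s"
    using v_unbounded[OF r1(1,3)] by blast
  have "v s + B / \<gamma> * s powr \<gamma> \<le> v r1 + B / \<gamma> * r1 powr \<gamma>"
  proof (rule DERIV_nonneg_imp_nondecreasing[where f = "\<lambda>x. v x + B / \<gamma> * x powr \<gamma>"])
    fix x assume x: "s \<le> x" "x \<le> r1"
    have x0: "0 < x" "x < \<rho>" using x s r1 by auto
    have "((\<lambda>x. v x + B / \<gamma> * x powr \<gamma>) has_real_derivative v' x + B / \<gamma> * (\<gamma> * x powr (\<gamma> - 1))) (at x)"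
      using x0 \<rho> by (auto intro!: derivative_eq_intros v_deriv)
    then show "\<exists>y. ((\<lambda>x. v x + B / \<gamma> * x powr \<gamma>) has_real_derivative y) (at x) \<and> 0 \<le> y"
      using v'_ge[OF x0] \<gamma> by (intro exI[of _ "v' x + B / \<gamma> * (\<gamma> * x powr (\<gamma> - 1))"]) auto
  qed (use s in simp)
  moreover have "0 \<le> B / \<gamma> * s powr \<gamma>" using B \<gamma> by simp
  ultimately show False using s(3) by linarith
qed

end

section \<open>Asymptotic behaviour of unbounded solutions\<close>

lemma locally_Hoelder_continuous_on:
  assumes "locally_Hoelder f"
  shows "continuous_on {0..} f"
proof -
  from assms obtain \<theta> where \<theta>: "0 < \<theta>" "\<theta> < 1"
    and H: "\<forall>K. compact K \<and> K \<subseteq> {0..} \<longrightarrow> (\<exists>C. \<forall>s\<in>K. \<forall>t\<in>K. \<bar>f s - f t\<bar> \<le> C * \<bar>s - t\<bar> powr \<theta>)"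
    unfolding locally_Hoelder_def by (elim exE conjE)
  show ?thesis
    unfolding continuous_on_def
  proof
      fix t :: real assume t: "t \<in> {0..}"
      have "\<exists>C. \<forall>s\<in>{0..t + 1}. \<forall>t\<in>{0..t + 1}. \<bar>f s - f t\<bar> \<le> C * \<bar>s - t\<bar> powr \<theta>"
        using H[rule_format, of "{0..t + 1}"] by simp
      then obtain C where C: "\<forall>s\<in>{0..t + 1}. \<forall>t\<in>{0..t + 1}. \<bar>f s - f t\<bar> \<le> C * \<bar>s - t\<bar> powr \<theta>" ..
      have "((\<lambda>s. C * \<bar>s - t\<bar> powr \<theta>) \<longlongrightarrow> C * \<bar>t - t\<bar> powr \<theta>) (at t within {0..})"
        using \<theta> by (intro tendsto_intros tendsto_powr') auto
      then have "((\<lambda>s. C * \<bar>s - t\<bar> powr \<theta>) \<longlongrightarrow> 0) (at t within {0..})" by simp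
      moreover have "\<forall>\<^sub>F s in at t within {0..}. norm (f s - f t) \<le> C * \<bar>s - t\<bar> powr \<theta>"
      proof -
        have "\<forall>\<^sub>F s in at t within {0..}. s \<in> {..<t + 1}"
          by (rule eventually_at_in_open'[THEN filter_leD[OF at_le[OF subset_UNIV]]]) auto
        moreover have "\<forall>\<^sub>F s in at t within {0..}. s \<in> {0..}"
          by (simp add: eventually_at_filter)
        ultimately show ?thesis
          by eventually_elim (use C t in auto)
      qed
      ultimately have "((\<lambda>s. f s - f t) \<longlongrightarrow> 0) (at t within {0..})"
        by (rule Lim_null_comparison[rotated])
      then show "(f \<longlongrightarrow> f t) (at t within {0..})"
        by (simp add: LIM_zero_iff)
  qed
qed

text \<open>\<open>T \<ge> 1\<close> is secured because t \<le> t^n is used later to see that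
  \<open>F\<close> is unbounded.\<close>

lemma Liminf_growthE:
  assumes "Liminf at_top (\<lambda>t. ereal (f t * t powr (1 - real N))) > 0" "N \<ge> 1"
  obtains m T where "m > 0" "T \<ge> 1" "\<And>t. t \<ge> T \<Longrightarrow> m * t ^ (N - 1) \<le> f t"
proof -
  obtain m where m: "0 < ereal m" "ereal m < Liminf at_top (\<lambda>t. ereal (f t * t powr (1 - real N)))"
    using ereal_dense2[OF assms(1)] by (metis zero_ereal_def)
  from less_LiminfD[OF m(2)] have "\<forall>\<^sub>F t in at_top. m < f t * t powr (1 - real N)" by simp
  then obtain T where T: "\<And>t. t \<ge> T \<Longrightarrow> m < f t * t powr (1 - real N)"
    by (auto simp: eventually_at_top_linorder)
  show ?thesis
  proof (rule that[of m "max T 1"])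
    fix t assume t: "max T 1 \<le> t"
    have "t powr (1 - real N) * t ^ (N - 1) = 1"
    proof -
      have "t ^ (N - 1) = t powr (real N - 1)"
        using powr_realpow[of t "N - 1"] t assms(2) by (simp add: of_nat_diff)
      then show ?thesis using t by (simp flip: powr_add)
    qed
    moreover have "m * t ^ (N - 1) \<le> f t * t powr (1 - real N) * t ^ (N - 1)"
      using T[of t] t by (intro mult_right_mono) auto
    ultimately show "m * t ^ (N - 1) \<le> f t" by (simp add: mult.assoc)
  qed (use m in auto)
qed

text \<open>\<open>inv_into\<close> is a true inverse only on the image of \<open>F\<close>; the
  intermediate value theorem puts every y \<ge> F 0 into that image.\<close>

lemma inv_into_strict_mono_growth:
  fixes F :: "real \<Rightarrow> real"
  assumes mono: "strict_mono_on {0..} F" and cont: "continuous_on {0..} F"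
    and growth: "\<And>y. \<exists>t\<ge>0. y \<le> F t" and y: "F 0 \<le> y"
  shows "0 \<le> inv_into {0..} F y" "F (inv_into {0..} F y) = y"
proof -
  obtain t where t: "t \<ge> 0" "y \<le> F t" using growth by blast
  obtain z where "0 \<le> z" "z \<le> t" "F z = y"
    using IVT'[of F 0 y t] y t continuous_on_subset[OF cont, of "{0..t}"] by auto
  then have "y \<in> F ` {0..}" by auto
  then show "0 \<le> inv_into {0..} F y" "F (inv_into {0..} F y) = y"
    using inv_into_into[of y F "{0..}"] f_inv_into_f[of y F "{0..}"] by auto
qed

text \<open>The local bound reaches up to the outer sphere, and continuity turns it from an
  essential into a pointwise one, because the set where it fails is open and null. Unboundedness can
  then only come from the origin.\<close>

lemma radial_unbounded_near_0:
  fixes u :: "'a::euclidean_space \<Rightarrow> real"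
  assumes "R > 0" and cont: "continuous_on (ball 0 R - {0}) u"
    and ess: "\<And>K. compact K \<Longrightarrow> K \<subseteq> cball 0 R - {0} \<Longrightarrow> \<exists>C. AE x in lebesgue. x \<in> K \<inter> ball 0 R \<longrightarrow> \<bar>u x\<bar> \<le> C"
    and nn: "\<And>x. x \<in> ball 0 R - {0} \<Longrightarrow> 0 \<le> u x"
    and unb: "\<not> bounded (u ` (ball 0 R - {0}))"
    and \<rho>: "0 < \<rho>" "\<rho> < R"
  shows "\<exists>x. 0 < norm x \<and> norm x < \<rho> \<and> M < u x"
proof (rule ccontr)
  assume "\<not> ?thesis"
  then have M: "u x \<le> M" if "0 < norm x" "norm x < \<rho>" for x
    using that by (meson not_less)
  let ?K = "cball 0 R - ball 0 (\<rho> / 2) :: 'a set"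
  let ?O = "{x::'a. \<rho> / 2 < norm x \<and> norm x < R}"
  obtain C where C: "AE x in lebesgue. x \<in> ?K \<inter> ball 0 R \<longrightarrow> \<bar>u x\<bar> \<le> C"
  proof -
    have "compact ?K" by (intro compact_diff) auto
    moreover have "?K \<subseteq> cball 0 R - {0}" using \<rho> by auto
    ultimately show ?thesis using ess that by blast
  qed
  have O: "open ?O" by (intro open_Collect_conj open_Collect_less continuous_intros)
  have "continuous_on ?O u"
    by (rule continuous_on_subset[OF cont]) (use \<rho> in auto)
  then have op: "open (?O \<inter> u -` {C<..})"
    by (rule continuous_open_preimage[OF _ O open_greaterThan])
  have "AE x in lebesgue. x \<notin> ?O \<inter> u -` {C<..}"
    using C by eventually_elim auto
  then have "?O \<inter> u -` {C<..} \<in> null_sets lebesgue"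
    using op by (subst (asm) AE_iff_null_sets[symmetric]) auto
  then have "?O \<inter> u -` {C<..} = {}"
    using op open_not_negligible negligible_iff_null_sets by blast
  then have C': "u x \<le> C" if "x \<in> ?O" for x using that by auto
  have "\<bar>u x\<bar> \<le> max M C" if "x \<in> ball 0 R - {0}" for x
  proof (cases "norm x < \<rho>")
    case True
    then show ?thesis using M[of x] nn[OF that] that by auto
  next
    case False
    then have "x \<in> ?O" using that \<rho> by auto
    then show ?thesis using C'[of x] nn[OF that] by auto
  qed
  then have "bounded (u ` (ball 0 R - {0}))"
    by (intro boundedI[where B = "max M C"]) (elim imageE, simp only: real_norm_def)
  then show False using unb by simp
qed

text \<open>The continuity assumption expresses the choice of the continuous representative, and
  \<open>inv_into {0..} F\<close> stands for the inverse of \<open>F\<close>, which is meaningful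
  from \<open>F 0\<close> on.\<close>

theorem lemma6p1:
  fixes f F :: "real \<Rightarrow> real" and R \<kappa> c :: real and u :: "'a::euclidean_space \<Rightarrow> real"
  assumes "DIM('a) \<ge> 2" and "R > 0"
    and f_nonneg: "\<And>t. t \<ge> 0 \<Longrightarrow> f t \<ge> 0"
    and f1: "locally_Hoelder f"
    and f2: "Liminf at_top (\<lambda>t. ereal (f t * t powr (1 - real DIM('a)))) > 0"
    and f3: "\<exists>\<kappa>'>0. mono_on {0..} (\<lambda>t. f t + \<kappa>' * t ^ (DIM('a) - 1))"
    and "super_exponential f"
    and "\<kappa> \<ge> 0"
    and F_def: "\<And>t. F t = f t + \<kappa> * t ^ (DIM('a) - 1)"
    and "strict_mono_on {0..} F"
    and "c > 0"
    and "\<And>l t. l > 1 \<Longrightarrow> t \<ge> 0 \<Longrightarrow> f t powr l \<le> c * f (l * t)"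
    and "solution_PR f R u"
    and u_cont: "continuous_on (ball 0 R - {0}) u"
    and u_unbounded: "\<not> bounded (u ` (ball 0 R - {0}))"
  shows "(\<forall>\<epsilon>>0. \<exists>R\<^sub>\<epsilon>. 0 < R\<^sub>\<epsilon> \<and> R\<^sub>\<epsilon> < R \<and>
            (\<forall>x\<in>ball 0 R\<^sub>\<epsilon> - {0}. u x \<le> inv_into {0..} F (\<epsilon> / norm x ^ DIM('a))))
       \<and> (\<forall>\<epsilon>>0. Limsup (at 0) (\<lambda>x. ereal (u x / inv_into {0..} F (\<epsilon> / norm x ^ DIM('a)))) = 1)"
proof -
  let ?N = "DIM('a)"
  define n where "n = ?N - 1"
  have n: "n \<ge> 1" and Sn: "Suc n = ?N" using \<open>DIM('a) \<ge> 2\<close> by (auto simp: n_def)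
  note sol = \<open>solution_PR f R u\<close> and mono = \<open>strict_mono_on {0..} F\<close> and R = \<open>R > 0\<close> and c = \<open>c > 0\<close>
    and \<kappa> = \<open>\<kappa> \<ge> 0\<close> and scaling = \<open>\<And>l t. l > 1 \<Longrightarrow> t \<ge> 0 \<Longrightarrow> f t powr l \<le> c * f (l * t)\<close>
  from sol have radial: "\<And>x y. x \<in> ball 0 R - {0} \<Longrightarrow> y \<in> ball 0 R - {0} \<Longrightarrow> norm x = norm y \<Longrightarrow> u x = u y"
    and u_nn: "\<And>x. x \<in> ball 0 R - {0} \<Longrightarrow> 0 \<le> u x"
    and ess: "\<And>K. compact K \<Longrightarrow> K \<subseteq> cball 0 R - {0} \<Longrightarrow> \<exists>C. AE x in lebesgue. x \<in> K \<inter> ball 0 R \<longrightarrow> \<bar>u x\<bar> \<le> C"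
    unfolding solution_PR_def by blast+
  obtain e :: 'a where e: "e \<in> Basis" using nonempty_Basis by blast
  \<comment> \<open>By radial symmetry one coordinate ray represents \<open>u\<close>.\<close>
  define v where "v r = u (r *\<^sub>R e)" for r
  have uv: "u x = v (norm x)" if "0 < norm x" "norm x < R" for x
    unfolding v_def by (rule radial) (use that e in auto)
  have ray: "r *\<^sub>R e \<in> ball 0 R - {0}" if "0 < r" "r < R" for r
    using that e nonzero_Basis[OF e] by auto
  have v_nn: "0 \<le> v r" if "0 < r" "r < R" for r
    unfolding v_def by (rule u_nn[OF ray[OF that]])
  have v_cont: "continuous_on {0<..<R} v"
    unfolding v_def by (rule continuous_on_compose2[OF u_cont]) (use ray in \<open>auto intro!: continuous_intros\<close>)
  have f_cont: "continuous_on {0..} f" by (rule locally_Hoelder_continuous_on[OF f1])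
  have fv_cont: "continuous_on {0<..<R} (\<lambda>r. f (v r))"
    by (rule continuous_on_compose2[OF f_cont v_cont]) (use v_nn in auto)
  have ode: "(v has_real_derivative deriv v r) (at r)"
    "((\<lambda>r. r ^ (?N - 1) * (\<bar>deriv v r\<bar> ^ (?N - 2) * deriv v r)) has_real_derivative - (r ^ (?N - 1) * f (v r))) (at r)"
    if "0 < r" "r < R" for r
    using solution_ode[OF \<open>DIM('a) \<ge> 2\<close> sol v_cont _ fv_cont that] uv by blast+
  obtain m T where mT: "m > 0" "T \<ge> 1" "\<And>t. t \<ge> T \<Longrightarrow> m * t ^ n \<le> f t"
    using Liminf_growthE[OF f2] \<open>DIM('a) \<ge> 2\<close> unfolding n_def by auto
  interpret radial_blowup n R \<kappa> m T f F v "deriv v"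
  proof
    show "\<exists>r. 0 < r \<and> r < \<rho> \<and> M < v r" if \<rho>: "0 < \<rho>" "\<rho> < R" for M \<rho>
    proof -
      obtain x where x: "0 < norm x" "norm x < \<rho>" "M < u x"
        using radial_unbounded_near_0[OF R u_cont ess u_nn u_unbounded \<rho>] by blast
      then show ?thesis using uv[of x] \<rho> by (intro exI[of _ "norm x"]) auto
    qed
    show "((\<lambda>r. r ^ n * (\<bar>deriv v r\<bar> ^ (n - 1) * deriv v r)) has_real_derivative - (r ^ n * f (v r))) (at r)"
      if "0 < r" "r < R" for r
      using ode(2)[OF that] unfolding n_def diff_diff_left one_add_one .
  qed (use n R \<kappa> mT f_nonneg F_def mono ode(1) v_nn in \<open>auto simp: n_def\<close>)
  have \<alpha>0: "\<alpha> = 0"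
    using \<alpha>_nonneg sub_exponential_if_\<alpha>_pos \<open>super_exponential f\<close> by fastforce
  define Fi where "Fi = inv_into {0..} F"
  have F_cont: "continuous_on {0..} F"
    unfolding F_def by (intro continuous_intros f_cont)
  have F_growth: "\<exists>t\<ge>0. y \<le> F t" for y
  proof -
    define t where "t = max T (y / m)"
    have t: "t \<ge> T" "t \<ge> 1" "y / m \<le> t" using mT by (auto simp: t_def)
    have "y \<le> m * t" using t(3) mT by (simp add: pos_divide_le_eq mult.commute)
    also have "\<dots> \<le> m * t ^ n"
      using mT t n by (intro mult_left_mono self_le_power) auto
    also have "\<dots> \<le> f t" by (rule mT(3)[OF t(1)])
    also have "\<dots> \<le> F t" unfolding F_def using \<kappa> t by simp
    finally show ?thesis using t by (intro exI[of _ t]) auto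
  qed
  have Fi: "0 \<le> Fi y" "F (Fi y) = y" if "F 0 \<le> y" for y
    unfolding Fi_def using inv_into_strict_mono_growth[OF mono F_cont F_growth that] by auto
  have le_Fi: "t \<le> Fi y" if "0 \<le> t" "F t \<le> y" for t y
  proof (rule ccontr)
    assume "\<not> ?thesis"
    moreover have "F 0 \<le> y" using F_le[of 0 t] that by simp
    ultimately have "F (Fi y) < F t"
      using Fi(1)[of y] that by (intro strict_mono_onD[OF mono]) auto
    then show False using Fi(2)[OF \<open>F 0 \<le> y\<close>] that by simp
  qed
  have upper: "\<exists>\<rho>. 0 < \<rho> \<and> \<rho> < R \<and> (\<forall>x\<in>ball 0 \<rho> - {0}. u x \<le> Fi (\<epsilon> / norm x ^ ?N))" if \<epsilon>: "\<epsilon> > 0" for \<epsilon>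
  proof -
    obtain \<rho> where \<rho>: "0 < \<rho>" "\<rho> < R" "\<And>r. 0 < r \<Longrightarrow> r < \<rho> \<Longrightarrow> F (v r) \<le> \<epsilon> / r ^ Suc n"
      using F_v_small[OF \<epsilon>] by blast
    have "u x \<le> Fi (\<epsilon> / norm x ^ ?N)" if x: "x \<in> ball 0 \<rho> - {0}" for x
    proof -
      have r: "0 < norm x" "norm x < \<rho>" "norm x < R" using x \<rho> by auto
      show ?thesis
        using le_Fi[OF v_nn[OF r(1,3)]] \<rho>(3)[OF r(1,2)] uv[OF r(1,3)] unfolding Sn by simp
    qed
    then show ?thesis using \<rho> by blast
  qed
  have limsup: "Limsup (at 0) (\<lambda>x::'a. ereal (u x / Fi (\<epsilon> / norm x ^ ?N))) = 1" if \<epsilon>: "\<epsilon> > 0" for \<epsilon>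
  proof (rule antisym)
    obtain \<rho>1 where \<rho>1: "0 < \<rho>1" "\<rho>1 < R" "\<And>x. x \<in> ball 0 \<rho>1 - {0} \<Longrightarrow> u x \<le> Fi (\<epsilon> / norm x ^ ?N)"
      using upper[OF \<epsilon>] by blast
    \<comment> \<open>Close to 0 the argument of \<open>Fi\<close> exceeds \<open>F 0\<close>, so
      that \<open>Fi\<close> inverts \<open>F\<close> there and the quotient has a positive
      denominator.\<close>
    have "LIM r at_right 0. \<epsilon> / r ^ ?N :> at_top"
    proof (rule LIM_at_top_divide)
      show "\<forall>\<^sub>F r in at_right (0::real). 0 < r ^ ?N"
        by (rule eventually_mono[OF eventually_at_right_less]) auto
      show "((\<lambda>r::real. r ^ ?N) \<longlongrightarrow> 0) (at_right 0)"
        by (rule tendsto_eq_rhs[OF tendsto_power[OF tendsto_ident_at]]) simp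
    qed (use \<epsilon> in auto)
    then have "\<forall>\<^sub>F r in at_right 0. F 0 < \<epsilon> / r ^ ?N"
      by (simp add: filterlim_at_top_dense)
    then obtain \<rho>2 where \<rho>2: "0 < \<rho>2" "\<And>r. 0 < r \<Longrightarrow> r < \<rho>2 \<Longrightarrow> F 0 < \<epsilon> / r ^ ?N"
      by (auto simp: eventually_at_right_field)
    have Fi_pos: "0 < Fi (\<epsilon> / r ^ ?N)" if "0 < r" "r < \<rho>2" for r
    proof -
      note * = Fi[OF less_imp_le[OF \<rho>2(2)[OF that]]]
      have "Fi (\<epsilon> / r ^ ?N) \<noteq> 0" using *(2) \<rho>2(2)[OF that] by auto
      then show ?thesis using *(1) by simp
    qed
    show "Limsup (at 0) (\<lambda>x::'a. ereal (u x / Fi (\<epsilon> / norm x ^ ?N))) \<le> 1"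
    proof (rule Limsup_bounded)
      show "\<forall>\<^sub>F x::'a in at 0. ereal (u x / Fi (\<epsilon> / norm x ^ ?N)) \<le> 1"
        unfolding eventually_at
      proof (intro exI[of _ "min \<rho>1 \<rho>2"] conjI ballI impI)
        fix x :: 'a assume x: "x \<noteq> 0 \<and> dist x 0 < min \<rho>1 \<rho>2"
        then have "u x \<le> Fi (\<epsilon> / norm x ^ ?N)" "0 < Fi (\<epsilon> / norm x ^ ?N)"
          using \<rho>1(3)[of x] Fi_pos[of "norm x"] by auto
        then show "ereal (u x / Fi (\<epsilon> / norm x ^ ?N)) \<le> 1"
          by (simp add: one_ereal_def)
      qed (use \<rho>1 \<rho>2 in auto)
    qed
    show "1 \<le> Limsup (at 0) (\<lambda>x::'a. ereal (u x / Fi (\<epsilon> / norm x ^ ?N)))"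
    proof (rule ccontr)
      assume "\<not> ?thesis"
      from ereal_dense2[OF this[unfolded not_le]] obtain \<mu>0 where \<mu>0: "Limsup (at 0) (\<lambda>x::'a. ereal (u x / Fi (\<epsilon> / norm x ^ ?N))) < ereal \<mu>0" "ereal \<mu>0 < 1"
        by blast
      \<comment> \<open>\<open>\<mu>0\<close> may fail to be positive, while the dilation factor
        1/\<mu> has to be finite and greater than 1.\<close>
      define \<mu> where "\<mu> = max \<mu>0 (1 / 2)"
      have \<mu>: "0 < \<mu>" "\<mu> < 1" "\<mu>0 \<le> \<mu>" using \<mu>0(2) by (auto simp: \<mu>_def one_ereal_def)
      have "\<forall>\<^sub>F x::'a in at 0. u x / Fi (\<epsilon> / norm x ^ ?N) < \<mu>0"
        using Limsup_lessD[OF \<mu>0(1)] by simp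
      then obtain \<rho>3 where \<rho>3: "0 < \<rho>3" "\<And>x::'a. x \<noteq> 0 \<Longrightarrow> norm x < \<rho>3 \<Longrightarrow> u x / Fi (\<epsilon> / norm x ^ ?N) < \<mu>0"
        by (auto simp: eventually_at)
      define \<rho> where "\<rho> = min \<rho>1 (min \<rho>2 \<rho>3)"
      have \<rho>: "0 < \<rho>" "\<rho> < R" using \<rho>1 \<rho>2 \<rho>3 by (auto simp: \<rho>_def)
      show False
      proof (rule no_small_power_bound[OF \<alpha>0 \<mu>(1,2) _ \<rho>])
        show "0 < (c * \<epsilon>) powr \<mu>" using c \<epsilon> by simp
        fix r assume r: "0 < r" "r < \<rho>"
        have rR: "r < R" and r2: "r < \<rho>2" using r \<rho> by (auto simp: \<rho>_def)
        let ?y = "\<epsilon> / r ^ ?N"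
        have pos: "0 < Fi ?y" by (rule Fi_pos[OF r(1) r2])
        have "v r / Fi ?y < \<mu>0"
          using \<rho>3(2)[of "r *\<^sub>R e"] r e nonzero_Basis[OF e] unfolding v_def by (simp add: \<rho>_def)
        then have "v r / Fi ?y \<le> \<mu>" using \<mu>(3) by simp
        then have "v r \<le> \<mu> * Fi ?y" using pos by (simp add: pos_divide_le_eq)
        \<comment> \<open>The gap in the upper limit leaves room to dilate v(r) by \<lambda> =
          1/\<mu> and still stay below \<open>Fi ?y\<close>.\<close>
        then have scaled: "1 / \<mu> * v r \<le> Fi ?y" using \<mu> by (simp add: pos_divide_le_eq mult.commute)
        have v0: "0 \<le> v r" by (rule v_nn[OF r(1) rR])
        have "f (1 / \<mu> * v r) \<le> F (1 / \<mu> * v r)"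
          unfolding F_def using \<kappa> v0 \<mu> by simp
        also have "\<dots> \<le> F (Fi ?y)"
          by (rule F_le[OF _ scaled]) (use v0 \<mu> in simp)
        also have "\<dots> = ?y"
          using Fi(2)[OF less_imp_le[OF \<rho>2(2)[OF r(1) r2]]] .
        finally have f_le: "f (1 / \<mu> * v r) \<le> ?y" .
        have "f (v r) powr (1 / \<mu>) \<le> c * f (1 / \<mu> * v r)"
          using scaling[of "1 / \<mu>" "v r"] \<mu> v0 by simp
        also have "\<dots> \<le> c * ?y" using f_le c by (intro mult_left_mono) auto
        finally have *: "f (v r) powr (1 / \<mu>) \<le> c * ?y" .
        \<comment> \<open>Undoing the power 1/\<mu> is what turns r^(-N) into r^(-N \<mu>).\<close>
        have "f (v r) = (f (v r) powr (1 / \<mu>)) powr \<mu>"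
          using f_nonneg[OF v0] \<mu> by (simp add: powr_powr)
        also have "\<dots> \<le> (c * ?y) powr \<mu>"
          using * \<mu> by (intro powr_mono2) auto
        also have "c * ?y = (c * \<epsilon>) * r powr (- real (Suc n))"
          using r unfolding Sn by (simp add: powr_minus powr_realpow divide_inverse)
        also have "\<dots> powr \<mu> = (c * \<epsilon>) powr \<mu> * r powr (- (real (Suc n) * \<mu>))"
          using c \<epsilon> r by (simp only: powr_mult powr_powr mult_minus_left)
        finally show "f (v r) \<le> (c * \<epsilon>) powr \<mu> * r powr (- (real (Suc n) * \<mu>))" .
      qed
    qed
  qed
  show ?thesis
    using upper limsup unfolding Fi_def by blast
qed

end
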